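(* Let $E,F$ be finite, essential, strongly connected graphs that satisfy Condition (L), and let $R$ be a unital subring of $\mathbb C$ closed under complex conjugation. If $\phi\colon L_R(E)\to L_R(F)$ is a $*$-isomorphism with $\phi(\mathcal D(L_R(E)))\subseteq\mathcal D(L_R(F))$, then $\operatorname{sgn}(\det(I-A_E))=\operatorname{sgn}(\det(I-A_F))$.
   Context: A graph $E=(E^0,E^1,r,s)$ has vertices $E^0$, edges $E^1$, and range and source maps $r,s$. A path is a word $e_1\cdots e_n$ with $r(e_i)=s(e_{i+1})$; vertices are paths of length $0$; $E^*$ is the set of finite paths. The adjacency matrix $A_E$ is the $E^0\times E^0$ matrix with $A_E(v,w)=|s^{-1}(v)\cap r^{-1}(w)|$. $E$ is strongly connected if there is a path between any two vertices; essential if it has no sinks or sources; and satisfies Condition (L) if every cycle has an exit. The Leavitt path algebra $L_R(E)$ is the universal $R$-algebra generated by pairwise orthogonal idempotents $\{v\}_{v\in E^0}$ and $\{e,e^*\}_{e\in E^1}$ with: $e^*f=0$ for $e\ne f$; $e^*e=r(e)$; $s(e)e=e=er(e)$; $e^*s(e)=e^*=r(e)e^*$; and $v=\sum_{e\in s^{-1}(v)}ee^*$ whenever $s^{-1}(v)$ is finite and nonempty. For $\alpha=e_1\cdots e_n$ put $\alpha^*=e_n^*\cdots e_1^*$. $L_R(E)$ carries the conjugate-linear involution $(\lambda\alpha\beta^* )^*=\overline\lambda\beta\alpha^*$. Its diagonal is $\mathcal D(L_R(E))=\mathrm{span}_R\{\alpha\alpha^*\mid\alpha\in E^*\}$. 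*)

theory Defs
  imports Complex_Main "HOL-Combinatorics.Permutations"
begin

section \<open>Graphs\<close>

record ('v,'e) graph =
  verts :: "'v set"
  edges :: "'e set"
  src   :: "'e \<Rightarrow> 'v"
  rng   :: "'e \<Rightarrow> 'v"

definition finite_graph :: "('v,'e) graph \<Rightarrow> bool" where
  "finite_graph G \<longleftrightarrow> finite (verts G) \<and> finite (edges G) \<and>
     (\<forall>e\<in>edges G. src G e \<in> verts G \<and> rng G e \<in> verts G)"

text \<open>no sinks and no sources\<close>
definition essential :: "('v,'e) graph \<Rightarrow> bool" where
  "essential G \<longleftrightarrow> (\<forall>v\<in>verts G. (\<exists>e\<in>edges G. src G e = v) \<and> (\<exists>e\<in>edges G. rng G e = v))"

definition edge_rel :: "('v,'e) graph \<Rightarrow> ('v \<times> 'v) set" where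
  "edge_rel G = {(src G e, rng G e) | e. e \<in> edges G}"

definition strongly_connected :: "('v,'e) graph \<Rightarrow> bool" where
  "strongly_connected G \<longleftrightarrow> (\<forall>v\<in>verts G. \<forall>w\<in>verts G. (v, w) \<in> (edge_rel G)\<^sup>*)"

definition is_edge_path :: "('v,'e) graph \<Rightarrow> 'e list \<Rightarrow> bool" where
  "is_edge_path G es \<longleftrightarrow> es \<noteq> [] \<and> set es \<subseteq> edges G \<and>
     (\<forall>i. Suc i < length es \<longrightarrow> rng G (es ! i) = src G (es ! Suc i))"

text \<open>A cycle: a closed path whose vertices s(e_i) are pairwise distinct.\<close>
definition is_cycle :: "('v,'e) graph \<Rightarrow> 'e list \<Rightarrow> bool" where
  "is_cycle G es \<longleftrightarrow> is_edge_path G es \<and> rng G (last es) = src G (hd es) \<and>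
     distinct (map (src G) es)"

definition condition_L :: "('v,'e) graph \<Rightarrow> bool" where
  "condition_L G \<longleftrightarrow> (\<forall>es. is_cycle G es \<longrightarrow>
     (\<exists>i<length es. \<exists>f\<in>edges G. src G f = src G (es ! i) \<and> f \<noteq> es ! i))"

text \<open>Finite paths: vertices (length 0) or nonempty edge paths.\<close>
definition is_path :: "('v,'e) graph \<Rightarrow> 'v + 'e list \<Rightarrow> bool" where
  "is_path G \<alpha> = (case \<alpha> of Inl v \<Rightarrow> v \<in> verts G | Inr es \<Rightarrow> is_edge_path G es)"

section \<open>Adjacency matrix and det(I - A)\<close>

definition adj :: "('v,'e) graph \<Rightarrow> 'v \<Rightarrow> 'v \<Rightarrow> int" where
  "adj G v w = int (card {e \<in> edges G. src G e = v \<and> rng G e = w})"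

text \<open>Leibniz formula for det(I - A_E), the matrix being indexed by the finite set E^0.\<close>
definition det_I_minus_adj :: "('v,'e) graph \<Rightarrow> int" where
  "det_I_minus_adj G = (\<Sum>p | p permutes verts G.
      sign p * (\<Prod>v\<in>verts G. (if p v = v then 1 else 0) - adj G v (p v)))"

section \<open>Free non-unital algebra on the generators v, e, e*\<close>

datatype ('v,'e) gen = GV 'v | GE 'e | GS 'e

type_synonym ('v,'e) ncp = "('v,'e) gen list \<Rightarrow> complex"

definition gens :: "('v,'e) graph \<Rightarrow> ('v,'e) gen set" where
  "gens G = GV ` verts G \<union> GE ` edges G \<union> GS ` edges G"

text \<open>Noncommutative polynomials (without constant term) with coefficients in R.\<close>
definition ncpoly :: "complex set \<Rightarrow> ('v,'e) graph \<Rightarrow> ('v,'e) ncp set" where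
  "ncpoly R G = {p. finite {w. p w \<noteq> 0} \<and> p [] = 0 \<and> (\<forall>w. p w \<in> R) \<and>
                   (\<forall>w. p w \<noteq> 0 \<longrightarrow> set w \<subseteq> gens G)}"

definition pzero :: "('v,'e) ncp" where "pzero = (\<lambda>w. 0)"
definition padd :: "('v,'e) ncp \<Rightarrow> ('v,'e) ncp \<Rightarrow> ('v,'e) ncp" where
  "padd p q = (\<lambda>w. p w + q w)"
definition psub :: "('v,'e) ncp \<Rightarrow> ('v,'e) ncp \<Rightarrow> ('v,'e) ncp" where
  "psub p q = (\<lambda>w. p w - q w)"
definition psmult :: "complex \<Rightarrow> ('v,'e) ncp \<Rightarrow> ('v,'e) ncp" where
  "psmult c p = (\<lambda>w. c * p w)"
definition pmul :: "('v,'e) ncp \<Rightarrow> ('v,'e) ncp \<Rightarrow> ('v,'e) ncp" where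
  "pmul p q = (\<lambda>w. \<Sum>i\<in>{0..length w}. p (take i w) * q (drop i w))"
definition psum :: "'a set \<Rightarrow> ('a \<Rightarrow> ('v,'e) ncp) \<Rightarrow> ('v,'e) ncp" where
  "psum S f = (\<lambda>w. \<Sum>x\<in>S. f x w)"
definition mono :: "('v,'e) gen list \<Rightarrow> ('v,'e) ncp" where
  "mono u = (\<lambda>w. if w = u then 1 else 0)"

fun gstar :: "('v,'e) gen \<Rightarrow> ('v,'e) gen" where
  "gstar (GV v) = GV v" | "gstar (GE e) = GS e" | "gstar (GS e) = GE e"

text \<open>Conjugate-linear anti-involution: v* = v, e <-> e*.\<close>
definition pstar :: "('v,'e) ncp \<Rightarrow> ('v,'e) ncp" where
  "pstar p = (\<lambda>w. cnj (p (map gstar (rev w))))"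

section \<open>The Leavitt path algebra as a quotient\<close>

definition lpa_rels :: "('v,'e) graph \<Rightarrow> ('v,'e) ncp set" where
  "lpa_rels G =
     {psub (mono [GV v, GV v]) (mono [GV v]) | v. v \<in> verts G}
   \<union> {mono [GV v, GV w] | v w. v \<in> verts G \<and> w \<in> verts G \<and> v \<noteq> w}
   \<union> {mono [GS e, GE f] | e f. e \<in> edges G \<and> f \<in> edges G \<and> e \<noteq> f}
   \<union> {psub (mono [GS e, GE e]) (mono [GV (rng G e)]) | e. e \<in> edges G}
   \<union> {psub (mono [GV (src G e), GE e]) (mono [GE e]) | e. e \<in> edges G}
   \<union> {psub (mono [GE e, GV (rng G e)]) (mono [GE e]) | e. e \<in> edges G}
   \<union> {psub (mono [GS e, GV (src G e)]) (mono [GS e]) | e. e \<in> edges G}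
   \<union> {psub (mono [GV (rng G e), GS e]) (mono [GS e]) | e. e \<in> edges G}
   \<union> {psub (mono [GV v]) (psum {e \<in> edges G. src G e = v} (\<lambda>e. mono [GE e, GS e])) | v.
        v \<in> verts G \<and> finite {e \<in> edges G. src G e = v} \<and> {e \<in> edges G. src G e = v} \<noteq> {}}"

text \<open>The two-sided R-ideal generated by the relations.\<close>
inductive_set lpa_ideal :: "complex set \<Rightarrow> ('v,'e) graph \<Rightarrow> ('v,'e) ncp set"
  for R :: "complex set" and G :: "('v,'e) graph" where
  rel:  "p \<in> lpa_rels G \<Longrightarrow> p \<in> lpa_ideal R G"
| zero: "pzero \<in> lpa_ideal R G"
| add:  "p \<in> lpa_ideal R G \<Longrightarrow> q \<in> lpa_ideal R G \<Longrightarrow> padd p q \<in> lpa_ideal R G"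
| smul: "c \<in> R \<Longrightarrow> p \<in> lpa_ideal R G \<Longrightarrow> psmult c p \<in> lpa_ideal R G"
| lmul: "set u \<subseteq> gens G \<Longrightarrow> p \<in> lpa_ideal R G \<Longrightarrow> pmul (mono u) p \<in> lpa_ideal R G"
| rmul: "set u \<subseteq> gens G \<Longrightarrow> p \<in> lpa_ideal R G \<Longrightarrow> pmul p (mono u) \<in> lpa_ideal R G"

definition lpa_cls :: "complex set \<Rightarrow> ('v,'e) graph \<Rightarrow> ('v,'e) ncp \<Rightarrow> ('v,'e) ncp set" where
  "lpa_cls R G p = {q \<in> ncpoly R G. psub p q \<in> lpa_ideal R G}"

text \<open>Carrier of L_R(G): equivalence classes.\<close>
definition lpa :: "complex set \<Rightarrow> ('v,'e) graph \<Rightarrow> ('v,'e) ncp set set" where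
  "lpa R G = lpa_cls R G ` ncpoly R G"

definition rep :: "('v,'e) ncp set \<Rightarrow> ('v,'e) ncp" where
  "rep A = (SOME p. p \<in> A)"

definition lpa_add :: "complex set \<Rightarrow> ('v,'e) graph \<Rightarrow> ('v,'e) ncp set \<Rightarrow> ('v,'e) ncp set \<Rightarrow> ('v,'e) ncp set" where
  "lpa_add R G A B = lpa_cls R G (padd (rep A) (rep B))"
definition lpa_mul :: "complex set \<Rightarrow> ('v,'e) graph \<Rightarrow> ('v,'e) ncp set \<Rightarrow> ('v,'e) ncp set \<Rightarrow> ('v,'e) ncp set" where
  "lpa_mul R G A B = lpa_cls R G (pmul (rep A) (rep B))"
definition lpa_smult :: "complex set \<Rightarrow> ('v,'e) graph \<Rightarrow> complex \<Rightarrow> ('v,'e) ncp set \<Rightarrow> ('v,'e) ncp set" where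
  "lpa_smult R G c A = lpa_cls R G (psmult c (rep A))"
definition lpa_star :: "complex set \<Rightarrow> ('v,'e) graph \<Rightarrow> ('v,'e) ncp set \<Rightarrow> ('v,'e) ncp set" where
  "lpa_star R G A = lpa_cls R G (pstar (rep A))"

section \<open>Diagonal\<close>

fun path_word :: "'v + 'e list \<Rightarrow> ('v,'e) gen list" where
  "path_word (Inl v) = [GV v]"
| "path_word (Inr es) = map GE es"

definition diag_polys :: "complex set \<Rightarrow> ('v,'e) graph \<Rightarrow> ('v,'e) ncp set" where
  "diag_polys R G = {psum S (\<lambda>\<alpha>. psmult (c \<alpha>) (pmul (mono (path_word \<alpha>)) (pstar (mono (path_word \<alpha>)))))
       | S c. finite S \<and> S \<subseteq> {\<alpha>. is_path G \<alpha>} \<and> (\<forall>\<alpha>. c \<alpha> \<in> R)}"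

definition lpa_diag :: "complex set \<Rightarrow> ('v,'e) graph \<Rightarrow> ('v,'e) ncp set set" where
  "lpa_diag R G = lpa_cls R G ` diag_polys R G"

section \<open>*-isomorphisms\<close>

definition star_iso :: "complex set \<Rightarrow> ('v,'e) graph \<Rightarrow> ('w,'f) graph
     \<Rightarrow> (('v,'e) ncp set \<Rightarrow> ('w,'f) ncp set) \<Rightarrow> bool" where
  "star_iso R E F \<phi> \<longleftrightarrow> bij_betw \<phi> (lpa R E) (lpa R F) \<and>
     (\<forall>A\<in>lpa R E. \<forall>B\<in>lpa R E.
        \<phi> (lpa_add R E A B) = lpa_add R F (\<phi> A) (\<phi> B) \<and>
        \<phi> (lpa_mul R E A B) = lpa_mul R F (\<phi> A) (\<phi> B)) \<and>
     (\<forall>c\<in>R. \<forall>A\<in>lpa R E. \<phi> (lpa_smult R E c A) = lpa_smult R F c (\<phi> A)) \<and>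
     (\<forall>A\<in>lpa R E. \<phi> (lpa_star R E A) = lpa_star R F (\<phi> A))"

definition conj_closed_unital_subring :: "complex set \<Rightarrow> bool" where
  "conj_closed_unital_subring R \<longleftrightarrow> 0 \<in> R \<and> 1 \<in> R \<and>
     (\<forall>x\<in>R. \<forall>y\<in>R. x + y \<in> R \<and> x * y \<in> R) \<and> (\<forall>x\<in>R. - x \<in> R) \<and> (\<forall>x\<in>R. cnj x \<in> R)"

end

theory Submission
  imports "HOL-Complex_Analysis.Complex_Analysis" "Jordan_Normal_Form.Schur_Decomposition"
    "HOL-Library.Stream" Defs
begin

text \<open>Let \<open>X\<close> be the space of one-sided infinite paths of a graph. The Leavitt path algebra acts on
  functions on \<open>X\<close>, each word in the generators acting by a partial injection that replaces prefixes.
  Under Condition (L) aperiodic paths are dense; evaluating at them shows that the action is faithful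
  and that the diagonal is its own commutant, so that \<open>\<phi>\<close> maps the diagonal of \<open>E\<close> onto that of \<open>F\<close>.
  Points of \<open>X\<close> are the characters of the diagonal, hence \<open>\<phi>\<close> induces a bijection between the path
  spaces, and the normal form of \<open>\<phi> e\<close> for an edge \<open>e\<close> shows that it turns shifts into locally constant
  prefix replacements (continuous orbit equivalence). The length difference of these replacements is a
  locally constant function \<open>lag\<close> on the paths of \<open>E\<close>.

  As a shift by a period is locally expanding, the sum of \<open>lag\<close> over a periodic orbit of \<open>E\<close> is exactly the
  length of the corresponding periodic orbit of \<open>F\<close>. Therefore the zeta function of \<open>E\<close> weighted by
  \<open>t ^ lag\<close> equals the zeta function of \<open>F\<close>, that is \<open>det (I - A\<^sub>E(t)) = det (I - t A\<^sub>F)\<close> for small \<open>t > 0\<close>, where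
  \<open>A\<^sub>E(t)\<close> is a weighted adjacency matrix of a higher block graph of \<open>E\<close>. Analytic continuation to
  \<open>t = 1\<close> gives \<open>det (I - A\<^sub>E) = det (I - A\<^sub>F)\<close>.\<close>

section \<open>Infinite paths\<close>

text \<open>Three points shape the details. Functions are pulled back along partial maps, so the
  leftmost letter of a word moves the point first; with this order words compose as in the algebra.
  Secondly, the points alone do not determine a lag: at an eventually periodic point two prefixes of
  different lengths may be followed by the same tail. The lag is therefore a locally constant choice
  read off from normal forms, unique only at aperiodic points, and facts about periodic points come
  from comparison with aperiodic points nearby. Thirdly, \<open>lag\<close> may be negative, so a
  small t neither makes the weights on \<open>E\<close> small nor bounds the spectral radius of the
  weighted matrix. Convergence is imported from \<open>F\<close>: all terms are nonnegative, so the
  sum survives the rearrangement of the series over periodic orbits. This is why the determinant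
  formula assumes only absolute summability of the traces and has to reach the boundary of the disc.
  Continuation to 1 is used twice, once to remove the weights and once to compare a block graph with
  its graph.\<close>

definition ipaths :: "('v,'e) graph \<Rightarrow> 'e stream set" where
  "ipaths G = {x. \<forall>n. x !! n \<in> edges G \<and> rng G (x !! n) = src G (x !! Suc n)}"

definition source :: "('v,'e) graph \<Rightarrow> 'e stream \<Rightarrow> 'v" where
  "source G x = src G (shd x)"

text \<open>Both endpoints are recorded because empty prefixes occur throughout, and a list of edges
  does not say where an empty path sits.\<close>

fun fpath :: "('v,'e) graph \<Rightarrow> 'v \<Rightarrow> 'e list \<Rightarrow> 'v \<Rightarrow> bool" where
  "fpath G v [] w \<longleftrightarrow> v = w"
| "fpath G v (e # es) w \<longleftrightarrow> e \<in> edges G \<and> src G e = v \<and> fpath G (rng G e) es w"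

lemma source_Stream [simp]: "source G (e ## x) = src G e"
  by (simp add: source_def)

lemma ipaths_Stream:
  "e ## x \<in> ipaths G \<longleftrightarrow> e \<in> edges G \<and> rng G e = source G x \<and> x \<in> ipaths G"
proof
  assume *: "e ## x \<in> ipaths G"
  have "(e ## x) !! n \<in> edges G \<and> rng G ((e ## x) !! n) = src G ((e ## x) !! Suc n)" for n
    using * by (simp only: ipaths_def mem_Collect_eq)
  from this[of 0] this[of "Suc n" for n]
  show "e \<in> edges G \<and> rng G e = source G x \<and> x \<in> ipaths G"
    by (auto simp: ipaths_def source_def)
next
  assume *: "e \<in> edges G \<and> rng G e = source G x \<and> x \<in> ipaths G"
  have "(e ## x) !! n \<in> edges G \<and> rng G ((e ## x) !! n) = src G ((e ## x) !! Suc n)" for n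
    using * by (cases n) (auto simp: ipaths_def source_def)
  then show "e ## x \<in> ipaths G" by (simp add: ipaths_def)
qed

lemma ipaths_stl: "x \<in> ipaths G \<Longrightarrow> stl x \<in> ipaths G"
  by (metis ipaths_Stream stream.collapse)

lemma ipaths_sdrop: "x \<in> ipaths G \<Longrightarrow> sdrop n x \<in> ipaths G"
  by (induction n arbitrary: x) (auto simp: ipaths_stl)

lemma ipaths_shd: "x \<in> ipaths G \<Longrightarrow> shd x \<in> edges G"
  by (metis ipaths_Stream stream.collapse)

lemma ipaths_rng_shd: "x \<in> ipaths G \<Longrightarrow> rng G (shd x) = source G (stl x)"
  by (metis ipaths_Stream stream.collapse)

lemma source_in_verts: "finite_graph G \<Longrightarrow> x \<in> ipaths G \<Longrightarrow> source G x \<in> verts G"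
  by (auto simp: finite_graph_def source_def dest: ipaths_shd)

lemma fpath_source: "fpath G v \<alpha> (source G z) \<Longrightarrow> source G (\<alpha> @- z) = v"
  by (cases \<alpha>) auto

lemma shift_ipaths_iff:
  "\<alpha> @- z \<in> ipaths G \<longleftrightarrow> z \<in> ipaths G \<and> fpath G (source G (\<alpha> @- z)) \<alpha> (source G z)"
proof (induction \<alpha>)
  case (Cons e \<alpha>)
  then show ?case using fpath_source[of G "rng G e" \<alpha> z] by (auto simp: ipaths_Stream)
qed auto

lemma fpath_shift_ipaths: "fpath G v \<alpha> (source G z) \<Longrightarrow> z \<in> ipaths G \<Longrightarrow> \<alpha> @- z \<in> ipaths G"
  using fpath_source shift_ipaths_iff by metis

lemma fpath_stake: "x \<in> ipaths G \<Longrightarrow> fpath G (source G x) (stake n x) (source G (sdrop n x))"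
  using shift_ipaths_iff[of "stake n x" "sdrop n x" G] by (simp add: stake_sdrop)

lemma fpath_append: "fpath G v (\<alpha> @ \<beta>) w \<longleftrightarrow> (\<exists>u. fpath G v \<alpha> u \<and> fpath G u \<beta> w)"
  by (induction \<alpha> arbitrary: v) auto

lemma fpath_set: "fpath G v \<alpha> w \<Longrightarrow> set \<alpha> \<subseteq> edges G"
  by (induction \<alpha> arbitrary: v) auto

lemma fpath_end_unique: "fpath G v \<alpha> w \<Longrightarrow> fpath G v' \<alpha> w' \<Longrightarrow> \<alpha> \<noteq> [] \<Longrightarrow> v = v' \<and> w = w'"
proof (induction \<alpha> arbitrary: v v')
  case (Cons e \<alpha>)
  then show ?case by (cases \<alpha>) auto
qed simp

lemma fpath_imp_is_edge_path: "fpath G v \<alpha> w \<Longrightarrow> \<alpha> \<noteq> [] \<Longrightarrow> is_edge_path G \<alpha>"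
proof (induction \<alpha> arbitrary: v)
  case (Cons e \<alpha>)
  show ?case
  proof (cases \<alpha>)
    case Nil
    then show ?thesis using Cons.prems by (simp add: is_edge_path_def)
  next
    case (Cons f \<beta>)
    then have "is_edge_path G \<alpha>" using Cons.IH Cons.prems(1) by auto
    then show ?thesis using Cons Cons.prems
      by (auto simp: is_edge_path_def nth_Cons split: nat.splits)
  qed
qed simp

lemma fpath_ends: "fpath G v \<alpha> w \<Longrightarrow> \<alpha> \<noteq> [] \<Longrightarrow> src G (hd \<alpha>) = v \<and> rng G (last \<alpha>) = w"
  by (induction \<alpha> arbitrary: v) (auto split: if_splits)

lemma finite_fpaths: "finite (edges G) \<Longrightarrow> finite {\<alpha>. length \<alpha> = n \<and> (\<exists>v w. fpath G v \<alpha> w)}"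
  by (rule finite_subset[OF _ finite_lists_length_eq[of "edges G" n]]) (auto dest: fpath_set)

section \<open>Eventually periodic streams and uniqueness of lags\<close>

definition eper :: "'e stream \<Rightarrow> bool" where
  "eper x \<longleftrightarrow> (\<exists>m n. m \<noteq> n \<and> sdrop m x = sdrop n x)"

lemma eper_alt: "eper x \<longleftrightarrow> (\<exists>m k. k > 0 \<and> sdrop k (sdrop m x) = sdrop m x)"
proof
  assume "eper x"
  then obtain m n where "m < n" "sdrop m x = sdrop n x"
    unfolding eper_def by (metis nat_neq_iff)
  then have "n - m > 0" "sdrop (n - m) (sdrop m x) = sdrop m x"
    by (simp, metis less_imp_add_positive sdrop_add diff_add_inverse)
  then show "\<exists>m k. k > 0 \<and> sdrop k (sdrop m x) = sdrop m x" by blast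
next
  assume "\<exists>m k. k > 0 \<and> sdrop k (sdrop m x) = sdrop m x"
  then obtain m k where "k > 0" "sdrop (m + k) x = sdrop m x" by auto
  then show "eper x" unfolding eper_def by (intro exI[of _ "m + k"] exI[of _ m]) auto
qed

lemma eper_sdrop [simp]: "eper (sdrop n x) \<longleftrightarrow> eper x"
proof
  assume "eper (sdrop n x)"
  then obtain a b where "a \<noteq> b" "sdrop (n + a) x = sdrop (n + b) x"
    by (auto simp: eper_def add.commute)
  then show "eper x" unfolding eper_def by (metis add_left_cancel)
next
  assume "eper x"
  then obtain a b where ab: "a \<noteq> b" "sdrop a x = sdrop b x" by (auto simp: eper_def)
  then have "sdrop a (sdrop n x) = sdrop b (sdrop n x)"
    by (metis add.commute sdrop_add)
  then show "eper (sdrop n x)" using ab by (auto simp: eper_def)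
qed

lemma eper_shift [simp]: "eper (\<alpha> @- z) \<longleftrightarrow> eper z"
  using eper_sdrop[of "length \<alpha>" "\<alpha> @- z"] by (simp add: sdrop_shift)

text \<open>Shifting the first relation by \<open>d\<close> and the second by \<open>b\<close> leads
  to the same tail of \<open>x'\<close>, so \<open>a + d\<close> and \<open>c + b\<close> shift
  \<open>x\<close> to the same stream; aperiodicity equates the two numbers.\<close>

lemma lag_unique:
  assumes "\<not> eper x" "sdrop a x = sdrop b x'" "sdrop c x = sdrop d x'"
  shows "int a - int b = int c - int d"
proof (rule ccontr)
  assume *: "int a - int b \<noteq> int c - int d"
  have "sdrop (a + d) x = sdrop d (sdrop b x')" using assms(2) by (metis sdrop_add)
  also have "\<dots> = sdrop b (sdrop d x')" by (simp add: add.commute)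
  also have "\<dots> = sdrop (c + b) x" using assms(3) by (metis sdrop_add)
  finally have "a + d = c + b" using assms(1) unfolding eper_def by blast
  then show False using * by simp
qed

text \<open>An aperiodic tail remembers its prefix. In this form aperiodicity separates normal words
  and isolates their coefficients.\<close>

lemma shift_eq_aperiodic:
  assumes "\<alpha> @- z = \<beta> @- z" "\<not> eper z"
  shows "\<alpha> = \<beta>"
proof -
  have "sdrop (length \<alpha>) (\<alpha> @- z) = z" "sdrop (length \<beta>) (\<beta> @- z) = z"
    by (simp_all add: sdrop_shift)
  then have "int (length \<alpha>) - int (length \<beta>) = 0 - 0"
    using lag_unique[of "\<alpha> @- z" "length \<alpha>" "length \<beta>" "\<beta> @- z" 0 0] assms by simp
  then have "length \<alpha> = length \<beta>" by simp
  then show ?thesis using arg_cong[OF assms(1), of "stake (length \<alpha>)"] by (simp add: stake_shift)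
qed

lemma stream_eqI: "(\<And>n. x !! n = y !! n) \<Longrightarrow> x = y"
  using smap_alt[of id x y] by (simp add: stream.map_id)

lemma shift_fix_unique:
  assumes "z = u @- z" "z' = u @- z'" "u \<noteq> []"
  shows "z = z'"
proof (rule stream_eqI)
  fix n
  show "z !! n = z' !! n"
  proof (induction n rule: less_induct)
    case (less n)
    have *: "z !! n = (u @- z) !! n" "z' !! n = (u @- z') !! n" using assms by auto
    show ?case
    proof (cases "n < length u")
      case True
      then show ?thesis using * by (simp add: shift_snth)
    next
      case False
      then have "n - length u < n" using assms(3) by (cases u) auto
      then show ?thesis using * False less[of "n - length u"] by (simp add: shift_snth)
    qed
  qed
qed

lemma periodic_eq_cycle:
  assumes "sdrop k z = z" "k > 0"
  shows "z = cycle (stake k z)"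
  by (rule shift_fix_unique[of _ "stake k z"])
     (use assms stake_sdrop[of k z] cycle_decomp[of "stake k z"] in auto)

text \<open>Such a stream is a finite prefix followed by a repeated finite block, and there are only
  countably many pairs of lists over a finite alphabet.\<close>

lemma countable_eper: 
  assumes "finite A"
  shows "countable {x. sset x \<subseteq> A \<and> eper x}"
proof -
  have "{x. sset x \<subseteq> A \<and> eper x} \<subseteq> (\<lambda>(a, b). a @- cycle b) ` (lists A \<times> lists A)"
  proof
    fix x assume x: "x \<in> {x. sset x \<subseteq> A \<and> eper x}"
    then obtain m k where mk: "k > 0" "sdrop k (sdrop m x) = sdrop m x" by (auto simp: eper_alt)
    have "x = stake m x @- cycle (stake k (sdrop m x))"
      using periodic_eq_cycle[OF mk(2,1)] by (metis stake_sdrop)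
    moreover have "set (stake k y) \<subseteq> sset y" for k and y :: "'a stream"
      by (metis Un_upper1 sset_shift stake_sdrop)
    moreover have "sset (sdrop m x) \<subseteq> sset x"
      by (metis Un_upper2 sset_shift stake_sdrop)
    ultimately show "x \<in> (\<lambda>(a, b). a @- cycle b) ` (lists A \<times> lists A)"
      using x by (intro image_eqI[of _ _ "(stake m x, stake k (sdrop m x))"])
        (simp, simp add: lists_eq_set, meson order_trans)
  qed
  moreover have "countable (lists A)" using assms by (simp add: countable_finite)
  ultimately show ?thesis by (meson countable_SIGMA countable_image countable_subset)
qed

section \<open>Infinite paths assembled from blocks, and their number\<close>

lemma flat_blocks_ipaths:
  assumes ab: "\<And>b::bool. h b \<noteq> []" "\<And>b. fpath G u (h b) u"
  shows "flat (smap h c) \<in> ipaths G \<and> source G (flat (smap h c)) = u"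
proof -
  have unf: "flat (smap h c) = h (shd c) @- flat (smap h (stl c))" for c
    using ab(1) flat_unfold[of "smap h c"] by simp
  have src: "source G (w @- flat (smap h c)) = v" if "fpath G v w u" for v w c
  proof (cases w)
    case Nil
    then show ?thesis using that unf[of c] ab(2)[of "shd c"] ab(1)[of "shd c"]
      by (cases "h (shd c)") auto
  qed (use that in auto)
  define P where "P n x \<longleftrightarrow> x !! n \<in> edges G \<and> rng G (x !! n) = src G (x !! Suc n)" for n x
  \<comment> \<open>Removing one edge can exhaust the current block. An empty remainder is traded
    for the next full block, so the induction on \<open>n\<close> always finds an edge to
    remove.\<close>
  have step: "P n (w @- flat (smap h c))"
    if *: "\<And>w v c. fpath G v w u \<Longrightarrow> w \<noteq> [] \<Longrightarrow> P n (w @- flat (smap h c))" and "fpath G v w u"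
    for n v w c
  proof (cases "w = []")
    case True
    then show ?thesis using *[OF ab(2)[of "shd c"] ab(1), of "stl c"] unf[of c] by simp
  qed (use that in blast)
  have "P n (w @- flat (smap h c))" if "fpath G v w u" for n v w c
    using that
  proof (induction n arbitrary: v w c)
    case 0
    show ?case
    proof (rule step[OF _ 0])
      fix w v c assume *: "fpath G v w u" "w \<noteq> []"
      then obtain e w' where "w = e # w'" by (cases w) auto
      then show "P 0 (w @- flat (smap h c))"
        using * src[of "rng G e" w' c] by (auto simp: source_def P_def)
    qed
  next
    case (Suc n)
    show ?case
    proof (rule step[OF _ Suc.prems])
      fix w v c assume *: "fpath G v w u" "w \<noteq> []"
      then obtain e w' where "w = e # w'" by (cases w) auto
      then show "P (Suc n) (w @- flat (smap h c))"
        using * Suc.IH[of "rng G e" w' c] by (auto simp: P_def)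
    qed
  qed
  from this[of u "[]"] src[of u "[]"] show ?thesis by (auto simp: ipaths_def P_def)
qed

text \<open>Blocks of one fixed positive length can be cut off unambiguously, and \<open>h\<close>
  is inverted on each of them.\<close>

lemma flat_blocks_inj:
  assumes ab: "\<And>b. length (h b) = L" "L > 0" "inj h"
  shows "inj (\<lambda>c. flat (smap h c))"
proof
  fix c d assume eq: "flat (smap h c) = flat (smap h d)"
  have ne: "h b \<noteq> []" for b using ab by (metis length_greater_0_conv)
  have unf: "flat (smap h c) = h (shd c) @- flat (smap h (stl c))" for c
    using ne flat_unfold[of "smap h c"] by simp
  have "\<forall>c d. flat (smap h c) = flat (smap h d) \<longrightarrow> c !! n = d !! n" for n
  proof (induction n)
    case 0
    have "stake L (flat (smap h c)) = h (shd c)" for c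
      using unf[of c] by (simp add: stake_shift ab)
    then show ?case using ab(3) by (metis injD snth.simps(1))
  next
    case (Suc n)
    have "sdrop L (flat (smap h c)) = flat (smap h (stl c))" for c
      using unf[of c] by (simp add: sdrop_shift ab)
    then show ?case using Suc by (metis snth.simps(2))
  qed
  then show "c = d" using eq stream_eqI by blast
qed

lemma uncountable_bool_stream: "uncountable (UNIV :: bool stream set)"
proof
  assume *: "countable (UNIV :: bool stream set)"
  have "inj (\<lambda>S::nat set. smap (\<lambda>n. n \<in> S) nats)"
  proof
    fix S T :: "nat set" assume "smap (\<lambda>n. n \<in> S) nats = smap (\<lambda>n. n \<in> T) nats"
    then have "smap (\<lambda>n. n \<in> S) nats !! n = smap (\<lambda>n. n \<in> T) nats !! n" for n by simp
    then show "S = T" by auto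
  qed
  then have "countable (UNIV :: nat set set)"
    using * countable_image_inj_on countable_subset subset_UNIV by metis
  then obtain f :: "nat \<Rightarrow> nat set" where "range f = UNIV"
    by (metis UNIV_not_empty uncountable_def)
  then show False using Cantors_theorem[of "UNIV :: nat set"] by auto
qed

locale good_graph =
  fixes G :: "('v,'e) graph"
  assumes fin: "finite_graph G" and ess: "essential G"
    and conn: "strongly_connected G" and condL: "condition_L G"
begin

lemma finite_edges: "finite (edges G)"
  using fin by (simp add: finite_graph_def)

lemma fpath_exists:
  assumes "v \<in> verts G" "w \<in> verts G"
  shows "\<exists>\<alpha>. fpath G v \<alpha> w"
proof -
  have "(v, w) \<in> (edge_rel G)\<^sup>*" using conn assms by (auto simp: strongly_connected_def)
  then show ?thesis
  proof (induction rule: converse_rtrancl_induct)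
    case base
    show ?case by (rule exI[of _ "[]"]) simp
  next
    case (step y z)
    then obtain \<alpha> e where "fpath G z \<alpha> w" "e \<in> edges G" "y = src G e" "z = rng G e"
      by (auto simp: edge_rel_def)
    then show ?case by (intro exI[of _ "e # \<alpha>"]) auto
  qed
qed

text \<open>A closed path of least length visits no source twice, since the part between two visits
  would be shorter. It is therefore a cycle, and the exit provided by Condition (L) shares its
  source with an edge of the cycle.\<close>

lemma branching_vertex:
  assumes "verts G \<noteq> {}"
  shows "\<exists>e\<in>edges G. \<exists>f\<in>edges G. e \<noteq> f \<and> src G e = src G f"
proof -
  define P where "P n \<longleftrightarrow> n > 0 \<and> (\<exists>v es. length es = n \<and> fpath G v es v)" for n
  obtain v where v: "v \<in> verts G" using assms by blast
  then obtain e where e: "e \<in> edges G" "src G e = v" using ess by (auto simp: essential_def)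
  then have "rng G e \<in> verts G" using fin by (auto simp: finite_graph_def)
  then obtain \<alpha> where "fpath G (rng G e) \<alpha> v" using fpath_exists v by blast
  then have "P (length (e # \<alpha>))" unfolding P_def using e by (intro conjI exI[of _ v] exI[of _ "e # \<alpha>"]) auto
  then have least: "P (LEAST n. P n)" by (rule LeastI)
  then obtain v es where es: "length es = (LEAST n. P n)" "fpath G v es v" "es \<noteq> []"
    unfolding P_def by fastforce
  have "distinct (map (src G) es)"
  proof (rule ccontr)
    assume "\<not> distinct (map (src G) es)"
    then obtain xs y ys zs where "map (src G) es = xs @ [y] @ ys @ [y] @ zs"
      using not_distinct_decomp by blast
    then obtain as e bs f cs where dec: "es = as @ (e # bs) @ f # cs" "src G e = y" "src G f = y"
      by (auto simp: map_eq_append_conv append_eq_map_conv map_eq_Cons_conv)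
    have "\<exists>u u'. fpath G u (e # bs) u' \<and> fpath G u' (f # cs) v"
      using es(2) unfolding dec(1) fpath_append by blast
    then have "fpath G y (e # bs) y" using dec by auto
    then have "P (length (e # bs))" unfolding P_def by blast
    then have "length es \<le> length (e # bs)" using es(1) by (simp only: Least_le)
    then show False using dec(1) by simp
  qed
  then have "is_cycle G es"
    using es fpath_imp_is_edge_path[OF es(2,3)] fpath_ends[OF es(2,3)] by (simp add: is_cycle_def)
  then obtain i f where "i < length es" "f \<in> edges G" "src G f = src G (es ! i)" "f \<noteq> es ! i"
    using condL by (auto simp: condition_L_def)
  moreover have "es ! i \<in> edges G" using fpath_set[OF es(2)] calculation(1) by auto
  ultimately show ?thesis by metis
qed

text \<open>Two different loops at a branching vertex, arranged according to a stream of booleans,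
  give uncountably many paths, of which only countably many are eventually periodic. A finite path
  from \<open>v\<close> leads there.\<close>

lemma aperiodic_exists:
  assumes "v \<in> verts G"
  shows "\<exists>x\<in>ipaths G. source G x = v \<and> \<not> eper x"
proof -
  obtain e f where ef: "e \<in> edges G" "f \<in> edges G" "e \<noteq> f" "src G e = src G f"
    using branching_vertex assms by blast
  define u where "u = src G e"
  have in_v: "u \<in> verts G" "rng G e \<in> verts G" "rng G f \<in> verts G"
    using ef fin by (auto simp: finite_graph_def u_def)
  obtain \<alpha> where \<alpha>: "fpath G (rng G e) \<alpha> u" using fpath_exists in_v by blast
  obtain \<beta> where \<beta>: "fpath G (rng G f) \<beta> u" using fpath_exists in_v by blast
  obtain \<gamma> where \<gamma>: "fpath G v \<gamma> u" using fpath_exists in_v assms by blast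
  \<comment> \<open>Each block runs through both loops, in one of the two orders: the blocks are
    then equally long, and they differ because \<open>e\<close> and \<open>f\<close> do.\<close>
  define h where "h b = (if b then (e # \<alpha>) @ (f # \<beta>) else (f # \<beta>) @ (e # \<alpha>))" for b
  have hp: "fpath G u (h b) u" for b
    using ef \<alpha> \<beta> by (auto simp: h_def u_def fpath_append)
  have hne: "h b \<noteq> []" for b by (simp add: h_def)
  have inj: "inj (\<lambda>c. flat (smap h c))"
    by (rule flat_blocks_inj[of _ "length \<alpha> + length \<beta> + 2"])
       (use ef in \<open>auto simp: h_def inj_def\<close>)
  have path: "flat (smap h c) \<in> ipaths G" "source G (flat (smap h c)) = u" for c
    using flat_blocks_ipaths[of h G u c] hp hne by auto
  have "\<exists>c. \<not> eper (flat (smap h c))"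
  proof (rule ccontr)
    assume "\<not> ?thesis"
    then have "range (\<lambda>c. flat (smap h c)) \<subseteq> {x. sset x \<subseteq> edges G \<and> eper x}"
      using path(1) by (auto simp: sset_range ipaths_def)
    then have "countable (range (\<lambda>c. flat (smap h c)))"
      using countable_eper[OF finite_edges] countable_subset by blast
    then show False using uncountable_bool_stream inj countable_image_inj_on by blast
  qed
  then obtain c where c: "\<not> eper (flat (smap h c))" by blast
  show ?thesis
  proof (intro bexI[of _ "\<gamma> @- flat (smap h c)"] conjI)
    show "source G (\<gamma> @- flat (smap h c)) = v" using \<gamma> path by (intro fpath_source) simp
    show "\<gamma> @- flat (smap h c) \<in> ipaths G" using \<gamma> path fpath_shift_ipaths by metis
  qed (use c in simp)
qed

text \<open>No cylinder is a single point; this excludes the collapse in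
  \<open>periodic_lag_positive\<close>. An eventually periodic path differs from an aperiodic one,
  and an aperiodic path changes when a loop is put in front of it.\<close>

lemma another_path:
  assumes "z \<in> ipaths G"
  shows "\<exists>z'\<in>ipaths G. source G z' = source G z \<and> z' \<noteq> z"
proof (cases "eper z")
  case True
  then show ?thesis using aperiodic_exists[OF source_in_verts[OF fin assms]] by metis
next
  case False
  define v where "v = source G z"
  have v: "v \<in> verts G" using source_in_verts[OF fin assms] by (simp add: v_def)
  then obtain e where e: "e \<in> edges G" "src G e = v" using ess by (auto simp: essential_def)
  then have "rng G e \<in> verts G" using fin by (auto simp: finite_graph_def)
  then obtain \<alpha> where "fpath G (rng G e) \<alpha> v" using fpath_exists v by blast
  then have p: "fpath G v (e # \<alpha>) v" using e by auto
  have "(e # \<alpha>) @- z \<noteq> z"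
    using False shift_eq_aperiodic[of "e # \<alpha>" z "[]"] by auto
  then show ?thesis using p fpath_source[of G v "e # \<alpha>" z] fpath_shift_ipaths[of G v "e # \<alpha>" z] assms
    unfolding v_def by blast
qed

end

section \<open>The action on infinite paths\<close>

text \<open>The maps are meant for pulling functions back, hence \<open>GE e\<close> deletes an edge
  and \<open>GS e\<close> prepends one. The resulting operator of \<open>GE e\<close> sends the
  indicator of \<open>y\<close> to the indicator of \<open>e ## y\<close>.\<close>

fun gact :: "('v,'e) graph \<Rightarrow> ('v,'e) gen \<Rightarrow> 'e stream \<Rightarrow> 'e stream option" where
  "gact G (GV v) x = (if source G x = v then Some x else None)"
| "gact G (GE e) x = (if shd x = e then Some (stl x) else None)"
| "gact G (GS e) x = (if rng G e = source G x then Some (e ## x) else None)"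

fun wact :: "('v,'e) graph \<Rightarrow> ('v,'e) gen list \<Rightarrow> 'e stream \<Rightarrow> 'e stream option" where
  "wact G [] x = Some x"
| "wact G (g # w) x = Option.bind (gact G g x) (wact G w)"

lemma wact_append: "wact G (u @ w) x = Option.bind (wact G u x) (wact G w)"
proof (induction u arbitrary: x)
  case (Cons g u)
  then show ?case by (cases "gact G g x") auto
qed simp

lemma wact_GE: "wact G (map GE \<alpha>) x = (if stake (length \<alpha>) x = \<alpha> then Some (sdrop (length \<alpha>) x) else None)"
  by (induction \<alpha> arbitrary: x) auto

lemma wact_GS: "fpath G v \<beta> (source G z) \<Longrightarrow> wact G (map GS (rev \<beta>)) z = Some (\<beta> @- z)"
  by (induction \<beta> arbitrary: v) (auto simp: wact_append fpath_source)

lemma wact_ipaths: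
  "wact G w x = Some y \<Longrightarrow> x \<in> ipaths G \<Longrightarrow> set w \<subseteq> gens G \<Longrightarrow> y \<in> ipaths G"
proof (induction w arbitrary: x)
  case (Cons g w)
  from Cons.prems obtain x' where x': "gact G g x = Some x'" "wact G w x' = Some y"
    by (auto simp: bind_eq_Some_conv)
  have "x' \<in> ipaths G" using x'(1) Cons.prems
    by (cases g) (auto simp: gens_def ipaths_Stream ipaths_stl split: if_splits)
  then show ?case using Cons.IH x'(2) Cons.prems by simp
qed simp

lemma gact_gstar:
  "gact G g x = Some y \<Longrightarrow> x \<in> ipaths G \<Longrightarrow> gact G (gstar g) y = Some x"
  by (cases g) (auto simp: ipaths_rng_shd split: if_splits)

text \<open>The star of a letter inverts its partial map, and reversal inverts the order of the
  letters. Restricting to paths supplies the range condition that \<open>GE\<close> does not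
  test.\<close>

lemma wact_star:
  "wact G w x = Some y \<Longrightarrow> x \<in> ipaths G \<Longrightarrow> set w \<subseteq> gens G \<Longrightarrow>
    wact G (map gstar (rev w)) y = Some x"
proof (induction w arbitrary: x)
  case (Cons g w)
  from Cons.prems obtain x' where x': "gact G g x = Some x'" "wact G w x' = Some y"
    by (auto simp: bind_eq_Some_conv)
  have "x' \<in> ipaths G" using wact_ipaths[of G "[g]" x x'] x'(1) Cons.prems by simp
  then have "wact G (map gstar (rev w)) y = Some x'" using Cons.IH x'(2) Cons.prems by simp
  then show ?case using gact_gstar[OF x'(1)] Cons.prems by (simp add: wact_append)
qed simp

section \<open>Noncommutative polynomials as operators on functions\<close>

definition lin :: "('v,'e) ncp \<Rightarrow> (('v,'e) gen list \<Rightarrow> complex) \<Rightarrow> complex" where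
  "lin p F = (\<Sum>w | p w \<noteq> 0. p w * F w)"

definition fsupp :: "('v,'e) ncp \<Rightarrow> bool" where
  "fsupp p \<longleftrightarrow> finite {w. p w \<noteq> 0}"

lemma lin_superset: "finite S \<Longrightarrow> {w. p w \<noteq> 0} \<subseteq> S \<Longrightarrow> lin p F = (\<Sum>w\<in>S. p w * F w)"
  unfolding lin_def by (intro sum.mono_neutral_left) auto

lemma fsupp_simps [simp]:
  "fsupp pzero" "fsupp (mono u)"
  "fsupp p \<Longrightarrow> fsupp q \<Longrightarrow> fsupp (padd p q)"
  "fsupp p \<Longrightarrow> fsupp q \<Longrightarrow> fsupp (psub p q)"
  "fsupp p \<Longrightarrow> fsupp (psmult c p)"
proof -
  show "fsupp pzero" "fsupp (mono u)" by (auto simp: fsupp_def pzero_def mono_def)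
  show "fsupp (padd p q)" "fsupp (psub p q)" if "fsupp p" "fsupp q"
    using that unfolding fsupp_def padd_def psub_def
    by (auto intro!: finite_subset[of _ "{w. p w \<noteq> 0} \<union> {w. q w \<noteq> 0}"])
  show "fsupp (psmult c p)" if "fsupp p"
    using that unfolding fsupp_def psmult_def
    by (auto intro!: finite_subset[of _ "{w. p w \<noteq> 0}"])
qed

lemma fsupp_psum: "finite S \<Longrightarrow> (\<And>s. s \<in> S \<Longrightarrow> fsupp (f s)) \<Longrightarrow> fsupp (psum S f)"
  unfolding fsupp_def psum_def
  by (rule finite_subset[of _ "\<Union>s\<in>S. {w. f s w \<noteq> 0}"]) (auto elim: sum.not_neutral_contains_not_neutral)

lemma lin_pzero [simp]: "lin pzero F = 0"
  by (simp add: lin_def pzero_def)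

lemma lin_mono [simp]: "lin (mono u) F = F u"
  by (subst lin_superset[of "{u}"]) (auto simp: mono_def)

lemma lin_padd [simp]:
  assumes "fsupp p" "fsupp q"
  shows "lin (padd p q) F = lin p F + lin q F"
proof -
  let ?S = "{w. p w \<noteq> 0} \<union> {w. q w \<noteq> 0}"
  have fin: "finite ?S" using assms by (simp add: fsupp_def)
  have "lin p F = (\<Sum>w\<in>?S. p w * F w)" "lin q F = (\<Sum>w\<in>?S. q w * F w)"
    "lin (padd p q) F = (\<Sum>w\<in>?S. padd p q w * F w)"
    by (rule lin_superset[OF fin]; auto simp: padd_def)+
  then show ?thesis by (simp add: padd_def algebra_simps sum.distrib)
qed

lemma lin_psub [simp]:
  assumes "fsupp p" "fsupp q"
  shows "lin (psub p q) F = lin p F - lin q F"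
proof -
  let ?S = "{w. p w \<noteq> 0} \<union> {w. q w \<noteq> 0}"
  have fin: "finite ?S" using assms by (simp add: fsupp_def)
  have "lin p F = (\<Sum>w\<in>?S. p w * F w)" "lin q F = (\<Sum>w\<in>?S. q w * F w)"
    "lin (psub p q) F = (\<Sum>w\<in>?S. psub p q w * F w)"
    by (rule lin_superset[OF fin]; auto simp: psub_def)+
  then show ?thesis by (simp add: psub_def algebra_simps sum_subtractf)
qed

lemma lin_psmult [simp]: "fsupp p \<Longrightarrow> lin (psmult c p) F = c * lin p F"
  using lin_superset[of "{w. p w \<noteq> 0}" p F] lin_superset[of "{w. p w \<noteq> 0}" "psmult c p" F]
  by (auto simp: fsupp_def psmult_def algebra_simps sum_distrib_left)

lemma psum_empty [simp]: "psum {} f = pzero"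
  by (simp add: psum_def pzero_def)

lemma psum_insert: "finite S \<Longrightarrow> s \<notin> S \<Longrightarrow> psum (insert s S) f = padd (f s) (psum S f)"
  by (simp add: psum_def padd_def)

lemma lin_psum:
  assumes "finite S" "\<And>s. s \<in> S \<Longrightarrow> fsupp (f s)"
  shows "lin (psum S f) F = (\<Sum>s\<in>S. lin (f s) F)"
  using assms
proof (induction S rule: finite_induct)
  case (insert s S)
  then show ?case by (simp add: psum_insert fsupp_psum)
qed simp

text \<open>Cut positions of \<open>w\<close> are its factorizations into two words. Letting the
  factors range over fixed finite sets prepares the regrouping over all \<open>w\<close> in
  \<open>lin_pmul\<close>.\<close>

lemma pmul_eq_sum_pairs:
  assumes "finite A" "finite B" "{u. p u \<noteq> 0} \<subseteq> A" "{v. q v \<noteq> 0} \<subseteq> B"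
  shows "pmul p q w = (\<Sum>(u, v) | u \<in> A \<and> v \<in> B \<and> u @ v = w. p u * q v)"
proof -
  have fin: "finite {(u, v). u @ v = w}"
  proof (rule finite_subset)
    show "{(u, v). u @ v = w} \<subseteq> (\<lambda>i. (take i w, drop i w)) ` {0..length w}"
    proof
      fix uv assume "uv \<in> {(u, v). u @ v = w}"
      then show "uv \<in> (\<lambda>i. (take i w, drop i w)) ` {0..length w}"
        by (intro image_eqI[of _ _ "length (fst uv)"]) auto
    qed
  qed simp
  have "pmul p q w = (\<Sum>(u, v)\<in>{(u, v). u @ v = w}. p u * q v)"
    unfolding pmul_def
    by (rule sum.reindex_bij_witness[of _ "\<lambda>(u, v). length u" "\<lambda>i. (take i w, drop i w)"]) auto
  also have "\<dots> = (\<Sum>(u, v) | u \<in> A \<and> v \<in> B \<and> u @ v = w. p u * q v)"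
    by (rule sum.mono_neutral_right[OF fin]) (use assms in auto)
  finally show ?thesis .
qed

lemma fsupp_pmul [simp]:
  assumes "fsupp p" "fsupp q"
  shows "fsupp (pmul p q)"
proof -
  let ?A = "{u. p u \<noteq> 0}" and ?B = "{u. q u \<noteq> 0}"
  have "{w. pmul p q w \<noteq> 0} \<subseteq> (\<lambda>(u, v). u @ v) ` (?A \<times> ?B)"
  proof
    fix w assume "w \<in> {w. pmul p q w \<noteq> 0}"
    then have "(\<Sum>(u, v) | u \<in> ?A \<and> v \<in> ?B \<and> u @ v = w. p u * q v) \<noteq> 0"
      using pmul_eq_sum_pairs[of ?A ?B p q w] assms by (auto simp: fsupp_def)
    then obtain uv where "uv \<in> {(u, v). u \<in> ?A \<and> v \<in> ?B \<and> u @ v = w}"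
      by (elim sum.not_neutral_contains_not_neutral)
    then show "w \<in> (\<lambda>(u, v). u @ v) ` (?A \<times> ?B)" by auto
  qed
  then show ?thesis using assms by (auto simp: fsupp_def intro: finite_subset)
qed

lemma lin_pmul:
  assumes "fsupp p" "fsupp q"
  shows "lin (pmul p q) F = lin p (\<lambda>u. lin q (\<lambda>v. F (u @ v)))"
proof -
  let ?A = "{u. p u \<noteq> 0}" and ?B = "{u. q u \<noteq> 0}"
  let ?C = "(\<lambda>(u, v). u @ v) ` (?A \<times> ?B)"
  have fin: "finite ?A" "finite ?B" using assms by (auto simp: fsupp_def)
  have pm: "pmul p q w = (\<Sum>(u, v) | u \<in> ?A \<and> v \<in> ?B \<and> u @ v = w. p u * q v)" for w
    using pmul_eq_sum_pairs[of ?A ?B p q w] fin by auto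
  have "{w. pmul p q w \<noteq> 0} \<subseteq> ?C"
  proof
    fix w assume "w \<in> {w. pmul p q w \<noteq> 0}"
    then have "(\<Sum>(u, v) | u \<in> ?A \<and> v \<in> ?B \<and> u @ v = w. p u * q v) \<noteq> 0"
      using pm by simp
    then obtain uv where "uv \<in> {(u, v). u \<in> ?A \<and> v \<in> ?B \<and> u @ v = w}"
      by (elim sum.not_neutral_contains_not_neutral)
    then show "w \<in> ?C" by auto
  qed
  then have "lin (pmul p q) F = (\<Sum>w\<in>?C. pmul p q w * F w)"
    using fin by (intro lin_superset) auto
  also have "\<dots> = (\<Sum>w\<in>?C. \<Sum>uv\<in>{uv \<in> ?A \<times> ?B. (\<lambda>(u, v). u @ v) uv = w}. p (fst uv) * q (snd uv) * F (fst uv @ snd uv))"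
  proof (rule sum.cong[OF refl])
    fix w
    have "{uv \<in> ?A \<times> ?B. (\<lambda>(u, v). u @ v) uv = w} = {(u, v). u \<in> ?A \<and> v \<in> ?B \<and> u @ v = w}" by auto
    then show "pmul p q w * F w = (\<Sum>uv\<in>{uv \<in> ?A \<times> ?B. (\<lambda>(u, v). u @ v) uv = w}. p (fst uv) * q (snd uv) * F (fst uv @ snd uv))"
      unfolding pm sum_distrib_right by (intro sum.cong) (auto simp: algebra_simps)
  qed
  also have "\<dots> = (\<Sum>uv\<in>?A \<times> ?B. p (fst uv) * q (snd uv) * F (fst uv @ snd uv))"
    using fin by (intro sum.group) auto
  also have "\<dots> = (\<Sum>u\<in>?A. \<Sum>v\<in>?B. p u * q v * F (u @ v))"
    by (simp add: sum.cartesian_product case_prod_beta)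
  also have "\<dots> = lin p (\<lambda>u. lin q (\<lambda>v. F (u @ v)))"
    by (simp add: lin_def sum_distrib_left algebra_simps)
  finally show ?thesis .
qed

definition opr :: "('v,'e) graph \<Rightarrow> ('v,'e) ncp \<Rightarrow> ('e stream \<Rightarrow> complex) \<Rightarrow> 'e stream \<Rightarrow> complex" where
  "opr G p \<xi> x = lin p (\<lambda>w. case wact G w x of None \<Rightarrow> 0 | Some y \<Rightarrow> \<xi> y)"

lemma opr_mono: "opr G (mono u) \<xi> x = (case wact G u x of None \<Rightarrow> 0 | Some y \<Rightarrow> \<xi> y)"
  by (simp add: opr_def)

lemma opr_pmul: "fsupp p \<Longrightarrow> fsupp q \<Longrightarrow> opr G (pmul p q) \<xi> x = opr G p (opr G q \<xi>) x"
  unfolding opr_def lin_pmul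
  by (rule arg_cong[of _ _ "lin p"]) (auto simp: fun_eq_iff wact_append lin_def split: option.splits)

lemma opr_lin [simp]:
  "opr G pzero \<xi> x = 0"
  "fsupp p \<Longrightarrow> fsupp q \<Longrightarrow> opr G (padd p q) \<xi> x = opr G p \<xi> x + opr G q \<xi> x"
  "fsupp p \<Longrightarrow> fsupp q \<Longrightarrow> opr G (psub p q) \<xi> x = opr G p \<xi> x - opr G q \<xi> x"
  "fsupp p \<Longrightarrow> opr G (psmult c p) \<xi> x = c * opr G p \<xi> x"
  by (simp_all add: opr_def)

lemma opr_psum: "finite S \<Longrightarrow> (\<And>s. s \<in> S \<Longrightarrow> fsupp (f s)) \<Longrightarrow>
    opr G (psum S f) \<xi> x = (\<Sum>s\<in>S. opr G (f s) \<xi> x)"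
  by (simp add: opr_def lin_psum)

lemma opr_cong_row:
  assumes "\<And>w y. p w \<noteq> 0 \<Longrightarrow> wact G w x = Some y \<Longrightarrow> \<xi> y = \<xi>' y"
  shows "opr G p \<xi> x = opr G p \<xi>' x"
  unfolding opr_def lin_def using assms by (intro sum.cong) (auto split: option.splits)

lemma opr_linear_row:
  "opr G p (\<lambda>y. c * \<xi> y) x = c * opr G p \<xi> x"
  "opr G p (\<lambda>y. \<Sum>s\<in>S. f s y) x = (\<Sum>s\<in>S. opr G p (f s) x)"
proof -
  show "opr G p (\<lambda>y. c * \<xi> y) x = c * opr G p \<xi> x"
    unfolding opr_def lin_def sum_distrib_left
    by (intro sum.cong) (auto split: option.splits)
  have "opr G p (\<lambda>y. \<Sum>s\<in>S. f s y) x = 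
     (\<Sum>w | p w \<noteq> 0. \<Sum>s\<in>S. p w * (case wact G w x of None \<Rightarrow> 0 | Some y \<Rightarrow> f s y))"
    unfolding opr_def lin_def by (intro sum.cong) (auto simp: sum_distrib_left split: option.splits)
  then show "opr G p (\<lambda>y. \<Sum>s\<in>S. f s y) x = (\<Sum>s\<in>S. opr G p (f s) x)"
    unfolding opr_def lin_def by (subst sum.swap) simp
qed

definition delta :: "'a \<Rightarrow> 'a \<Rightarrow> complex" where
  "delta a b = (if a = b then 1 else 0)"

lemma opr_eq_sum_delta:
  assumes "finite Y" "\<And>w y. p w \<noteq> 0 \<Longrightarrow> wact G w x = Some y \<Longrightarrow> y \<in> Y"
  shows "opr G p \<xi> x = (\<Sum>y\<in>Y. \<xi> y * opr G p (delta y) x)"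
proof -
  have "opr G p \<xi> x = opr G p (\<lambda>y'. \<Sum>y\<in>Y. \<xi> y * delta y y') x"
    by (rule opr_cong_row) (use assms in \<open>auto simp: delta_def if_distrib cong: if_cong\<close>)
  also have "\<dots> = (\<Sum>y\<in>Y. \<xi> y * opr G p (delta y) x)"
    by (simp add: opr_linear_row)
  finally show ?thesis .
qed

lemma opr_delta_nonzero:
  assumes "opr G p (delta y) x \<noteq> 0"
  shows "\<exists>w. p w \<noteq> 0 \<and> wact G w x = Some y"
proof (rule ccontr)
  assume "\<not> ?thesis"
  then have "opr G p (delta y) x = opr G p (\<lambda>_. 0) x"
    by (intro opr_cong_row) (auto simp: delta_def)
  then show False using assms opr_linear_row(1)[of G p 0 "\<lambda>_. 0" x] by simp
qed

text \<open>Only the finitely many end points of the row matter, and on them \<open>\<xi>\<close> is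
  a combination of point masses.\<close>

lemma opr_nonzero_delta:
  assumes "opr G p \<xi> x \<noteq> 0" "fsupp p"
  shows "\<exists>y. \<xi> y \<noteq> 0 \<and> opr G p (delta y) x \<noteq> 0"
proof -
  let ?Y = "(\<lambda>w. the (wact G w x)) ` {w. p w \<noteq> 0}"
  have "opr G p \<xi> x = (\<Sum>y\<in>?Y. \<xi> y * opr G p (delta y) x)"
    by (rule opr_eq_sum_delta) (use assms in \<open>force simp: fsupp_def\<close>)+
  then have "(\<Sum>y\<in>?Y. \<xi> y * opr G p (delta y) x) \<noteq> 0" using assms by simp
  then show ?thesis by (elim sum.not_neutral_contains_not_neutral) auto
qed

lemma pmul_mono_mono: "pmul (mono u) (mono w) = mono (u @ w)"
proof
  fix x
  have "pmul (mono u) (mono w) x = (\<Sum>(a, b) | a \<in> {u} \<and> b \<in> {w} \<and> a @ b = x. mono u a * mono w b)"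
    by (rule pmul_eq_sum_pairs) (auto simp: mono_def)
  also have "{(a, b). a \<in> {u} \<and> b \<in> {w} \<and> a @ b = x} = (if x = u @ w then {(u, w)} else {})" by auto
  finally show "pmul (mono u) (mono w) x = mono (u @ w) x" by (simp add: mono_def)
qed

lemma pmul_psub_right: "pmul p (psub q r) = psub (pmul p q) (pmul p r)"
  by (simp add: pmul_def psub_def fun_eq_iff algebra_simps sum_subtractf)

lemma pmul_psub_left: "pmul (psub q r) p = psub (pmul q p) (pmul r p)"
  by (simp add: pmul_def psub_def fun_eq_iff algebra_simps sum_subtractf)

lemma pmul_psum_right: "pmul p (psum S f) = psum S (\<lambda>s. pmul p (f s))"
  unfolding pmul_def psum_def fun_eq_iff sum_distrib_left by (intro allI sum.swap)

lemma pmul_psum_left: "pmul (psum S f) p = psum S (\<lambda>s. pmul (f s) p)"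
  unfolding pmul_def psum_def fun_eq_iff sum_distrib_right by (intro allI sum.swap)

lemma psub_pzero [simp]: "psub p pzero = p"
  by (simp add: psub_def pzero_def)

lemma psub_self [simp]: "psub p p = pzero"
  by (simp add: psub_def pzero_def)

lemma pstar_mono: "pstar (mono u) = mono (map gstar (rev u))"
proof
  fix w
  have inv: "map gstar (rev (map gstar (rev u))) = u" for u :: "('a,'b) gen list"
  proof -
    have "gstar (gstar g) = g" for g :: "('a,'b) gen" by (cases g) auto
    then show ?thesis by (simp add: rev_map comp_def)
  qed
  have "map gstar (rev w) = u \<longleftrightarrow> w = map gstar (rev u)" using inv[of w] inv[of u] by auto
  then show "pstar (mono u) w = mono (map gstar (rev u)) w" by (simp add: pstar_def mono_def)
qed

section \<open>Coefficients, the ideal of relations and congruence modulo it\<close>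

locale leavitt = good_graph G for G :: "('v,'e) graph" +
  fixes R :: "complex set"
  assumes coeff_ring: "conj_closed_unital_subring R"
begin

lemma R_simps [simp]: "0 \<in> R" "1 \<in> R" "x \<in> R \<Longrightarrow> y \<in> R \<Longrightarrow> x + y \<in> R"
  "x \<in> R \<Longrightarrow> y \<in> R \<Longrightarrow> x * y \<in> R" "x \<in> R \<Longrightarrow> - x \<in> R" "x \<in> R \<Longrightarrow> y \<in> R \<Longrightarrow> x - y \<in> R"
proof -
  show neg: "0 \<in> R" "1 \<in> R" "x \<in> R \<Longrightarrow> y \<in> R \<Longrightarrow> x + y \<in> R"
    "x \<in> R \<Longrightarrow> y \<in> R \<Longrightarrow> x * y \<in> R" "x \<in> R \<Longrightarrow> - x \<in> R" for x y
    using coeff_ring by (simp_all add: conj_closed_unital_subring_def)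
  show "x \<in> R \<Longrightarrow> y \<in> R \<Longrightarrow> x - y \<in> R"
    using neg(3)[of x "- y"] neg(5)[of y] by simp
qed

lemma R_sum: "(\<And>s. s \<in> S \<Longrightarrow> f s \<in> R) \<Longrightarrow> sum f S \<in> R"
  by (induction S rule: infinite_finite_induct) auto

lemma ncpoly_fsupp [simp]: "p \<in> ncpoly R G \<Longrightarrow> fsupp p"
  by (simp add: ncpoly_def fsupp_def)

lemma ncpoly_alt:
  "p \<in> ncpoly R G \<longleftrightarrow> fsupp p \<and> (\<forall>w. p w \<in> R \<and> (p w \<noteq> 0 \<longrightarrow> w \<noteq> [] \<and> set w \<subseteq> gens G))"
  unfolding ncpoly_def fsupp_def by blast

lemma ncpoly_pzero [simp]: "pzero \<in> ncpoly R G"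
  by (simp add: ncpoly_alt) (simp add: pzero_def)

lemma ncpoly_padd [simp]:
  assumes p: "p \<in> ncpoly R G" and q: "q \<in> ncpoly R G"
  shows "padd p q \<in> ncpoly R G"
proof -
  have "padd p q w \<in> R \<and> (padd p q w \<noteq> 0 \<longrightarrow> w \<noteq> [] \<and> set w \<subseteq> gens G)" for w
    using p q unfolding ncpoly_alt padd_def by (metis R_simps(3) add.right_neutral)
  then show ?thesis using assms by (simp add: ncpoly_alt)
qed

lemma ncpoly_psub [simp]:
  assumes p: "p \<in> ncpoly R G" and q: "q \<in> ncpoly R G"
  shows "psub p q \<in> ncpoly R G"
proof -
  have "psub p q w \<in> R \<and> (psub p q w \<noteq> 0 \<longrightarrow> w \<noteq> [] \<and> set w \<subseteq> gens G)" for w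
    using p q unfolding ncpoly_alt psub_def by (metis R_simps(6) diff_self)
  then show ?thesis using assms by (simp add: ncpoly_alt)
qed

lemma ncpoly_psmult [simp]: "c \<in> R \<Longrightarrow> p \<in> ncpoly R G \<Longrightarrow> psmult c p \<in> ncpoly R G"
  by (auto simp: ncpoly_alt) (auto simp: psmult_def)

lemma ncpoly_mono [simp]: "u \<noteq> [] \<Longrightarrow> set u \<subseteq> gens G \<Longrightarrow> mono u \<in> ncpoly R G"
  by (simp add: ncpoly_alt) (simp add: mono_def)

lemma ncpoly_psum: "finite S \<Longrightarrow> (\<And>s. s \<in> S \<Longrightarrow> f s \<in> ncpoly R G) \<Longrightarrow> psum S f \<in> ncpoly R G"
  by (induction S rule: finite_induct) (auto simp: psum_insert)

lemma pmul_gens: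
  assumes "fsupp p" "fsupp q" "\<And>w. p w \<in> R" "\<And>w. q w \<in> R"
    "\<And>w. p w \<noteq> 0 \<Longrightarrow> set w \<subseteq> gens G" "\<And>w. q w \<noteq> 0 \<Longrightarrow> set w \<subseteq> gens G" "p [] = 0 \<or> q [] = 0"
  shows "pmul p q \<in> ncpoly R G"
proof -
  have "set w \<subseteq> gens G" if nz: "pmul p q w \<noteq> 0" for w
  proof -
    obtain i where "p (take i w) * q (drop i w) \<noteq> 0"
      using nz unfolding pmul_def by (elim sum.not_neutral_contains_not_neutral)
    then have "set (take i w) \<subseteq> gens G" "set (drop i w) \<subseteq> gens G" using assms(5,6) by auto
    then show ?thesis by (metis append_take_drop_id set_append Un_least)
  qed
  moreover have "pmul p q w \<in> R" for w unfolding pmul_def by (intro R_sum) (simp add: assms)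
  moreover have "pmul p q [] = 0" using assms(7) by (auto simp: pmul_def)
  ultimately show ?thesis unfolding ncpoly_alt using fsupp_pmul[OF assms(1,2)] by blast
qed

lemma ncpoly_pmul [simp]: "p \<in> ncpoly R G \<Longrightarrow> q \<in> ncpoly R G \<Longrightarrow> pmul p q \<in> ncpoly R G"
  by (rule pmul_gens) (auto simp: ncpoly_alt)

lemma gens_simps [simp]:
  "GV v \<in> gens G \<longleftrightarrow> v \<in> verts G" "GE e \<in> gens G \<longleftrightarrow> e \<in> edges G" "GS e \<in> gens G \<longleftrightarrow> e \<in> edges G"
  by (auto simp: gens_def)

lemma edge_verts [simp]: "e \<in> edges G \<Longrightarrow> src G e \<in> verts G" "e \<in> edges G \<Longrightarrow> rng G e \<in> verts G"
  using fin by (auto simp: finite_graph_def)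

lemma finite_out [simp]: "finite {e \<in> edges G. src G e = v}"
  using finite_edges by simp

lemma ck_ncpoly: "psum {e \<in> edges G. src G e = v} (\<lambda>e. mono [GE e, GS e]) \<in> ncpoly R G"
  by (rule ncpoly_psum[OF finite_out]) auto

lemma lpa_rels_ncpoly: "p \<in> lpa_rels G \<Longrightarrow> p \<in> ncpoly R G"
  unfolding lpa_rels_def
  by (elim UnE CollectE exE conjE; hypsubst) (simp_all add: ck_ncpoly)

lemma ncpoly_word_mult:
  assumes "p \<in> ncpoly R G" "set u \<subseteq> gens G"
  shows "pmul (mono u) p \<in> ncpoly R G" "pmul p (mono u) \<in> ncpoly R G"
proof -
  have p: "fsupp p" "\<And>w. p w \<in> R" "\<And>w. p w \<noteq> 0 \<Longrightarrow> set w \<subseteq> gens G" "p [] = 0"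
    using assms(1) by (auto simp only: ncpoly_alt)
  have u: "\<And>w. mono u w \<in> R" "\<And>w. mono u w \<noteq> 0 \<Longrightarrow> set w \<subseteq> gens G"
    using assms(2) by (simp_all add: mono_def split: if_splits)
  show "pmul (mono u) p \<in> ncpoly R G" "pmul p (mono u) \<in> ncpoly R G"
    by (rule pmul_gens; (rule p u | simp add: p)+)+
qed

lemma lpa_ideal_ncpoly: "p \<in> lpa_ideal R G \<Longrightarrow> p \<in> ncpoly R G"
  by (induction rule: lpa_ideal.induct) (simp_all add: lpa_rels_ncpoly ncpoly_word_mult)

lemma opr_rels:
  assumes "p \<in> lpa_rels G" "x \<in> ipaths G"
  shows "opr G p \<xi> x = 0"
proof -
  \<comment> \<open>The summand of an edge \<open>e\<close> tests whether the path starts with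
    \<open>e\<close>, so exactly the one for \<open>shd x\<close> survives.\<close>
  have ck: "opr G (psub (mono [GV v]) (psum {e \<in> edges G. src G e = v} (\<lambda>e. mono [GE e, GS e]))) \<xi> x = 0" for v
  proof -
    have "opr G (mono [GE e, GS e]) \<xi> x = (if e = shd x then \<xi> x else 0)" for e
      using ipaths_rng_shd[OF assms(2)] by (auto simp: opr_mono)
    then have "opr G (psum {e \<in> edges G. src G e = v} (\<lambda>e. mono [GE e, GS e])) \<xi> x
      = (\<Sum>e | e \<in> edges G \<and> src G e = v. if e = shd x then \<xi> x else 0)"
      by (subst opr_psum) simp_all
    also have "\<dots> = (if source G x = v then \<xi> x else 0)"
      using ipaths_shd[OF assms(2)] finite_edges by (simp add: source_def)
    finally show ?thesis by (simp add: opr_mono fsupp_psum)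
  qed
  have shd: "shd x \<in> edges G" using assms ipaths_shd by blast
  have rs: "rng G (shd x) = source G (stl x)" using assms ipaths_rng_shd by blast
  show ?thesis
    using assms(1) unfolding lpa_rels_def
    by (elim UnE CollectE exE conjE; hypsubst?) (use shd rs ck in \<open>auto simp: opr_mono source_def[of G x]\<close>)
qed

lemma opr_lpa_ideal:
  "p \<in> lpa_ideal R G \<Longrightarrow> x \<in> ipaths G \<Longrightarrow> opr G p \<xi> x = 0"
proof (induction arbitrary: x \<xi> rule: lpa_ideal.induct)
  case (lmul u p)
  have "opr G (pmul (mono u) p) \<xi> x = opr G (mono u) (opr G p \<xi>) x"
    using lmul lpa_ideal_ncpoly by (simp add: opr_pmul)
  then show ?case using lmul wact_ipaths[of G u x] by (auto simp: opr_mono split: option.splits)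
next
  case (rmul u p)
  then show ?case using lpa_ideal_ncpoly by (simp add: opr_pmul)
qed (auto simp: opr_rels lpa_ideal_ncpoly)

definition cg :: "('v,'e) ncp \<Rightarrow> ('v,'e) ncp \<Rightarrow> bool" where
  "cg p q \<longleftrightarrow> psub p q \<in> lpa_ideal R G"

lemma cg_refl [simp]: "cg p p"
  by (simp add: cg_def lpa_ideal.zero)

lemma cg_sym: "cg p q \<Longrightarrow> cg q p"
proof -
  assume "cg p q"
  then have "psmult (-1) (psub p q) \<in> lpa_ideal R G" unfolding cg_def by (intro lpa_ideal.smul) simp_all
  moreover have "psmult (-1) (psub p q) = psub q p" by (simp add: psmult_def psub_def)
  ultimately show ?thesis by (simp add: cg_def)
qed

lemma cg_trans: "cg p q \<Longrightarrow> cg q r \<Longrightarrow> cg p r"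
proof -
  assume "cg p q" "cg q r"
  then have "padd (psub p q) (psub q r) \<in> lpa_ideal R G" unfolding cg_def by (rule lpa_ideal.add)
  moreover have "padd (psub p q) (psub q r) = psub p r" by (simp add: padd_def psub_def)
  ultimately show ?thesis by (simp add: cg_def)
qed

lemma cg_padd: "cg p q \<Longrightarrow> cg p' q' \<Longrightarrow> cg (padd p p') (padd q q')"
proof -
  assume "cg p q" "cg p' q'"
  then have "padd (psub p q) (psub p' q') \<in> lpa_ideal R G" unfolding cg_def by (rule lpa_ideal.add)
  moreover have "padd (psub p q) (psub p' q') = psub (padd p p') (padd q q')" by (simp add: padd_def psub_def fun_eq_iff)
  ultimately show ?thesis by (simp add: cg_def)
qed

lemma cg_psmult: "c \<in> R \<Longrightarrow> cg p q \<Longrightarrow> cg (psmult c p) (psmult c q)"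
proof -
  assume "cg p q" "c \<in> R"
  then have "psmult c (psub p q) \<in> lpa_ideal R G" unfolding cg_def by (intro lpa_ideal.smul)
  moreover have "psmult c (psub p q) = psub (psmult c p) (psmult c q)"
    by (simp add: psmult_def psub_def fun_eq_iff algebra_simps)
  ultimately show ?thesis by (simp add: cg_def)
qed

lemma cg_lmul: "set u \<subseteq> gens G \<Longrightarrow> cg p q \<Longrightarrow> cg (pmul (mono u) p) (pmul (mono u) q)"
  by (simp add: cg_def pmul_psub_right[symmetric] lpa_ideal.lmul)

lemma cg_rmul: "set u \<subseteq> gens G \<Longrightarrow> cg p q \<Longrightarrow> cg (pmul p (mono u)) (pmul q (mono u))"
  by (simp add: cg_def pmul_psub_left[symmetric] lpa_ideal.rmul)

lemma cg_context:
  assumes "cg (mono l) (mono r)" "set a \<subseteq> gens G" "set b \<subseteq> gens G"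
  shows "cg (mono (a @ l @ b)) (mono (a @ r @ b))"
  using cg_lmul[OF assms(2) cg_rmul[OF assms(3,1)]] by (simp add: pmul_mono_mono)

lemma cg_context0:
  assumes "cg (mono l) pzero" "set a \<subseteq> gens G" "set b \<subseteq> gens G"
  shows "cg (mono (a @ l @ b)) pzero"
proof -
  have "pmul p pzero = pzero" "pmul pzero p = pzero" for p :: "('v,'e) ncp"
    by (simp_all add: pmul_def pzero_def)
  then show ?thesis using cg_lmul[OF assms(2) cg_rmul[OF assms(3,1)]] by (simp add: pmul_mono_mono)
qed

lemma lpa_rels_intros:
  "v \<in> verts G \<Longrightarrow> psub (mono [GV v, GV v]) (mono [GV v]) \<in> lpa_rels G"
  "v \<in> verts G \<Longrightarrow> w \<in> verts G \<Longrightarrow> v \<noteq> w \<Longrightarrow> mono [GV v, GV w] \<in> lpa_rels G"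
  "e \<in> edges G \<Longrightarrow> f \<in> edges G \<Longrightarrow> e \<noteq> f \<Longrightarrow> mono [GS e, GE f] \<in> lpa_rels G"
  "e \<in> edges G \<Longrightarrow> psub (mono [GS e, GE e]) (mono [GV (rng G e)]) \<in> lpa_rels G"
  "e \<in> edges G \<Longrightarrow> psub (mono [GV (src G e), GE e]) (mono [GE e]) \<in> lpa_rels G"
  "e \<in> edges G \<Longrightarrow> psub (mono [GE e, GV (rng G e)]) (mono [GE e]) \<in> lpa_rels G"
  "e \<in> edges G \<Longrightarrow> psub (mono [GS e, GV (src G e)]) (mono [GS e]) \<in> lpa_rels G"
  "e \<in> edges G \<Longrightarrow> psub (mono [GV (rng G e), GS e]) (mono [GS e]) \<in> lpa_rels G"
  unfolding lpa_rels_def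
  subgoal by (rule UnI1, rule UnI1, rule UnI1, rule UnI1, rule UnI1, rule UnI1, rule UnI1, rule UnI1, intro CollectI exI conjI, rule refl)
  subgoal by (rule UnI1, rule UnI1, rule UnI1, rule UnI1, rule UnI1, rule UnI1, rule UnI1, rule UnI2, intro CollectI exI conjI, rule refl)
  subgoal by (rule UnI1, rule UnI1, rule UnI1, rule UnI1, rule UnI1, rule UnI1, rule UnI2, intro CollectI exI conjI, rule refl)
  subgoal by (rule UnI1, rule UnI1, rule UnI1, rule UnI1, rule UnI1, rule UnI2, intro CollectI exI conjI, rule refl)
  subgoal by (rule UnI1, rule UnI1, rule UnI1, rule UnI1, rule UnI2, intro CollectI exI conjI, rule refl)
  subgoal by (rule UnI1, rule UnI1, rule UnI1, rule UnI2, intro CollectI exI conjI, rule refl)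
  subgoal by (rule UnI1, rule UnI1, rule UnI2, intro CollectI exI conjI, rule refl)
  subgoal by (rule UnI1, rule UnI2, intro CollectI exI conjI, rule refl)
  done

lemma lpa_rels_intro_CK:
  "v \<in> verts G \<Longrightarrow> psub (mono [GV v]) (psum {e \<in> edges G. src G e = v} (\<lambda>e. mono [GE e, GS e])) \<in> lpa_rels G"
proof -
  assume v: "v \<in> verts G"
  then have "finite {e \<in> edges G. src G e = v} \<and> {e \<in> edges G. src G e = v} \<noteq> {}"
    using ess by (auto simp: essential_def)
  then show ?thesis unfolding lpa_rels_def using v by (intro UnI2 CollectI exI[of _ v] conjI refl) auto
qed

lemma cg_rels:
  "v \<in> verts G \<Longrightarrow> cg (mono [GV v, GV v]) (mono [GV v])"
  "v \<in> verts G \<Longrightarrow> w \<in> verts G \<Longrightarrow> v \<noteq> w \<Longrightarrow> cg (mono [GV v, GV w]) pzero"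
  "e \<in> edges G \<Longrightarrow> f \<in> edges G \<Longrightarrow> e \<noteq> f \<Longrightarrow> cg (mono [GS e, GE f]) pzero"
  "e \<in> edges G \<Longrightarrow> cg (mono [GS e, GE e]) (mono [GV (rng G e)])"
  "e \<in> edges G \<Longrightarrow> cg (mono [GV (src G e), GE e]) (mono [GE e])"
  "e \<in> edges G \<Longrightarrow> cg (mono [GE e, GV (rng G e)]) (mono [GE e])"
  "e \<in> edges G \<Longrightarrow> cg (mono [GS e, GV (src G e)]) (mono [GS e])"
  "e \<in> edges G \<Longrightarrow> cg (mono [GV (rng G e), GS e]) (mono [GS e])"
  "v \<in> verts G \<Longrightarrow> cg (mono [GV v]) (psum {e \<in> edges G. src G e = v} (\<lambda>e. mono [GE e, GS e]))"
  unfolding cg_def psub_pzero by (rule lpa_ideal.rel, (rule lpa_rels_intros lpa_rels_intro_CK; assumption))+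

end

section \<open>Normal forms and faithfulness\<close>

definition nw :: "'e list \<Rightarrow> 'e list \<Rightarrow> ('v,'e) gen list" where
  "nw \<alpha> \<beta> = map GE \<alpha> @ map GS (rev \<beta>)"

text \<open>The usual spanning words have arbitrary \<alpha>. With its length fixed to
  \<open>N\<close>, words with different \<alpha> act on disjoint cylinders, so above a single
  cylinder only \<beta> varies.\<close>

definition normal_words :: "('v,'e) graph \<Rightarrow> nat \<Rightarrow> ('v,'e) gen list set" where
  "normal_words G N = {map GE \<alpha> @ map GS (rev \<beta>) | \<alpha> \<beta>.
     length \<alpha> = N \<and> (\<exists>v v' u. fpath G v \<alpha> u \<and> fpath G v' \<beta> u)}"

lemma nw_inj:
  assumes "nw \<alpha> \<beta> = (nw \<alpha>' \<beta>' :: ('v,'e) gen list)" "length \<alpha> = length \<alpha>'"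
  shows "\<alpha> = \<alpha>' \<and> \<beta> = \<beta>'"
proof -
  have inj: "inj (GE :: 'e \<Rightarrow> ('v,'e) gen)" "inj (GS :: 'e \<Rightarrow> ('v,'e) gen)" by (auto simp: inj_def)
  have "map (GE :: 'e \<Rightarrow> ('v,'e) gen) \<alpha> = map GE \<alpha>'"
    "map (GS :: 'e \<Rightarrow> ('v,'e) gen) (rev \<beta>) = map GS (rev \<beta>')" using assms by (auto simp: nw_def)
  then show ?thesis using inj by (simp add: inj_map_eq_map)
qed

context leavitt
begin

definition NF :: "nat \<Rightarrow> ('v,'e) ncp set" where
  "NF N = {q \<in> ncpoly R G. \<forall>w. q w \<noteq> 0 \<longrightarrow> w \<in> normal_words G N}"

definition normalizable :: "nat \<Rightarrow> ('v,'e) ncp set" where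
  "normalizable N = {p \<in> ncpoly R G. \<exists>q\<in>NF N. cg p q}"

lemma NF_pzero: "pzero \<in> NF N"
  by (simp add: NF_def) (simp add: pzero_def)

lemma NF_padd: "p \<in> NF N \<Longrightarrow> q \<in> NF N \<Longrightarrow> padd p q \<in> NF N"
  by (simp add: NF_def) (simp add: padd_def, metis add.right_neutral)

lemma NF_psmult: "c \<in> R \<Longrightarrow> p \<in> NF N \<Longrightarrow> psmult c p \<in> NF N"
  by (simp add: NF_def) (simp add: psmult_def)

lemma normalizable_pzero: "pzero \<in> normalizable N"
  using NF_pzero cg_refl unfolding normalizable_def by fastforce

lemma normalizable_padd: "p \<in> normalizable N \<Longrightarrow> q \<in> normalizable N \<Longrightarrow> padd p q \<in> normalizable N"
  unfolding normalizable_def using cg_padd NF_padd ncpoly_padd by blast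

lemma normalizable_psmult: "c \<in> R \<Longrightarrow> p \<in> normalizable N \<Longrightarrow> psmult c p \<in> normalizable N"
  unfolding normalizable_def using cg_psmult NF_psmult ncpoly_psmult by blast

lemma normalizable_psum: "finite S \<Longrightarrow> (\<And>s. s \<in> S \<Longrightarrow> f s \<in> normalizable N) \<Longrightarrow> psum S f \<in> normalizable N"
  by (induction S rule: finite_induct) (auto simp: psum_insert normalizable_pzero normalizable_padd)

lemma normalizable_cg: "cg p q \<Longrightarrow> q \<in> normalizable N \<Longrightarrow> p \<in> ncpoly R G \<Longrightarrow> p \<in> normalizable N"
  unfolding normalizable_def using cg_trans by blast

lemma fpath_gens: "fpath G v \<alpha> w \<Longrightarrow> set (map GE \<alpha>) \<subseteq> gens G" "fpath G v \<alpha> w \<Longrightarrow> set (map GS (rev \<alpha>)) \<subseteq> gens G"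
  using fpath_set[of G v \<alpha> w] by auto

lemma normal_words_gens: "w \<in> normal_words G N \<Longrightarrow> set w \<subseteq> gens G"
  unfolding normal_words_def using fpath_set by fastforce

lemma normalizable_normal_word: "w \<in> normal_words G N \<Longrightarrow> N > 0 \<Longrightarrow> mono w \<in> normalizable N"
proof -
  assume w: "w \<in> normal_words G N" "N > 0"
  have "w \<noteq> []" using w by (auto simp: normal_words_def)
  then have "mono w \<in> ncpoly R G" using w normal_words_gens by (intro ncpoly_mono)
  moreover from this have "mono w \<in> NF N" using w by (simp add: NF_def) (simp add: mono_def)
  ultimately show ?thesis using cg_refl unfolding normalizable_def by blast
qed

text \<open>One letter at a time, a word acts on ghost paths as it acts on infinite paths.\<close>

lemma ghost_letter:
  assumes "fpath G v \<beta> u" "length \<beta> \<ge> 2" "g \<in> gens G"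
  shows "cg (mono (map GS (rev \<beta>) @ [g])) pzero \<or>
    (\<exists>v' \<beta>'. fpath G v' \<beta>' u \<and> length \<beta>' \<ge> length \<beta> - 1 \<and>
       cg (mono (map GS (rev \<beta>) @ [g])) (mono (map GS (rev \<beta>'))))"
proof -
  \<comment> \<open>The second edge is kept in reserve: when the letter cancels \<open>e\<close>,
    the vertex left behind is absorbed by the ghost edge of \<open>f\<close>.\<close>
  obtain e f \<gamma> where \<beta>: "\<beta> = e # f # \<gamma>"
    using assms(2) by (cases \<beta>; cases "tl \<beta>") auto
  have e: "e \<in> edges G" "f \<in> edges G" "src G e = v" "src G f = rng G e" "fpath G (rng G f) \<gamma> u"
    using assms(1) \<beta> by auto
  let ?p = "map GS (rev (f # \<gamma>)) :: ('v,'e) gen list"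
  have pg: "set ?p \<subseteq> gens G" "set (map GS (rev \<gamma>)) \<subseteq> gens G"
    using e fpath_gens(2)[of "rng G f" \<gamma> u] by auto
  have split: "map GS (rev \<beta>) = ?p @ [GS e]" using \<beta> by simp
  show ?thesis
  proof (cases g)
    case (GV x)
    then have x: "x \<in> verts G" using assms by simp
    show ?thesis
    proof (cases "x = v")
      case True
      then have "cg (mono (map GS (rev \<beta>) @ [g])) (mono (map GS (rev \<beta>)))"
        using cg_context[OF cg_rels(7)[OF e(1)] pg(1), of "[]"] GV e split by simp
      then show ?thesis using assms(1) by (intro disjI2 exI[of _ v] exI[of _ \<beta>]) auto
    next
      case False
      have "cg (mono (map GS (rev \<beta>) @ [g])) (mono (?p @ [GS e, GV v, GV x]))"
        using cg_sym[OF cg_context[OF cg_rels(7)[OF e(1)] pg(1), of "[GV x]"]] x GV e split by simp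
      moreover have "cg (mono (?p @ [GS e, GV v, GV x])) pzero"
        using cg_context0[OF cg_rels(2)[of v x], of "?p @ [GS e]" "[]"] x False e(1,3) pg by auto
      ultimately show ?thesis using cg_trans by blast
    qed
  next
    case (GE x)
    then have x: "x \<in> edges G" using assms by simp
    show ?thesis
    proof (cases "x = e")
      case True
      have "cg (mono (map GS (rev \<beta>) @ [g])) (mono (?p @ [GV (rng G e)]))"
        using cg_context[OF cg_rels(4)[OF e(1)] pg(1), of "[]"] GE True split by simp
      moreover have "cg (mono (?p @ [GV (rng G e)])) (mono ?p)"
        using cg_context[OF cg_rels(7)[OF e(2)] pg(2), of "[]"] e by simp
      ultimately have "cg (mono (map GS (rev \<beta>) @ [g])) (mono ?p)" using cg_trans by blast
      then show ?thesis using assms(1) e \<beta> 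
        by (intro disjI2 exI[of _ "rng G e"] exI[of _ "f # \<gamma>"]) auto
    next
      case False
      then have "cg (mono (?p @ [GS e, g] @ [])) pzero"
        using cg_context0[OF cg_rels(3)[of e x], of ?p "[]"] e x GE pg by simp
      then show ?thesis using split by simp
    qed
  next
    case (GS x)
    then have x: "x \<in> edges G" using assms by simp
    show ?thesis
    proof (cases "rng G x = v")
      case True
      then show ?thesis using assms(1) x GS
        by (intro disjI2 exI[of _ "src G x"] exI[of _ "x # \<beta>"]) auto
    next
      case False
      have "cg (mono (map GS (rev \<beta>) @ [g])) (mono (?p @ [GS e, GV v, GS x]))"
        using cg_sym[OF cg_context[OF cg_rels(7)[OF e(1)] pg(1), of "[GS x]"]] x GS e split by simp
      moreover have "cg (mono (?p @ [GS e, GV v, GS x])) (mono (?p @ [GS e, GV v, GV (rng G x), GS x]))"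
        using cg_sym[OF cg_context[OF cg_rels(8)[OF x], of "?p @ [GS e, GV v]" "[]"]] e(1,3) pg(1) by auto
      moreover have "cg (mono (?p @ [GS e, GV v, GV (rng G x), GS x])) pzero"
        using cg_context0[OF cg_rels(2)[of v "rng G x"], of "?p @ [GS e]" "[GS x]"] x False e(1,3) pg by auto
      ultimately have "cg (mono (map GS (rev \<beta>) @ [g])) pzero" using cg_trans by blast
      then show ?thesis by blast
    qed
  qed
qed

lemma ghost_word:
  assumes "fpath G v \<beta> u" "length w < length \<beta>" "set w \<subseteq> gens G"
  shows "cg (mono (map GS (rev \<beta>) @ w)) pzero \<or>
    (\<exists>v' \<beta>'. fpath G v' \<beta>' u \<and> cg (mono (map GS (rev \<beta>) @ w)) (mono (map GS (rev \<beta>'))))"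
  using assms
proof (induction w arbitrary: v \<beta>)
  case Nil
  then show ?case using cg_refl by fastforce
next
  case (Cons g w)
  have g: "g \<in> gens G" "set w \<subseteq> gens G" "length \<beta> \<ge> 2" using Cons.prems by auto
  show ?case
  proof (cases "cg (mono (map GS (rev \<beta>) @ [g])) pzero")
    case True
    then show ?thesis using cg_context0[OF True, of "[]" w] g by simp
  next
    case False
    then obtain v' \<beta>' where \<beta>': "fpath G v' \<beta>' u" "length \<beta>' \<ge> length \<beta> - 1"
       "cg (mono (map GS (rev \<beta>) @ [g])) (mono (map GS (rev \<beta>')))"
      using ghost_letter[OF Cons.prems(1) g(3,1)] by blast
    have "cg (mono (map GS (rev \<beta>) @ g # w)) (mono (map GS (rev \<beta>') @ w))"
      using cg_context[OF \<beta>'(3), of "[]" w] g by simp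
    moreover have "length w < length \<beta>'" using \<beta>'(2) Cons.prems by simp
    ultimately show ?thesis using Cons.IH[OF \<beta>'(1)] g cg_trans by meson
  qed
qed

text \<open>This is the Cuntz-Krieger relation applied \<open>n\<close> times: inside a word,
  \<open>v\<close> is the sum of \<alpha>\<alpha>* over all paths \<alpha> of length
  \<open>n\<close> starting at \<open>v\<close>.\<close>

lemma normalizable_insert_vertex:
  assumes "v \<in> verts G" "set a \<subseteq> gens G" "set b \<subseteq> gens G" "n > 0"
    "\<And>\<alpha> u. length \<alpha> = n \<Longrightarrow> fpath G v \<alpha> u \<Longrightarrow> mono (a @ map GE \<alpha> @ map GS (rev \<alpha>) @ b) \<in> normalizable N"
  shows "mono (a @ [GV v] @ b) \<in> normalizable N"
  using assms(4,1,2,3,5)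
proof (induction n arbitrary: v a b rule: nat_induct_non_zero)
  have red: "mono (a @ [GV v] @ b) \<in> normalizable N"
    if v: "v \<in> verts G" "set a \<subseteq> gens G" "set b \<subseteq> gens G"
    and *: "\<And>e. e \<in> edges G \<Longrightarrow> src G e = v \<Longrightarrow> mono (a @ [GE e, GS e] @ b) \<in> normalizable N" for v a b
  proof -
    have "cg (mono (a @ [GV v] @ b)) (psum {e \<in> edges G. src G e = v} (\<lambda>e. mono (a @ [GE e, GS e] @ b)))"
      using cg_lmul[OF v(2) cg_rmul[OF v(3) cg_rels(9)[OF v(1)]]]
      by (simp add: pmul_psum_left pmul_psum_right pmul_mono_mono)
    moreover have "psum {e \<in> edges G. src G e = v} (\<lambda>e. mono (a @ [GE e, GS e] @ b)) \<in> normalizable N"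
      using * by (intro normalizable_psum) auto
    moreover have "mono (a @ [GV v] @ b) \<in> ncpoly R G" using v by (intro ncpoly_mono) auto
    ultimately show ?thesis using normalizable_cg by blast
  qed
  {
    case 1
    show ?case
    proof (rule red)
      fix e assume "e \<in> edges G" "src G e = v"
      then show "mono (a @ [GE e, GS e] @ b) \<in> normalizable N" using 1(4)[of "[e]" "rng G e"] by simp
    qed (use 1 in auto)
  next
    case (Suc n)
    show ?case
    proof (rule red)
      fix e assume e: "e \<in> edges G" "src G e = v"
      have "mono ((a @ [GE e]) @ [GV (rng G e)] @ ([GS e] @ b)) \<in> normalizable N"
      proof (rule Suc.IH)
        fix \<alpha> u assume "length \<alpha> = n" "fpath G (rng G e) \<alpha> u"
        then show "mono ((a @ [GE e]) @ map GE \<alpha> @ map GS (rev \<alpha>) @ [GS e] @ b) \<in> normalizable N"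
          using Suc.prems(4)[of "e # \<alpha>" u] e by simp
      qed (use e Suc.prems in auto)
      moreover have "cg (mono (a @ [GE e, GS e] @ b)) (mono ((a @ [GE e]) @ [GV (rng G e)] @ ([GS e] @ b)))"
        using cg_sym[OF cg_context[OF cg_rels(6)[OF e(1)], of a "GS e # b"]] Suc.prems e by simp
      moreover have "mono (a @ [GE e, GS e] @ b) \<in> ncpoly R G"
        using Suc.prems e by (intro ncpoly_mono) auto
      ultimately show "mono (a @ [GE e, GS e] @ b) \<in> normalizable N" using normalizable_cg by blast
    qed (use Suc in auto)
  }
qed

text \<open>A vertex that fits can be put in front of \<open>w\<close> and expanded into paths of
  length \<open>N\<close>. The ghost half of each summand is longer than \<open>w\<close> and
  swallows it by \<open>ghost_word\<close>; the other half is the required prefix of length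
  \<open>N\<close>.\<close>

lemma normalizable_word:
  assumes "w \<noteq> []" "set w \<subseteq> gens G" "length w < N"
  shows "mono w \<in> normalizable N"
proof -
  obtain g w' where w: "w = g # w'" using assms by (cases w) auto
  have g: "g \<in> gens G" using assms w by simp
  have "\<exists>v\<in>verts G. cg (mono ([g] @ w')) (mono ([GV v] @ [g] @ w'))"
  proof (cases g)
    case (GV v)
    then show ?thesis using g cg_sym[OF cg_context[OF cg_rels(1)[of v], of "[]" w']] assms w
      by (intro bexI[of _ v]) auto
  next
    case (GE e)
    then show ?thesis using g cg_sym[OF cg_context[OF cg_rels(5)[of e], of "[]" w']] assms w
      by (intro bexI[of _ "src G e"]) auto
  next
    case (GS e)
    then show ?thesis using g cg_sym[OF cg_context[OF cg_rels(8)[of e], of "[]" w']] assms w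
      by (intro bexI[of _ "rng G e"]) auto
  qed
  then obtain v where v: "v \<in> verts G" "cg (mono w) (mono ([] @ [GV v] @ w))" using w by auto
  have "mono ([] @ [GV v] @ w) \<in> normalizable N"
  proof (rule normalizable_insert_vertex[of v "[]" w N])
    fix \<alpha> u assume \<alpha>: "length \<alpha> = N" "fpath G v \<alpha> u"
    have nc: "mono (map GE \<alpha> @ map GS (rev \<alpha>) @ w) \<in> ncpoly R G"
      using assms \<alpha> fpath_gens[OF \<alpha>(2)] by (intro ncpoly_mono) auto
    consider "cg (mono (map GS (rev \<alpha>) @ w)) pzero" | v' \<beta> where "fpath G v' \<beta> u"
       "cg (mono (map GS (rev \<alpha>) @ w)) (mono (map GS (rev \<beta>)))"
      using ghost_word[OF \<alpha>(2) _ assms(2)] assms(3) \<alpha>(1) by blast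
    then show "mono ([] @ map GE \<alpha> @ map GS (rev \<alpha>) @ w) \<in> normalizable N"
    proof cases
      case 1
      then show ?thesis using cg_context0[OF 1, of "map GE \<alpha>" "[]"] nc normalizable_cg[OF _ normalizable_pzero] fpath_gens[OF \<alpha>(2)] by simp
    next
      case 2
      have "map GE \<alpha> @ map GS (rev \<beta>) \<in> normal_words G N"
        using 2 \<alpha> unfolding normal_words_def by blast
      then have "mono (map GE \<alpha> @ map GS (rev \<beta>)) \<in> normalizable N" using normalizable_normal_word assms(3) by auto
      then show ?thesis using cg_context[OF 2(2), of "map GE \<alpha>" "[]"] nc normalizable_cg fpath_gens[OF \<alpha>(2)] by simp
    qed
  qed (use assms v in auto)
  then show ?thesis using normalizable_cg[OF v(2)] ncpoly_mono assms by blast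
qed

text \<open>Any \<open>N\<close> exceeding the length of every word in the support works. That all
  large \<open>N\<close> are admissible later allows one common length for finitely many
  words.\<close>

theorem normal_form:
  assumes "p \<in> ncpoly R G"
  shows "\<exists>N0>0. \<forall>N\<ge>N0. \<exists>q\<in>NF N. cg p q"
proof -
  let ?S = "{w. p w \<noteq> 0}"
  have fin: "finite ?S" using assms by (simp add: ncpoly_def)
  define N0 where "N0 = Suc (Max (insert 0 (length ` ?S)))"
  have "p \<in> normalizable N" if "N \<ge> N0" for N
  proof -
    have "psum ?S (\<lambda>w. psmult (p w) (mono w)) \<in> normalizable N"
    proof (rule normalizable_psum[OF fin])
      fix w assume w: "w \<in> ?S"
      then have "length w \<le> Max (insert 0 (length ` ?S))" using fin by (intro Max_ge) auto
      then have "length w < N" using that by (simp add: N0_def)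
      then show "psmult (p w) (mono w) \<in> normalizable N"
        using w assms by (intro normalizable_psmult normalizable_word) (auto simp: ncpoly_alt)
    qed
    moreover have "psum ?S (\<lambda>w. psmult (p w) (mono w)) = p"
      using fin by (auto simp: psum_def psmult_def mono_def fun_eq_iff if_distrib cong: if_cong)
    ultimately show ?thesis by simp
  qed
  then show ?thesis unfolding normalizable_def by (intro exI[of _ N0]) (auto simp: N0_def)
qed

end

section \<open>Normal forms as operators, faithfulness, and the diagonal\<close>

lemma wact_nw:
  assumes "fpath G v' \<beta> (source G (sdrop (length \<alpha>) x))"
  shows "wact G (nw \<alpha> \<beta>) x = (if stake (length \<alpha>) x = \<alpha> then Some (\<beta> @- sdrop (length \<alpha>) x) else None)"
  unfolding nw_def wact_append wact_GE using wact_GS[OF assms] by simp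

lemma wact_nw_self:
  assumes "x \<in> ipaths G"
  shows "wact G (nw \<alpha> \<alpha>) x = (if stake (length \<alpha>) x = \<alpha> then Some x else None)"
proof (cases "stake (length \<alpha>) x = \<alpha>")
  case True
  then have "fpath G (source G x) \<alpha> (source G (sdrop (length \<alpha>) x))"
    using fpath_stake[OF assms, of "length \<alpha>"] by simp
  then show ?thesis using wact_nw[of G "source G x" \<alpha> \<alpha> x] True stake_sdrop[of "length \<alpha>" x] by simp
qed (simp add: nw_def wact_append wact_GE)

lemma stake_le: "stake n x = stake n y \<Longrightarrow> m \<le> n \<Longrightarrow> stake m x = stake m y"
  by (metis take_stake min.absorb1)

text \<open>A word removes at most as many edges as it has letters, and one further edge always
  remains to determine the source that vertices and ghost edges test; hence the
  \<open>Suc m\<close>.\<close>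

lemma wact_cylinder:
  assumes "x \<in> ipaths G" "x' \<in> ipaths G" "set w \<subseteq> gens G" "stake (length w + Suc m) x = stake (length w + Suc m) x'"
  shows "(wact G w x = None \<and> wact G w x' = None) \<or>
    (\<exists>y y'. wact G w x = Some y \<and> wact G w x' = Some y' \<and> stake (Suc m) y = stake (Suc m) y')"
  using assms
proof (induction w arbitrary: x x')
  case (Cons g w)
  have sh: "shd x = shd x'" "stake (length w + Suc m) (stl x) = stake (length w + Suc m) (stl x')"
    using Cons.prems(4) by simp_all
  have len: "stake (length w + Suc m) x = stake (length w + Suc m) x'"
    by (rule stake_le[OF Cons.prems(4)]) simp
  have up: "stake (length w + Suc m) (e ## x) = stake (length w + Suc m) (e ## x')" for e
    using stake_le[OF len, of "length w + m"] by simp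
  show ?case
  proof (cases "gact G g x")
    case None
    then have "gact G g x' = None" using sh by (cases g) (auto simp: source_def)
    then show ?thesis using None by simp
  next
    case (Some y)
    then obtain y' where y': "gact G g x' = Some y'" "stake (length w + Suc m) y = stake (length w + Suc m) y'"
      using sh len up by (cases g) (auto simp: source_def split: if_splits)
    have "y \<in> ipaths G" "y' \<in> ipaths G"
      using wact_ipaths[of G "[g]" x y] wact_ipaths[of G "[g]" x' y'] Some y' Cons.prems by auto
    then show ?thesis using Cons.IH y' Some Cons.prems by simp
  qed
qed auto

lemma stake_eqI: "(\<And>n. stake (Suc n) x = stake (Suc n) y) \<Longrightarrow> x = y"
  by (rule stream_eqI) (metis lessI stake_nth)

context leavitt
begin

lemma nw_ncpoly:
  assumes "fpath G v \<alpha> u" "fpath G v' \<beta> u'" "\<alpha> \<noteq> []"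
  shows "mono (nw \<alpha> \<beta>) \<in> ncpoly R G"
  using assms fpath_gens[of v \<alpha> u] fpath_gens[of v' \<beta> u'] unfolding nw_def by (intro ncpoly_mono) auto

lemma fpath_end_verts: "fpath G v \<alpha> u \<Longrightarrow> \<alpha> \<noteq> [] \<Longrightarrow> u \<in> verts G"
  using fpath_ends[of G v \<alpha> u] fpath_set[of G v \<alpha> u] by (metis edge_verts(2) last_in_set subsetD)

lemma NF_coeff:
  assumes "q \<in> NF N" "N > 0" "fpath G v \<alpha> u" "length \<alpha> = N" "q (nw \<alpha> \<beta>) \<noteq> 0"
  shows "\<exists>v'. fpath G v' \<beta> u"
proof -
  have "nw \<alpha> \<beta> \<in> normal_words G N" using assms by (simp add: NF_def)
  then obtain \<alpha>' \<beta>' w w' u' where *: "nw \<alpha> \<beta> = (nw \<alpha>' \<beta>' :: ('v,'e) gen list)" "length \<alpha>' = N" "fpath G w \<alpha>' u'" "fpath G w' \<beta>' u'"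
    unfolding normal_words_def nw_def[symmetric] by blast
  then have "\<alpha> = \<alpha>'" "\<beta> = \<beta>'" using nw_inj[OF *(1)] assms(4) by auto
  moreover have "\<alpha> \<noteq> []" using assms(2,4) by auto
  ultimately show ?thesis using * assms(3) fpath_end_unique by metis
qed

text \<open>Normal words with another prefix of length \<open>N\<close> are undefined at
  \<open>\<alpha> @- z\<close>. The remaining coefficients do not depend on \<open>z\<close>, which
  makes the action uniform on the cylinder.\<close>

lemma opr_NF:
  assumes "q \<in> NF N" "N > 0" "fpath G v \<alpha> u" "length \<alpha> = N" "z \<in> ipaths G" "source G z = u"
  shows "opr G q \<xi> (\<alpha> @- z) = (\<Sum>\<beta> | q (nw \<alpha> \<beta>) \<noteq> 0. q (nw \<alpha> \<beta>) * \<xi> (\<beta> @- z))"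
    and "finite {\<beta>. q (nw \<alpha> \<beta>) \<noteq> 0}"
proof -
  let ?B = "{\<beta>. q (nw \<alpha> \<beta>) \<noteq> 0}" and ?S = "{w. q w \<noteq> 0}"
  have fin: "finite ?S" using assms by (auto simp: NF_def ncpoly_def)
  have inj: "inj_on (\<lambda>\<beta>. nw \<alpha> \<beta> :: ('v,'e) gen list) ?B"
    by (rule inj_onI) (use nw_inj in blast)
  show fB: "finite ?B"
    by (rule inj_on_finite[OF inj _ fin]) auto
  have "opr G q \<xi> (\<alpha> @- z) = (\<Sum>w\<in>nw \<alpha> ` ?B. q w * (case wact G w (\<alpha> @- z) of None \<Rightarrow> 0 | Some y \<Rightarrow> \<xi> y))"
    unfolding opr_def lin_def
  proof (rule sum.mono_neutral_right[OF fin])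
    show "\<forall>w\<in>?S - nw \<alpha> ` ?B. q w * (case wact G w (\<alpha> @- z) of None \<Rightarrow> 0 | Some y \<Rightarrow> \<xi> y) = 0"
    proof
      fix w assume w: "w \<in> ?S - nw \<alpha> ` ?B"
      then have "w \<in> normal_words G N" using assms by (simp add: NF_def)
      then obtain \<alpha>' \<beta>' where *: "w = nw \<alpha>' \<beta>'" "length \<alpha>' = N"
        unfolding normal_words_def nw_def[symmetric] by blast
      then have "\<alpha>' \<noteq> \<alpha>" using w by auto
      then have "wact G w (\<alpha> @- z) = None"
        using * assms(4) by (simp add: nw_def wact_append wact_GE stake_shift)
      then show "q w * (case wact G w (\<alpha> @- z) of None \<Rightarrow> 0 | Some y \<Rightarrow> \<xi> y) = 0" by simp
    qed
  qed auto
  also have "\<dots> = (\<Sum>\<beta>\<in>?B. q (nw \<alpha> \<beta>) * (case wact G (nw \<alpha> \<beta>) (\<alpha> @- z) of None \<Rightarrow> 0 | Some y \<Rightarrow> \<xi> y))"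
    by (simp add: sum.reindex[OF inj])
  also have "\<dots> = (\<Sum>\<beta>\<in>?B. q (nw \<alpha> \<beta>) * \<xi> (\<beta> @- z))"
  proof (rule sum.cong[OF refl])
    fix \<beta> assume "\<beta> \<in> ?B"
    then obtain v' where "fpath G v' \<beta> u" using NF_coeff[OF assms(1-4)] by blast
    then have "wact G (nw \<alpha> \<beta>) (\<alpha> @- z) = Some (\<beta> @- z)"
      using wact_nw[of G v' \<beta> \<alpha> "\<alpha> @- z"] assms by (simp add: sdrop_shift stake_shift)
    then show "q (nw \<alpha> \<beta>) * (case wact G (nw \<alpha> \<beta>) (\<alpha> @- z) of None \<Rightarrow> 0 | Some y \<Rightarrow> \<xi> y) = q (nw \<alpha> \<beta>) * \<xi> (\<beta> @- z)"
      by simp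
  qed
  finally show "opr G q \<xi> (\<alpha> @- z) = (\<Sum>\<beta>\<in>?B. q (nw \<alpha> \<beta>) * \<xi> (\<beta> @- z))" .
qed

text \<open>For aperiodic \<open>z\<close> different \<beta> give different points
  \<open>\<beta> @- z\<close>, so the entry collects no other coefficient.\<close>

lemma opr_NF_aperiodic:
  assumes "q \<in> NF N" "N > 0" "fpath G v \<alpha> u" "length \<alpha> = N" "z \<in> ipaths G" "source G z = u" "\<not> eper z"
  shows "opr G q (delta (\<beta> @- z)) (\<alpha> @- z) = q (nw \<alpha> \<beta>)"
proof -
  have "opr G q (delta (\<beta> @- z)) (\<alpha> @- z) = (\<Sum>\<beta>' | q (nw \<alpha> \<beta>') \<noteq> 0. if \<beta> = \<beta>' then q (nw \<alpha> \<beta>) else 0)"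
    unfolding opr_NF(1)[OF assms(1-6)]
    by (rule sum.cong[OF refl]) (use shift_eq_aperiodic[OF _ assms(7)] in \<open>auto simp: delta_def\<close>)
  also have "\<dots> = q (nw \<alpha> \<beta>)" using opr_NF(2)[OF assms(1-6)] by simp
  finally show ?thesis .
qed

definition eqv :: "('v,'e) ncp \<Rightarrow> ('v,'e) ncp \<Rightarrow> bool" where
  "eqv p q \<longleftrightarrow> (\<forall>x\<in>ipaths G. \<forall>\<xi>. opr G p \<xi> x = opr G q \<xi> x)"

lemma cg_imp_eqv: "p \<in> ncpoly R G \<Longrightarrow> q \<in> ncpoly R G \<Longrightarrow> cg p q \<Longrightarrow> eqv p q"
  unfolding cg_def eqv_def using opr_lpa_ideal[of "psub p q"] by simp

text \<open>Condition (L) enters here: aperiodic points separate the normal words, as in the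
  Cuntz--Krieger uniqueness theorem.\<close>

lemma eqv_imp_cg:
  assumes "p \<in> ncpoly R G" "q \<in> ncpoly R G" "eqv p q"
  shows "cg p q"
proof -
  let ?r = "psub p q"
  have r: "?r \<in> ncpoly R G" using assms by simp
  obtain N s where s: "N > 0" "s \<in> NF N" "cg ?r s" using normal_form[OF r] by blast
  have s': "s \<in> ncpoly R G" using s by (simp add: NF_def)
  have zero: "opr G s \<xi> x = 0" if "x \<in> ipaths G" for x \<xi>
    using cg_imp_eqv[OF r s' s(3)] assms that by (simp add: eqv_def)
  have "s w = 0" for w
  proof (rule ccontr)
    assume w: "s w \<noteq> 0"
    then have "w \<in> normal_words G N" using s by (simp add: NF_def)
    then obtain \<alpha> \<beta> v u where *: "w = nw \<alpha> \<beta>" "length \<alpha> = N" "fpath G v \<alpha> u"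
      unfolding normal_words_def nw_def[symmetric] by blast
    have "\<alpha> \<noteq> []" using * s by auto
    then obtain z where z: "z \<in> ipaths G" "source G z = u" "\<not> eper z"
      using aperiodic_exists fpath_end_verts * by blast
    have "\<alpha> @- z \<in> ipaths G" using * z fpath_shift_ipaths by metis
    then show False using opr_NF_aperiodic[OF s(2,1) *(3,2) z, of \<beta>] zero w * by simp
  qed
  then have "s = pzero" by (simp add: pzero_def fun_eq_iff)
  then show ?thesis using s by (simp add: cg_def)
qed

definition dval :: "('v,'e) ncp \<Rightarrow> 'e stream \<Rightarrow> complex" where
  "dval p x = opr G p (\<lambda>_. 1) x"

text \<open>The diagonal is described by its action as multiplication operators.
  \<open>isdiag_imp_diag_poly\<close> and \<open>diag_poly_isdiag\<close> show that, up to
  congruence, this is the span of the \<alpha>\<alpha>*.\<close>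

definition isdiag :: "('v,'e) ncp \<Rightarrow> bool" where
  "isdiag p \<longleftrightarrow> (\<forall>x\<in>ipaths G. \<forall>\<xi>. opr G p \<xi> x = dval p x * \<xi> x)"

lemma isdiag_eqv: "eqv p q \<Longrightarrow> isdiag p \<Longrightarrow> isdiag q"
  unfolding eqv_def isdiag_def dval_def by metis

lemma dval_eqv: "eqv p q \<Longrightarrow> x \<in> ipaths G \<Longrightarrow> dval p x = dval q x"
  by (simp add: eqv_def dval_def)

text \<open>A coefficient at two different paths \<alpha> and \<beta> would give a nonzero entry
  between the distinct points \<open>\<alpha> @- z\<close> and \<open>\<beta> @- z\<close> for an
  aperiodic \<open>z\<close>.\<close>

lemma isdiag_NF:
  assumes "q \<in> NF N" "N > 0" "isdiag q" "q w \<noteq> 0"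
  shows "\<exists>\<alpha> v u. w = nw \<alpha> \<alpha> \<and> length \<alpha> = N \<and> fpath G v \<alpha> u"
proof -
  have "w \<in> normal_words G N" using assms by (simp add: NF_def)
  then obtain \<alpha> \<beta> v u where *: "w = nw \<alpha> \<beta>" "length \<alpha> = N" "fpath G v \<alpha> u"
    unfolding normal_words_def nw_def[symmetric] by blast
  have "\<alpha> \<noteq> []" using * assms(2) by auto
  then obtain z where z: "z \<in> ipaths G" "source G z = u" "\<not> eper z"
    using aperiodic_exists fpath_end_verts * by blast
  have "\<alpha> @- z \<in> ipaths G" using * z fpath_shift_ipaths by metis
  moreover have "opr G q (delta (\<beta> @- z)) (\<alpha> @- z) \<noteq> 0"
    using opr_NF_aperiodic[OF assms(1,2) *(3,2) z, of \<beta>] assms * by simp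
  ultimately have "delta (\<beta> @- z) (\<alpha> @- z) \<noteq> 0" using assms(3) unfolding isdiag_def by auto
  then have "\<beta> = \<alpha>" using shift_eq_aperiodic z by (auto simp: delta_def split: if_splits)
  then show ?thesis using * by blast
qed

text \<open>By \<open>isdiag_NF\<close> the normal form contains only words \<alpha>\<alpha>*, so it
  is itself a diagonal polynomial, indexed by edge paths alone.\<close>

lemma isdiag_imp_diag_poly:
  assumes "p \<in> ncpoly R G" "isdiag p"
  shows "\<exists>q\<in>diag_polys R G. cg p q"
proof -
  obtain N q where q: "N > 0" "q \<in> NF N" "cg p q" using normal_form[OF assms(1)] by blast
  have q': "q \<in> ncpoly R G" using q by (simp add: NF_def)
  have dq: "isdiag q" using cg_imp_eqv[OF assms(1) q' q(3)] assms(2) isdiag_eqv by blast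
  define S where "S = {\<alpha>. q (nw \<alpha> \<alpha>) \<noteq> 0 \<and> length \<alpha> = N}"
  have supp: "\<exists>\<alpha>\<in>S. w = nw \<alpha> \<alpha>" if "q w \<noteq> 0" for w
    using isdiag_NF[OF q(2,1) dq that] that by (auto simp: S_def)
  have inj: "inj_on (\<lambda>\<alpha>. nw \<alpha> \<alpha> :: ('v,'e) gen list) S"
    by (rule inj_onI) (use nw_inj S_def in blast)
  have finS: "finite S"
    by (rule inj_on_finite[OF inj, of "{w. q w \<noteq> 0}"]) (use q' in \<open>auto simp: S_def ncpoly_def\<close>)
  have "q = psum (Inr ` S) (\<lambda>\<alpha>. psmult (case \<alpha> of Inl v \<Rightarrow> 0 | Inr es \<Rightarrow> q (nw es es))
     (pmul (mono (path_word \<alpha>)) (pstar (mono (path_word \<alpha>)))))" (is "_ = ?P")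
  proof
    fix w
    have gs: "map gstar (rev (map GE \<alpha>)) = map GS (rev \<alpha>)" for \<alpha> :: "'e list"
      by (simp add: rev_map comp_def)
    have "?P w = (\<Sum>\<alpha>\<in>S. q (nw \<alpha> \<alpha>) * mono (nw \<alpha> \<alpha>) w)"
      unfolding psum_def
      by (subst sum.reindex) (simp_all add: psmult_def pstar_mono pmul_mono_mono nw_def gs)
    also have "\<dots> = q w"
    proof (cases "q w = 0")
      case True
      then have "(\<Sum>\<alpha>\<in>S. q (nw \<alpha> \<alpha>) * mono (nw \<alpha> \<alpha>) w) = 0"
        by (intro sum.neutral) (auto simp: mono_def)
      then show ?thesis using True by simp
    next
      case False
      then obtain \<alpha> where \<alpha>: "\<alpha> \<in> S" "w = nw \<alpha> \<alpha>" using supp by blast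
      have "(\<Sum>\<alpha>'\<in>S. q (nw \<alpha>' \<alpha>') * mono (nw \<alpha>' \<alpha>') w) = (\<Sum>\<alpha>'\<in>S. if \<alpha>' = \<alpha> then q w else 0)"
        by (rule sum.cong[OF refl]) (use inj \<alpha> in \<open>auto simp: mono_def inj_on_def\<close>)
      then show ?thesis using \<alpha> finS by simp
    qed
    finally show "q w = ?P w" by simp
  qed
  moreover have "is_path G (Inr \<alpha>)" if "\<alpha> \<in> S" for \<alpha>
  proof -
    obtain \<alpha>' v u where *: "nw \<alpha> \<alpha> = (nw \<alpha>' \<alpha>' :: ('v,'e) gen list)" "length \<alpha>' = N" "fpath G v \<alpha>' u"
      using isdiag_NF[OF q(2,1) dq, of "nw \<alpha> \<alpha>"] \<open>\<alpha> \<in> S\<close> by (auto simp: S_def)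
    then have "\<alpha> = \<alpha>'" using nw_inj[OF *(1)] that by (auto simp: S_def)
    moreover have "\<alpha> \<noteq> []" using that q(1) by (auto simp: S_def)
    ultimately show ?thesis using *(3) fpath_imp_is_edge_path by (auto simp: is_path_def)
  qed
  ultimately have "q \<in> diag_polys R G"
    unfolding diag_polys_def using finS q'
    by (intro CollectI exI[of _ "Inr ` S"] exI[of _ "\<lambda>\<alpha>. case \<alpha> of Inl v \<Rightarrow> 0 | Inr es \<Rightarrow> q (nw es es)"])
       (auto simp: ncpoly_alt split: sum.splits)
  then show ?thesis using q by blast
qed

lemma path_word_proj:
  "pmul (mono (path_word \<alpha>)) (pstar (mono (path_word \<alpha>))) =
    mono (case \<alpha> of Inl v \<Rightarrow> [GV v, GV v] | Inr es \<Rightarrow> nw es es)"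
  by (cases \<alpha>) (simp_all add: pmul_mono_mono pstar_mono nw_def rev_map comp_def)

lemma diag_poly_ncpoly:
  assumes "p \<in> diag_polys R G"
  shows "p \<in> ncpoly R G"
proof -
  obtain S c where p: "p = psum S (\<lambda>\<alpha>. psmult (c \<alpha>) (pmul (mono (path_word \<alpha>)) (pstar (mono (path_word \<alpha>)))))"
    "finite S" "S \<subseteq> {\<alpha>. is_path G \<alpha>}" "\<And>\<alpha>. c \<alpha> \<in> R" using assms by (auto simp: diag_polys_def)
  have "mono (case \<alpha> of Inl v \<Rightarrow> [GV v, GV v] | Inr es \<Rightarrow> nw es es) \<in> ncpoly R G" if "\<alpha> \<in> S" for \<alpha>
  proof -
    have "is_path G \<alpha>" using p(3) that by blast
    then show ?thesis
      by (intro ncpoly_mono) (auto simp: is_path_def nw_def is_edge_path_def split: sum.splits)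
  qed
  then show ?thesis unfolding p(1) path_word_proj
    by (intro ncpoly_psum[OF p(2)] ncpoly_psmult p(4)) auto
qed

lemma diag_poly_isdiag:
  assumes "p \<in> diag_polys R G"
  shows "isdiag p"
proof -
  obtain S c where p: "p = psum S (\<lambda>\<alpha>. psmult (c \<alpha>) (pmul (mono (path_word \<alpha>)) (pstar (mono (path_word \<alpha>)))))"
    "finite S" using assms by (auto simp: diag_polys_def)
  have "opr G p \<xi> x = dval p x * \<xi> x" if x: "x \<in> ipaths G" for x \<xi>
  proof -
    have one: "opr G (mono (case \<alpha> of Inl v \<Rightarrow> [GV v, GV v] | Inr es \<Rightarrow> nw es es)) \<xi> x =
       (if (case \<alpha> of Inl v \<Rightarrow> source G x = v | Inr es \<Rightarrow> stake (length es) x = es) then \<xi> x else 0)" for \<alpha> \<xi>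
      by (cases \<alpha>) (auto simp: opr_mono wact_nw_self[OF x])
    show ?thesis
      unfolding dval_def p(1) path_word_proj using p(2)
      by (simp add: opr_psum one sum_distrib_right) (auto intro!: sum.cong)
  qed
  then show ?thesis by (simp add: isdiag_def)
qed

text \<open>On the cylinder of a prefix of length \<open>N\<close> the value is the sum of the
  normal form coefficients belonging to this prefix. Membership in \<open>R\<close> is needed to use
  the value as a scalar in \<open>corr_exists_left\<close>.\<close>

lemma dval_locally_constant:
  assumes "p \<in> ncpoly R G" "isdiag p"
  shows "\<exists>n>0. \<forall>x\<in>ipaths G. dval p x \<in> R \<and> (\<forall>x'\<in>ipaths G. stake n x = stake n x' \<longrightarrow> dval p x = dval p x')"
proof -
  obtain N q where q: "N > 0" "q \<in> NF N" "cg p q" using normal_form[OF assms(1)] by blast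
  have q': "q \<in> ncpoly R G" using q by (simp add: NF_def)
  have eq: "eqv p q" using cg_imp_eqv[OF assms(1) q' q(3)] .
  have "dval p x = (\<Sum>\<beta> | q (nw (stake N x) \<beta>) \<noteq> 0. q (nw (stake N x) \<beta>))" if x: "x \<in> ipaths G" for x
    using opr_NF(1)[OF q(2,1) fpath_stake[OF x, of N] _ ipaths_sdrop[OF x] refl, of "\<lambda>_. 1"]
    dval_eqv[OF eq x] by (simp add: dval_def stake_sdrop)
  then show ?thesis using q(1) q' by (intro exI[of _ N]) (auto simp: ncpoly_alt intro!: R_sum)
qed

lemma proj_diag: "x \<in> ipaths G \<Longrightarrow> opr G (mono (nw \<alpha> \<alpha>)) \<xi> x = (if stake (length \<alpha>) x = \<alpha> then \<xi> x else 0)"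
  by (simp add: opr_mono wact_nw_self)

lemma isdiag_proj: "isdiag (mono (nw \<alpha> \<alpha>))"
  unfolding isdiag_def dval_def by (simp add: proj_diag)

lemma dval_proj: "x \<in> ipaths G \<Longrightarrow> dval (mono (nw \<alpha> \<alpha>)) x = (if stake (length \<alpha>) x = \<alpha> then 1 else 0)"
  by (simp add: dval_def proj_diag)

lemma proj_ncpoly: "fpath G v \<alpha> u \<Longrightarrow> \<alpha> \<noteq> [] \<Longrightarrow> mono (nw \<alpha> \<alpha>) \<in> ncpoly R G"
  using nw_ncpoly by blast

lemma stake_proj_ncpoly: "x \<in> ipaths G \<Longrightarrow> mono (nw (stake (Suc n) x) (stake (Suc n) x)) \<in> ncpoly R G"
  using proj_ncpoly[OF fpath_stake[of x G "Suc n"]] by simp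

lemma row_cong:
  assumes "p \<in> ncpoly R G" "x \<in> ipaths G" "\<And>y. y \<in> ipaths G \<Longrightarrow> \<xi> y = \<xi>' y"
  shows "opr G p \<xi> x = opr G p \<xi>' x"
proof (rule opr_cong_row)
  fix w y assume "p w \<noteq> 0" "wact G w x = Some y"
  then show "\<xi> y = \<xi>' y" using assms wact_ipaths[of G w x y] by (auto simp: ncpoly_alt)
qed

text \<open>Represents the unit for every positive \<open>n\<close>; the choice of \<open>n\<close>
  sets the fineness of the partition into cylinders.\<close>

definition unit_poly :: "nat \<Rightarrow> ('v,'e) ncp" where
  "unit_poly n = psum {\<alpha>. length \<alpha> = n \<and> (\<exists>v w. fpath G v \<alpha> w)} (\<lambda>\<alpha>. mono (nw \<alpha> \<alpha>))"

lemma unit_poly_ncpoly: "n > 0 \<Longrightarrow> unit_poly n \<in> ncpoly R G"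
  unfolding unit_poly_def by (rule ncpoly_psum[OF finite_fpaths[OF finite_edges]]) (use proj_ncpoly in auto)

lemma opr_unit_poly: "x \<in> ipaths G \<Longrightarrow> opr G (unit_poly n) \<xi> x = \<xi> x"
proof -
  assume x: "x \<in> ipaths G"
  let ?P = "{\<alpha>. length \<alpha> = n \<and> (\<exists>v w. fpath G v \<alpha> w)}"
  have fin: "finite ?P" using finite_fpaths[OF finite_edges] by simp
  have "opr G (unit_poly n) \<xi> x = (\<Sum>\<alpha>\<in>?P. if \<alpha> = stake n x then \<xi> x else 0)"
    unfolding unit_poly_def using x by (subst opr_psum[OF fin]) (auto simp: proj_diag intro!: sum.cong)
  also have "\<dots> = \<xi> x" using fin fpath_stake[OF x, of n] by auto
  finally show ?thesis .
qed

end

lemma opr_row_diff: "opr G p (\<lambda>y. \<xi> y - \<zeta> y) x = opr G p \<xi> x - opr G p \<zeta> x"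
  unfolding opr_def lin_def sum_subtractf[symmetric]
  by (intro sum.cong) (auto simp: algebra_simps split: option.splits)

section \<open>The quotient algebra described through operators\<close>

context leavitt
begin

lemma gstar_gens: "g \<in> gens G \<Longrightarrow> gstar g \<in> gens G"
  by (cases g) auto

lemma eqv_refl [simp]: "eqv p p"
  by (simp add: eqv_def)

lemma eqv_sym: "eqv p q \<Longrightarrow> eqv q p"
  by (simp add: eqv_def)

lemma eqv_trans [trans]: "eqv p q \<Longrightarrow> eqv q r \<Longrightarrow> eqv p r"
  by (simp add: eqv_def)

lemma opr_eqv: "eqv p q \<Longrightarrow> x \<in> ipaths G \<Longrightarrow> opr G p \<xi> x = opr G q \<xi> x"
  by (simp add: eqv_def)

lemma eqv_pmul:
  assumes "p \<in> ncpoly R G" "p' \<in> ncpoly R G" "q \<in> ncpoly R G" "q' \<in> ncpoly R G" "eqv p p'" "eqv q q'"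
  shows "eqv (pmul p q) (pmul p' q')"
  using assms row_cong[of p _ "opr G q \<xi>" "opr G q' \<xi>" for \<xi>] by (simp add: eqv_def opr_pmul)

lemma eqv_padd:
  assumes "p \<in> ncpoly R G" "p' \<in> ncpoly R G" "q \<in> ncpoly R G" "q' \<in> ncpoly R G" "eqv p p'" "eqv q q'"
  shows "eqv (padd p q) (padd p' q')"
  using assms by (simp add: eqv_def)

lemma eqv_psmult:
  assumes "p \<in> ncpoly R G" "p' \<in> ncpoly R G" "eqv p p'"
  shows "eqv (psmult c p) (psmult c p')"
  using assms by (simp add: eqv_def)

text \<open>Soundness and faithfulness together replace congruence modulo the ideal by equality of
  operators on paths.\<close>

lemma lpa_cls_alt: "p \<in> ncpoly R G \<Longrightarrow> lpa_cls R G p = {q \<in> ncpoly R G. eqv p q}"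
  unfolding lpa_cls_def using cg_imp_eqv eqv_imp_cg by (auto simp: cg_def)

lemma lpa_cls_eq_iff:
  "p \<in> ncpoly R G \<Longrightarrow> q \<in> ncpoly R G \<Longrightarrow> lpa_cls R G p = lpa_cls R G q \<longleftrightarrow> eqv p q"
proof -
  assume p: "p \<in> ncpoly R G" "q \<in> ncpoly R G"
  show ?thesis
  proof
    assume "lpa_cls R G p = lpa_cls R G q"
    moreover have "q \<in> lpa_cls R G q" using p by (simp add: lpa_cls_alt)
    ultimately have "q \<in> lpa_cls R G p" by simp
    then show "eqv p q" using p(1) by (simp add: lpa_cls_alt)
  next
    assume "eqv p q"
    then have "eqv p r \<longleftrightarrow> eqv q r" for r using eqv_trans eqv_sym by blast
    then show "lpa_cls R G p = lpa_cls R G q" using p by (simp add: lpa_cls_alt)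
  qed
qed

lemma rep_lpa_cls:
  assumes "p \<in> ncpoly R G"
  shows "rep (lpa_cls R G p) \<in> ncpoly R G" "eqv p (rep (lpa_cls R G p))"
proof -
  have "rep (lpa_cls R G p) \<in> lpa_cls R G p"
    unfolding rep_def by (rule someI[of _ p]) (use assms in \<open>simp add: lpa_cls_alt\<close>)
  then show "rep (lpa_cls R G p) \<in> ncpoly R G" "eqv p (rep (lpa_cls R G p))"
    using assms by (auto simp: lpa_cls_alt)
qed

lemma rep_lpa:
  assumes "A \<in> lpa R G"
  shows "rep A \<in> ncpoly R G" "lpa_cls R G (rep A) = A"
proof -
  obtain p where "p \<in> ncpoly R G" "A = lpa_cls R G p" using assms by (auto simp: lpa_def)
  then show "rep A \<in> ncpoly R G" "lpa_cls R G (rep A) = A"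
    using rep_lpa_cls lpa_cls_eq_iff eqv_sym by metis+
qed

lemma lpa_cls_in [simp]: "p \<in> ncpoly R G \<Longrightarrow> lpa_cls R G p \<in> lpa R G"
  by (simp add: lpa_def)

lemma lpa_ops_cls:
  assumes "p \<in> ncpoly R G" "q \<in> ncpoly R G"
  shows "lpa_mul R G (lpa_cls R G p) (lpa_cls R G q) = lpa_cls R G (pmul p q)"
    and "lpa_add R G (lpa_cls R G p) (lpa_cls R G q) = lpa_cls R G (padd p q)"
    and "c \<in> R \<Longrightarrow> lpa_smult R G c (lpa_cls R G p) = lpa_cls R G (psmult c p)"
  unfolding lpa_mul_def lpa_add_def lpa_smult_def
  using assms rep_lpa_cls
  by (simp_all add: lpa_cls_eq_iff eqv_pmul eqv_padd eqv_psmult eqv_sym)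

end

section \<open>Diagonal-preserving isomorphisms\<close>

text \<open>The isomorphism and its inverse are represented by maps of polynomials that are
  compatible with \<open>eqv\<close>, so that no quotient has to be handled. Only one inclusion of
  diagonals is assumed; the other one is derived.\<close>

locale diag_iso = E: leavitt E R + F: leavitt F R
  for E :: "('v,'e) graph" and F :: "('w,'f) graph" and R +
  fixes \<Phi> :: "('v,'e) ncp \<Rightarrow> ('w,'f) ncp" and \<Psi> :: "('w,'f) ncp \<Rightarrow> ('v,'e) ncp"
  assumes Phi_in [simp]: "p \<in> ncpoly R E \<Longrightarrow> \<Phi> p \<in> ncpoly R F"
    and Psi_in [simp]: "r \<in> ncpoly R F \<Longrightarrow> \<Psi> r \<in> ncpoly R E"
    and Phi_eqv: "p \<in> ncpoly R E \<Longrightarrow> q \<in> ncpoly R E \<Longrightarrow> E.eqv p q \<Longrightarrow> F.eqv (\<Phi> p) (\<Phi> q)"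
    and Psi_eqv: "r \<in> ncpoly R F \<Longrightarrow> s \<in> ncpoly R F \<Longrightarrow> F.eqv r s \<Longrightarrow> E.eqv (\<Psi> r) (\<Psi> s)"
    and Phi_mul: "p \<in> ncpoly R E \<Longrightarrow> q \<in> ncpoly R E \<Longrightarrow> F.eqv (\<Phi> (pmul p q)) (pmul (\<Phi> p) (\<Phi> q))"
    and Phi_add: "p \<in> ncpoly R E \<Longrightarrow> q \<in> ncpoly R E \<Longrightarrow> F.eqv (\<Phi> (padd p q)) (padd (\<Phi> p) (\<Phi> q))"
    and Phi_smult: "p \<in> ncpoly R E \<Longrightarrow> c \<in> R \<Longrightarrow> F.eqv (\<Phi> (psmult c p)) (psmult c (\<Phi> p))"
    and PsiPhi: "p \<in> ncpoly R E \<Longrightarrow> E.eqv (\<Psi> (\<Phi> p)) p"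
    and PhiPsi: "r \<in> ncpoly R F \<Longrightarrow> F.eqv (\<Phi> (\<Psi> r)) r"
    and Phi_diag: "p \<in> ncpoly R E \<Longrightarrow> E.isdiag p \<Longrightarrow> F.isdiag (\<Phi> p)"
begin

lemma Phi_inj:
  assumes "p \<in> ncpoly R E" "q \<in> ncpoly R E" "F.eqv (\<Phi> p) (\<Phi> q)"
  shows "E.eqv p q"
proof -
  have "E.eqv (\<Psi> (\<Phi> p)) (\<Psi> (\<Phi> q))" using assms by (intro Psi_eqv) auto
  then show ?thesis using PsiPhi[OF assms(1)] PsiPhi[OF assms(2)] by (meson E.eqv_sym E.eqv_trans)
qed

lemma Psi_mul:
  assumes "p \<in> ncpoly R F" "q \<in> ncpoly R F"
  shows "E.eqv (\<Psi> (pmul p q)) (pmul (\<Psi> p) (\<Psi> q))"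
proof (rule Phi_inj)
  have "F.eqv (\<Phi> (\<Psi> (pmul p q))) (pmul p q)" using assms by (intro PhiPsi) auto
  moreover have "F.eqv (\<Phi> (pmul (\<Psi> p) (\<Psi> q))) (pmul (\<Phi> (\<Psi> p)) (\<Phi> (\<Psi> q)))" using assms by (intro Phi_mul) auto
  moreover have "F.eqv (pmul (\<Phi> (\<Psi> p)) (\<Phi> (\<Psi> q))) (pmul p q)"
    using assms by (intro F.eqv_pmul PhiPsi) auto
  ultimately show "F.eqv (\<Phi> (\<Psi> (pmul p q))) (\<Phi> (pmul (\<Psi> p) (\<Psi> q)))" by (meson F.eqv_sym F.eqv_trans)
qed (use assms in auto)

lemma Psi_add:
  assumes "p \<in> ncpoly R F" "q \<in> ncpoly R F"
  shows "E.eqv (\<Psi> (padd p q)) (padd (\<Psi> p) (\<Psi> q))"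
proof (rule Phi_inj)
  have "F.eqv (\<Phi> (\<Psi> (padd p q))) (padd p q)" using assms by (intro PhiPsi) auto
  moreover have "F.eqv (\<Phi> (padd (\<Psi> p) (\<Psi> q))) (padd (\<Phi> (\<Psi> p)) (\<Phi> (\<Psi> q)))" using assms by (intro Phi_add) auto
  moreover have "F.eqv (padd (\<Phi> (\<Psi> p)) (\<Phi> (\<Psi> q))) (padd p q)"
    using assms by (intro F.eqv_padd PhiPsi) auto
  ultimately show "F.eqv (\<Phi> (\<Psi> (padd p q))) (\<Phi> (padd (\<Psi> p) (\<Psi> q)))" by (meson F.eqv_sym F.eqv_trans)
qed (use assms in auto)

lemma Psi_smult:
  assumes "p \<in> ncpoly R F" "c \<in> R"
  shows "E.eqv (\<Psi> (psmult c p)) (psmult c (\<Psi> p))"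
proof (rule Phi_inj)
  have "F.eqv (\<Phi> (\<Psi> (psmult c p))) (psmult c p)" using assms by (intro PhiPsi) auto
  moreover have "F.eqv (\<Phi> (psmult c (\<Psi> p))) (psmult c (\<Phi> (\<Psi> p)))" using assms by (intro Phi_smult) auto
  moreover have "F.eqv (psmult c (\<Phi> (\<Psi> p))) (psmult c p)"
    using assms by (intro F.eqv_psmult PhiPsi) auto
  ultimately show "F.eqv (\<Phi> (\<Psi> (psmult c p))) (\<Phi> (psmult c (\<Psi> p)))" by (meson F.eqv_sym F.eqv_trans)
qed (use assms in auto)

lemma Phi_zero: "p \<in> ncpoly R E \<Longrightarrow> E.eqv p pzero \<Longrightarrow> F.eqv (\<Phi> p) pzero"
proof -
  assume p: "p \<in> ncpoly R E" "E.eqv p pzero"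
  then have "E.eqv p (psmult 0 p)" by (simp add: E.eqv_def)
  then have "F.eqv (\<Phi> p) (\<Phi> (psmult 0 p))" using p by (intro Phi_eqv) auto
  also have "F.eqv (\<Phi> (psmult 0 p)) (psmult 0 (\<Phi> p))" using p by (intro Phi_smult) auto
  also have "F.eqv (psmult 0 (\<Phi> p)) pzero" using p by (simp add: F.eqv_def)
  finally show ?thesis .
qed

lemma opr_Phi_mul:
  assumes "p \<in> ncpoly R E" "q \<in> ncpoly R E" "y \<in> ipaths F"
  shows "opr F (\<Phi> (pmul p q)) \<xi> y = opr F (\<Phi> p) (opr F (\<Phi> q) \<xi>) y"
  using F.opr_eqv[OF Phi_mul[OF assms(1,2)] assms(3)] assms by (simp add: opr_pmul)

lemma opr_Phi_psum:
  assumes "finite S" "\<And>s. s \<in> S \<Longrightarrow> f s \<in> ncpoly R E" "y \<in> ipaths F"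
  shows "opr F (\<Phi> (psum S f)) \<xi> y = (\<Sum>s\<in>S. opr F (\<Phi> (f s)) \<xi> y)"
  using assms(1,2)
proof (induction S rule: finite_induct)
  case empty
  then show ?case using F.opr_eqv[OF Phi_zero[of pzero] assms(3)] by simp
next
  case (insert s S)
  have "psum S f \<in> ncpoly R E" using insert by (intro E.ncpoly_psum) auto
  then show ?case
    using insert F.opr_eqv[OF Phi_add[of "f s" "psum S f"] assms(3)]
    by (simp add: psum_insert)
qed

text \<open>The diagonal is its own commutant, so the inverse also preserves diagonals.\<close>

lemma Psi_diag:
  assumes r: "r \<in> ncpoly R F" "F.isdiag r"
  shows "E.isdiag (\<Psi> r)"
proof -
  let ?p = "\<Psi> r"
  have p: "?p \<in> ncpoly R E" using r by simp
  have pr: "F.isdiag (\<Phi> ?p)" using F.isdiag_eqv[OF F.eqv_sym[OF PhiPsi]] r by blast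
  have comm: "E.eqv (pmul ?p d) (pmul d ?p)" if d: "d \<in> ncpoly R E" "E.isdiag d" for d
  proof (rule Phi_inj)
    have dd: "F.isdiag (\<Phi> d)" using Phi_diag d by blast
    have "F.eqv (pmul (\<Phi> ?p) (\<Phi> d)) (pmul (\<Phi> d) (\<Phi> ?p))"
      unfolding F.eqv_def
    proof (intro ballI allI)
      fix y \<xi> assume y: "y \<in> ipaths F"
      then show "opr F (pmul (\<Phi> ?p) (\<Phi> d)) \<xi> y = opr F (pmul (\<Phi> d) (\<Phi> ?p)) \<xi> y"
        using p d pr dd by (simp add: opr_pmul F.isdiag_def)
    qed
    then show "F.eqv (\<Phi> (pmul ?p d)) (\<Phi> (pmul d ?p))"
      using Phi_mul[OF p d(1)] Phi_mul[OF d(1) p] by (meson F.eqv_sym F.eqv_trans)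
  qed (use p d in auto)
  \<comment> \<open>A cylinder projection containing \<open>x'\<close> but not \<open>x\<close> does
    not change the entry when applied on the right and kills it when applied on the left.\<close>
  have off: "opr E ?p (delta x') x = 0" if x: "x \<in> ipaths E" "x' \<in> ipaths E" "x \<noteq> x'" for x x'
  proof -
    obtain n where n: "stake (Suc n) x \<noteq> stake (Suc n) x'" using x(3) stake_eqI by blast
    define d where "d = (mono (nw (stake (Suc n) x') (stake (Suc n) x')) :: ('v,'e) ncp)"
    have d: "d \<in> ncpoly R E" unfolding d_def using E.stake_proj_ncpoly x by blast
    have od: "opr E d \<xi> x1 = (if stake (Suc n) x1 = stake (Suc n) x' then \<xi> x1 else 0)" if "x1 \<in> ipaths E" for x1 \<xi>
      unfolding d_def using E.proj_diag[OF that] by simp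
    have "opr E ?p (delta x') x = opr E ?p (opr E d (delta x')) x"
      by (rule E.row_cong[OF p x(1)]) (auto simp: od delta_def)
    also have "\<dots> = opr E (pmul ?p d) (delta x') x" using p d by (simp add: opr_pmul)
    also have "\<dots> = opr E (pmul d ?p) (delta x') x"
      using E.opr_eqv[OF comm[OF d] x(1)] E.isdiag_proj by (simp add: d_def)
    also have "\<dots> = 0" using p d n by (simp add: opr_pmul od[OF x(1)] del: stake.simps)
    finally show ?thesis .
  qed
  show ?thesis
    unfolding E.isdiag_def
  proof (intro ballI allI)
    fix x \<xi> assume x: "x \<in> ipaths E"
    \<comment> \<open>The row at \<open>x\<close> is supported at \<open>x\<close> alone, so \<xi>
      can be replaced by a constant. The factor 1 gives the constant the shape that
      \<open>opr_linear_row\<close> expects.\<close>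
    have "opr E ?p (\<lambda>y. \<xi> y - \<xi> x * 1) x = 0"
    proof (rule ccontr)
      assume nz: "opr E ?p (\<lambda>y. \<xi> y - \<xi> x * 1) x \<noteq> 0"
      obtain y where y: "\<xi> y - \<xi> x * 1 \<noteq> 0" "opr E ?p (delta y) x \<noteq> 0"
        using opr_nonzero_delta[OF nz E.ncpoly_fsupp[OF p]] by blast
      then obtain w where "?p w \<noteq> 0" "wact E w x = Some y" using opr_delta_nonzero by blast
      then have "y \<in> ipaths E" using wact_ipaths[of E w x y] x p by (auto simp: E.ncpoly_alt)
      moreover have "y \<noteq> x" using y by auto
      ultimately show False using off x y by blast
    qed
    then have "opr E ?p \<xi> x = opr E ?p (\<lambda>y. \<xi> x * 1) x"
      using opr_row_diff[of E ?p \<xi> "\<lambda>_. \<xi> x * 1" x] by simp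
    also have "\<dots> = \<xi> x * opr E ?p (\<lambda>_. 1) x" by (rule opr_linear_row)
    finally show "opr E ?p \<xi> x = E.dval ?p x * \<xi> x" by (simp add: E.dval_def)
  qed
qed

lemma symmetric: "diag_iso F E R \<Psi> \<Phi>"
  by (rule diag_iso.intro[OF F.leavitt_axioms E.leavitt_axioms diag_iso_axioms.intro],
      erule Psi_in, erule Phi_in, erule (2) Psi_eqv, erule (2) Phi_eqv, erule (1) Psi_mul,
      erule (1) Psi_add, erule (1) Psi_smult, erule PhiPsi, erule PsiPhi, erule (1) Psi_diag)

section \<open>Corresponding points: those that induce the same character of the diagonal\<close>

definition corr :: "'e stream \<Rightarrow> 'f stream \<Rightarrow> bool" where
  "corr x y \<longleftrightarrow> x \<in> ipaths E \<and> y \<in> ipaths F \<and>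
     (\<forall>p\<in>ncpoly R E. E.isdiag p \<longrightarrow> E.dval p x = F.dval (\<Phi> p) y)"

lemma corr_unique_left:
  assumes "corr x y" "corr x' y"
  shows "x = x'"
proof (rule stake_eqI)
  fix n
  let ?\<alpha> = "stake (Suc n) x"
  have x: "x \<in> ipaths E" "x' \<in> ipaths E" using assms by (auto simp: corr_def)
  have "E.dval (mono (nw ?\<alpha> ?\<alpha>)) x' = E.dval (mono (nw ?\<alpha> ?\<alpha>)) x"
    using assms E.stake_proj_ncpoly[OF x(1)] E.isdiag_proj unfolding corr_def by metis
  then show "stake (Suc n) x = stake (Suc n) x'"
    using x by (simp add: E.dval_proj split: if_splits)
qed

lemma dval_Phi_mul:
  assumes "p \<in> ncpoly R E" "E.isdiag p" "q \<in> ncpoly R E" "y \<in> ipaths F"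
  shows "F.dval (\<Phi> (pmul p q)) y = F.dval (\<Phi> p) y * F.dval (\<Phi> q) y"
proof -
  have "opr F (\<Phi> p) (opr F (\<Phi> q) (\<lambda>_. 1)) y = F.dval (\<Phi> p) y * opr F (\<Phi> q) (\<lambda>_. 1) y"
    using Phi_diag[OF assms(1,2)] assms(4) unfolding F.isdiag_def by blast
  then show ?thesis by (simp add: F.dval_def opr_Phi_mul[OF assms(1,3,4)])
qed

text \<open>Evaluation at \<open>y\<close> after \<Phi> is multiplicative on the diagonal of
  \<open>E\<close>, hence 0 or 1 on cylinder projections. The projections of a fixed length sum to
  the unit, so one of them has value 1; incompatible projections have product zero, so the selected
  prefixes are nested and converge to \<open>x\<close>.\<close>

lemma corr_exists_left:
  assumes y: "y \<in> ipaths F"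
  shows "\<exists>x. corr x y"
proof -
  define pr where "pr \<alpha> = (mono (nw \<alpha> \<alpha>) :: ('v,'e) ncp)" for \<alpha>
  define P where "P n = {\<alpha>. length \<alpha> = n \<and> (\<exists>v w. fpath E v \<alpha> w)}" for n
  define ev where "ev p = F.dval (\<Phi> p) y" for p
  have pr: "pr \<alpha> \<in> ncpoly R E" "E.isdiag (pr \<alpha>)" if \<alpha>: "\<alpha> \<in> P (Suc n)" for \<alpha> n
  proof -
    obtain v w where "length \<alpha> = Suc n" "fpath E v \<alpha> w" using \<alpha> by (auto simp: P_def)
    then show "pr \<alpha> \<in> ncpoly R E" using E.proj_ncpoly[of v \<alpha> w] by (cases \<alpha>) (auto simp: pr_def)
  qed (simp add: pr_def E.isdiag_proj)
  have ev_mul: "ev (pmul (pr \<alpha>) q) = ev (pr \<alpha>) * ev q" if "\<alpha> \<in> P (Suc n)" "q \<in> ncpoly R E" for \<alpha> q n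
    unfolding ev_def using dval_Phi_mul pr[OF that(1)] that(2) y by blast
  have ev_eqv: "ev p = ev q" if "p \<in> ncpoly R E" "q \<in> ncpoly R E" "E.eqv p q" for p q
    unfolding ev_def using F.dval_eqv[OF Phi_eqv] that y by blast
  have ev_zero: "ev p = 0" if "p \<in> ncpoly R E" "E.eqv p pzero" for p
    unfolding ev_def using F.dval_eqv[OF Phi_zero y] that by (simp add: F.dval_def)
  have idem: "ev (pr \<alpha>) = 0 \<or> ev (pr \<alpha>) = 1" if \<alpha>: "\<alpha> \<in> P (Suc n)" for \<alpha> n
  proof -
    have "E.eqv (pmul (pr \<alpha>) (pr \<alpha>)) (pr \<alpha>)"
      using pr[OF \<alpha>] unfolding E.eqv_def by (simp add: opr_pmul) (simp add: pr_def E.proj_diag)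
    then have "ev (pr \<alpha>) * ev (pr \<alpha>) = ev (pr \<alpha>)"
      using ev_eqv[of "pmul (pr \<alpha>) (pr \<alpha>)" "pr \<alpha>"] ev_mul[OF \<alpha>] pr[OF \<alpha>] by simp
    then show ?thesis by auto
  qed
  have unit: "ev (E.unit_poly (Suc n)) = 1" for n
  proof -
    \<comment> \<open>That the image of a unit acts as a unit follows from surjectivity:
      \<open>r\<close> is a unit of \<open>F\<close>, and the unit of \<open>E\<close> leaves its
      preimage unchanged.\<close>
    define r where "r = F.unit_poly 1"
    have r: "r \<in> ncpoly R F" unfolding r_def by (rule F.unit_poly_ncpoly) simp
    let ?u = "E.unit_poly (Suc n)"
    have u: "?u \<in> ncpoly R E" by (rule E.unit_poly_ncpoly) simp
    have "E.eqv (pmul ?u (\<Psi> r)) (\<Psi> r)"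
      unfolding E.eqv_def using u r by (simp add: opr_pmul E.opr_unit_poly)
    then have "F.eqv (\<Phi> (pmul ?u (\<Psi> r))) (\<Phi> (\<Psi> r))" using u r by (intro Phi_eqv) auto
    then have "opr F (\<Phi> (pmul ?u (\<Psi> r))) (\<lambda>_. 1) y = opr F (\<Phi> (\<Psi> r)) (\<lambda>_. 1) y"
      using y by (rule F.opr_eqv)
    then have "opr F (\<Phi> ?u) (opr F (\<Phi> (\<Psi> r)) (\<lambda>_. 1)) y = opr F (\<Phi> (\<Psi> r)) (\<lambda>_. 1) y"
      using opr_Phi_mul[OF u Psi_in[OF r] y] by simp
    moreover have "opr F (\<Phi> (\<Psi> r)) (\<lambda>_. 1) y' = 1" if "y' \<in> ipaths F" for y'
      using F.opr_eqv[OF PhiPsi[OF r] that] F.opr_unit_poly[OF that] by (simp add: r_def)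
    ultimately show ?thesis
      unfolding ev_def F.dval_def
      using F.row_cong[of "\<Phi> ?u" y "opr F (\<Phi> (\<Psi> r)) (\<lambda>_. 1)" "\<lambda>_. 1"] u y by simp
  qed
  have ex: "\<exists>\<alpha>\<in>P (Suc n). ev (pr \<alpha>) = 1" for n
  proof (rule ccontr)
    assume "\<not> ?thesis"
    then have "ev (pr \<alpha>) = 0" if "\<alpha> \<in> P (Suc n)" for \<alpha> using idem that by blast
    then have "(\<Sum>\<alpha>\<in>P (Suc n). ev (pr \<alpha>)) = 0" by simp
    moreover have "ev (E.unit_poly (Suc n)) = (\<Sum>\<alpha>\<in>P (Suc n). ev (pr \<alpha>))"
      unfolding ev_def F.dval_def E.unit_poly_def P_def[symmetric] pr_def[symmetric]
      using pr finite_fpaths[OF E.finite_edges] y by (intro opr_Phi_psum) (auto simp: P_def)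
    ultimately show False using unit[of n] by simp
  qed
  define a where "a n = (SOME \<alpha>. \<alpha> \<in> P (Suc n) \<and> ev (pr \<alpha>) = 1)" for n
  have a: "a n \<in> P (Suc n)" "ev (pr (a n)) = 1" for n
    using someI_ex[of "\<lambda>\<alpha>. \<alpha> \<in> P (Suc n) \<and> ev (pr \<alpha>) = 1"] ex[of n] unfolding a_def by auto
  have len: "length (a n) = Suc n" for n using a(1)[of n] by (simp add: P_def)
  have pra: "pr (a n) \<in> ncpoly R E" for n using pr(1)[OF a(1)] .
  have compat: "take (Suc m) (a n) = a m" if "m \<le> n" for m n
  proof (rule ccontr)
    assume ne: "take (Suc m) (a n) \<noteq> a m"
    have "E.eqv (pmul (pr (a n)) (pr (a m))) pzero"
      unfolding E.eqv_def
    proof (intro ballI allI)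
      fix x \<xi> assume x: "x \<in> ipaths E"
      have "take (Suc m) (stake (Suc n) x) = stake (Suc m) x"
        using that by (simp only: take_stake) (simp add: min_def)
      then have "\<not> (stake (Suc n) x = a n \<and> stake (Suc m) x = a m)" using ne by metis
      then show "opr E (pmul (pr (a n)) (pr (a m))) \<xi> x = opr E pzero \<xi> x"
        using pra by (simp add: opr_pmul del: stake.simps) (auto simp: pr_def E.proj_diag x len simp del: stake.simps)
    qed
    then have "ev (pmul (pr (a n)) (pr (a m))) = 0" using ev_zero pra by simp
    then show False using ev_mul[OF a(1) pra, of n m] a(2) by simp
  qed
  define x where "x = smap (\<lambda>n. a n ! n) nats"
  have xn: "x !! n = a n ! n" for n by (simp add: x_def)
  have an: "a n ! i = x !! i" if "i \<le> n" for i n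
    using compat[OF that] by (metis xn lessI nth_take)
  have st: "stake (Suc n) x = a n" for n
    by (rule nth_equalityI) (simp_all add: len an del: stake.simps)
  have x: "x \<in> ipaths E"
    unfolding ipaths_def
  proof (intro CollectI allI)
    fix n
    obtain v w where "fpath E v (a (Suc n)) w" using a(1)[of "Suc n"] by (auto simp: P_def)
    then have "is_edge_path E (a (Suc n))" using len[of "Suc n"] by (intro fpath_imp_is_edge_path) auto
    then have "a (Suc n) ! n \<in> edges E \<and> rng E (a (Suc n) ! n) = src E (a (Suc n) ! Suc n)"
      using len[of "Suc n"] by (auto simp: is_edge_path_def)
    then show "x !! n \<in> edges E \<and> rng E (x !! n) = src E (x !! Suc n)"
      using an[of n "Suc n"] an[of "Suc n" "Suc n"] by simp
  qed
  \<comment> \<open>On a small cylinder around \<open>x\<close> the polynomial is the scalar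
    \<open>E.dval p x\<close>. Since the projection onto this cylinder has value 1, cutting down to
    it does not change \<open>ev p\<close>.\<close>
  have "E.dval p x = ev p" if p: "p \<in> ncpoly R E" "E.isdiag p" for p
  proof -
    obtain N where N: "N > 0" "\<And>x x'. x \<in> ipaths E \<Longrightarrow> x' \<in> ipaths E \<Longrightarrow> stake N x = stake N x' \<Longrightarrow> E.dval p x = E.dval p x'"
      "\<And>x. x \<in> ipaths E \<Longrightarrow> E.dval p x \<in> R"
      using E.dval_locally_constant[OF p] by blast
    obtain n where n: "N = Suc n" using N(1) by (cases N) auto
    let ?c = "E.dval p x"
    have prn: "pr (a n) \<in> ncpoly R E" using pr a by blast
    have "E.eqv (pmul (pr (a n)) p) (psmult ?c (pr (a n)))"
      unfolding E.eqv_def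
    proof (intro ballI allI)
      fix x1 \<xi> assume x1: "x1 \<in> ipaths E"
      show "opr E (pmul (pr (a n)) p) \<xi> x1 = opr E (psmult ?c (pr (a n))) \<xi> x1"
        using prn p x1 N(2)[OF x x1] st[of n] n
        by (simp add: opr_pmul del: stake.simps) (auto simp: pr_def E.proj_diag len E.isdiag_def simp del: stake.simps)
    qed
    then have "ev (pmul (pr (a n)) p) = ev (psmult ?c (pr (a n)))"
      using p prn N(3)[OF x] by (intro ev_eqv) auto
    moreover have "ev (pmul (pr (a n)) p) = ev p" using ev_mul[OF a(1) p(1)] a(2) by simp
    moreover have "ev (psmult ?c (pr (a n))) = ?c * ev (pr (a n))"
      using F.dval_eqv[OF Phi_smult[OF prn N(3)[OF x]] y] prn by (simp add: ev_def F.dval_def)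
    ultimately show ?thesis using a(2) by simp
  qed
  then have "corr x y" using x y by (simp add: corr_def ev_def)
  then show ?thesis by blast
qed

lemma corr_sym: "corr x y \<longleftrightarrow> diag_iso.corr F E R \<Psi> y x"
proof -
  interpret S: diag_iso F E R \<Psi> \<Phi> by (rule symmetric)
  have "E.dval (\<Psi> r) x = F.dval r y" if "corr x y" "r \<in> ncpoly R F" "F.isdiag r" for r
    using that Psi_diag[of r] F.dval_eqv[OF PhiPsi[of r], of y] by (auto simp: corr_def)
  moreover have "E.dval p x = F.dval (\<Phi> p) y" if "S.corr y x" "p \<in> ncpoly R E" "E.isdiag p" for p
    using that Phi_diag[of p] E.dval_eqv[OF PsiPhi[of p], of x] by (auto simp: S.corr_def)
  ultimately show ?thesis unfolding S.corr_def corr_def by auto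
qed

lemma corr_unique_right: "corr x y \<Longrightarrow> corr x y' \<Longrightarrow> y = y'"
  using diag_iso.corr_unique_left[OF symmetric] by (simp add: corr_sym)

lemma corr_exists_right: "x \<in> ipaths E \<Longrightarrow> \<exists>y. corr x y"
  using diag_iso.corr_exists_left[OF symmetric] by (simp add: corr_sym)

text \<open>If \<open>w\<close> did not move \<open>x\<close> to \<open>x'\<close>, it would vanish
  between suitable cylinder projections around the two points. Their images under \<Phi> are
  diagonal with value 1 at \<open>y\<close> and \<open>y'\<close>, so the entry of
  \<open>\<Phi> (mono w)\<close> there would vanish too.\<close>

lemma corr_word_imp:
  assumes "corr x y" "corr x' y'" "w \<noteq> []" "set w \<subseteq> gens E" "opr F (\<Phi> (mono w)) (delta y') y \<noteq> 0"
  shows "wact E w x = Some x'"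
proof (rule ccontr)
  assume not: "wact E w x \<noteq> Some x'"
  have x: "x \<in> ipaths E" "x' \<in> ipaths E" and y: "y \<in> ipaths F" "y' \<in> ipaths F"
    using assms by (auto simp: corr_def)
  have "\<exists>m. \<forall>z. wact E w x = Some z \<longrightarrow> stake (Suc m) z \<noteq> stake (Suc m) x'"
    using not stake_eqI by (cases "wact E w x") (auto simp del: stake.simps)
  then obtain m where m: "\<And>z. wact E w x = Some z \<Longrightarrow> stake (Suc m) z \<noteq> stake (Suc m) x'" by blast
  \<comment> \<open>Long enough for \<open>wact_cylinder\<close>: on this whole cylinder
    \<open>w\<close> is undefined or leads outside the cylinder of \<beta>.\<close>
  define \<alpha> where "\<alpha> = stake (length w + Suc m) x"
  define \<beta> where "\<beta> = stake (Suc m) x'"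
  let ?d = "mono (nw \<alpha> \<alpha>) :: ('v,'e) ncp" and ?d' = "mono (nw \<beta> \<beta>) :: ('v,'e) ncp"
  have len: "length \<alpha> = length w + Suc m" "length \<beta> = Suc m" by (simp_all add: \<alpha>_def \<beta>_def)
  have d: "?d \<in> ncpoly R E" "?d' \<in> ncpoly R E" "mono w \<in> ncpoly R E"
    using E.stake_proj_ncpoly[OF x(1), of "length w + m"] E.stake_proj_ncpoly[OF x(2), of m] assms(3,4)
    unfolding \<alpha>_def \<beta>_def by auto
  have "E.eqv (pmul ?d (pmul (mono w) ?d')) pzero"
    unfolding E.eqv_def
  proof (intro ballI allI)
    fix x1 \<xi> assume x1: "x1 \<in> ipaths E"
    show "opr E (pmul ?d (pmul (mono w) ?d')) \<xi> x1 = opr E pzero \<xi> x1"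
    proof (cases "stake (length \<alpha>) x1 = \<alpha> \<and> wact E w x1 \<noteq> None")
      case False
      then show ?thesis using d x1
        by (simp add: opr_pmul E.proj_diag) (auto simp: opr_mono[of E w] split: option.splits)
    next
      case True
      then obtain z1 where z1: "wact E w x1 = Some z1" by blast
      have "stake (length w + Suc m) x = stake (length w + Suc m) x1"
        using True len by (simp add: \<alpha>_def)
      then obtain z where "wact E w x = Some z" "stake (Suc m) z = stake (Suc m) z1"
        using wact_cylinder[OF x(1) x1 assms(4), of m] z1 by auto
      then have "stake (length \<beta>) z1 \<noteq> \<beta>" using m[of z] unfolding len(2) unfolding \<beta>_def by simp
      moreover have "z1 \<in> ipaths E" using wact_ipaths[OF z1 x1 assms(4)] .
      ultimately have "opr E (mono w) (opr E ?d' \<xi>) x1 = 0"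
        using z1 by (simp add: opr_mono[of E w] E.proj_diag)
      then show ?thesis using d x1 by (simp add: opr_pmul E.proj_diag)
    qed
  qed
  then have "opr F (\<Phi> (pmul ?d (pmul (mono w) ?d'))) (delta y') y = 0"
    using F.opr_eqv[OF Phi_zero y(1)] d by simp
  then have "opr F (\<Phi> ?d) (opr F (\<Phi> (pmul (mono w) ?d')) (delta y')) y = 0"
    using opr_Phi_mul d y by simp
  moreover have "F.isdiag (\<Phi> ?d)" "F.isdiag (\<Phi> ?d')" using Phi_diag d E.isdiag_proj by auto
  moreover have "F.dval (\<Phi> ?d) y = 1" "F.dval (\<Phi> ?d') y' = 1"
    using assms(1,2) d E.isdiag_proj E.dval_proj[OF x(1), of \<alpha>] E.dval_proj[OF x(2), of \<beta>] unfolding corr_def len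
    by (auto simp: \<alpha>_def \<beta>_def simp del: stake.simps)
  ultimately have "opr F (\<Phi> (pmul (mono w) ?d')) (delta y') y = 0" using y by (simp add: F.isdiag_def)
  then have "opr F (\<Phi> (mono w)) (opr F (\<Phi> ?d') (delta y')) y = 0"
    using opr_Phi_mul d y by simp
  moreover have "opr F (\<Phi> (mono w)) (opr F (\<Phi> ?d') (delta y')) y = opr F (\<Phi> (mono w)) (delta y') y"
    using \<open>F.isdiag (\<Phi> ?d')\<close> \<open>F.dval (\<Phi> ?d') y' = 1\<close> d y
    by (intro F.row_cong) (auto simp: F.isdiag_def delta_def)
  ultimately show False using assms(5) by simp
qed

text \<open>The product of \<open>w\<close> with its star has diagonal value 1 at \<open>x\<close>,
  so the row of \<open>\<Phi> (mono w)\<close> at \<open>y\<close> has some nonzero entry;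
  \<open>corr_word_imp\<close> forces that entry to sit at \<open>y'\<close>.\<close>

lemma corr_word_nonzero:
  assumes "corr x y" "wact E w x = Some x'" "corr x' y'" "w \<noteq> []" "set w \<subseteq> gens E"
  shows "opr F (\<Phi> (mono w)) (delta y') y \<noteq> 0"
proof -
  have x: "x \<in> ipaths E" and y: "y \<in> ipaths F" using assms by (auto simp: corr_def)
  let ?s = "map gstar (rev w)"
  have "set ?s \<subseteq> gens E"
  proof
    fix g assume "g \<in> set ?s"
    then obtain g' where "g' \<in> set w" "g = gstar g'" by auto
    then show "g \<in> gens E" using assms(5) E.gstar_gens by blast
  qed
  then have nc: "mono w \<in> ncpoly R E" "mono ?s \<in> ncpoly R E" using assms(4,5) by auto
  have op: "opr E (pmul (mono w) (mono ?s)) \<xi> x1 = (if wact E w x1 = None then 0 else \<xi> x1)" 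
    if "x1 \<in> ipaths E" for x1 \<xi>
    using wact_star[OF _ that assms(5)] by (auto simp: pmul_mono_mono opr_mono wact_append split: option.splits)
  have "E.isdiag (pmul (mono w) (mono ?s))" "E.dval (pmul (mono w) (mono ?s)) x = 1"
    unfolding E.isdiag_def E.dval_def using op x assms(2) by auto
  then have "F.dval (\<Phi> (pmul (mono w) (mono ?s))) y = 1"
    using assms(1) nc unfolding corr_def by simp
  then have "opr F (\<Phi> (mono w)) (opr F (\<Phi> (mono ?s)) (\<lambda>_. 1)) y \<noteq> 0"
    unfolding F.dval_def using opr_Phi_mul nc y by simp
  then obtain y'' where y'': "opr F (\<Phi> (mono w)) (delta y'') y \<noteq> 0"
    using opr_nonzero_delta[of F "\<Phi> (mono w)"] nc by auto
  then obtain u where "\<Phi> (mono w) u \<noteq> 0" "wact F u y = Some y''" using opr_delta_nonzero by blast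
  then have "y'' \<in> ipaths F" using wact_ipaths[of F u y y''] y Phi_in[OF nc(1)] by (auto simp: F.ncpoly_alt)
  then obtain x'' where x'': "corr x'' y''" using corr_exists_left by blast
  then have "wact E w x = Some x''" using corr_word_imp[OF assms(1) x'' assms(4,5) y''] by simp
  then have "y'' = y'" using assms(2,3) x'' corr_unique_right by simp
  then show ?thesis using y'' by simp
qed

end

text \<open>Every partial action of a word over \<open>E\<close> is carried by \<open>h\<close> to prefix replacement on cylinders of \<open>F\<close>.
  For single edges this says that \<open>h\<close> is one half of a continuous orbit equivalence.\<close>

definition tail_map :: "('v,'e) graph \<Rightarrow> ('w,'f) graph \<Rightarrow> ('f stream \<Rightarrow> 'e stream) \<Rightarrow> bool" where
  "tail_map E F h \<longleftrightarrow> (\<forall>w. w \<noteq> [] \<longrightarrow> set w \<subseteq> gens E \<longrightarrow> (\<exists>N0. \<forall>N\<ge>N0. \<forall>\<alpha> v u.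
     fpath F v \<alpha> u \<and> length \<alpha> = N \<longrightarrow>
     (\<forall>z\<in>ipaths F. source F z = u \<longrightarrow> wact E w (h (\<alpha> @- z)) = None) \<or>
     (\<exists>\<beta> v'. fpath F v' \<beta> u \<and>
        (\<forall>z\<in>ipaths F. source F z = u \<longrightarrow> wact E w (h (\<alpha> @- z)) = Some (h (\<beta> @- z))))))"

context diag_iso
begin

text \<open>Over each long \<alpha> the normal form of \<open>\<Phi> (mono w)\<close> turns out to
  have at most one \<beta>. No \<beta> means that \<open>w\<close> is undefined over the cylinder,
  by \<open>corr_word_nonzero\<close>; one \<beta> is the prefix replacement.\<close>

lemma corr_tail_map:
  assumes h: "\<And>y. y \<in> ipaths F \<Longrightarrow> corr (h y) y"
  shows "tail_map E F h"
  unfolding tail_map_def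
proof (intro allI impI)
  fix w :: "('v,'e) gen list"
  assume w: "w \<noteq> []" "set w \<subseteq> gens E"
  have wn: "mono w \<in> ncpoly R E" using w by simp
  obtain N0 where N0: "N0 > 0" "\<And>N. N \<ge> N0 \<Longrightarrow> \<exists>q\<in>F.NF N. F.cg (\<Phi> (mono w)) q"
    using F.normal_form[OF Phi_in[OF wn]] by blast
  show "\<exists>N0. \<forall>N\<ge>N0. \<forall>\<alpha> v u. fpath F v \<alpha> u \<and> length \<alpha> = N \<longrightarrow>
     (\<forall>z\<in>ipaths F. source F z = u \<longrightarrow> wact E w (h (\<alpha> @- z)) = None) \<or>
     (\<exists>\<beta> v'. fpath F v' \<beta> u \<and>
        (\<forall>z\<in>ipaths F. source F z = u \<longrightarrow> wact E w (h (\<alpha> @- z)) = Some (h (\<beta> @- z))))"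
  proof (intro exI[of _ N0] allI impI)
    fix N \<alpha> v u assume N: "N \<ge> N0" and "fpath F v \<alpha> u \<and> length \<alpha> = N"
    then have \<alpha>: "fpath F v \<alpha> u" "length \<alpha> = N" by auto
    have N_pos: "N > 0" using N N0 by simp
    obtain q where q: "q \<in> F.NF N" "F.cg (\<Phi> (mono w)) q" using N0(2)[OF N] by blast
    have "q \<in> ncpoly R F" using q by (simp add: F.NF_def)
    then have eq: "F.eqv (\<Phi> (mono w)) q" using F.cg_imp_eqv[OF Phi_in[OF wn] _ q(2)] by blast
    have path: "\<alpha> @- z \<in> ipaths F" if "z \<in> ipaths F" "source F z = u" for z
      using \<alpha> that fpath_shift_ipaths by metis
    have op: "opr F (\<Phi> (mono w)) \<xi> (\<alpha> @- z) = (\<Sum>\<beta> | q (nw \<alpha> \<beta>) \<noteq> 0. q (nw \<alpha> \<beta>) * \<xi> (\<beta> @- z))"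
      if "z \<in> ipaths F" "source F z = u" for z \<xi>
      using F.opr_eqv[OF eq path[OF that]] F.opr_NF(1)[OF q(1) N_pos \<alpha> that] by simp
    show "(\<forall>z\<in>ipaths F. source F z = u \<longrightarrow> wact E w (h (\<alpha> @- z)) = None) \<or>
     (\<exists>\<beta> v'. fpath F v' \<beta> u \<and>
        (\<forall>z\<in>ipaths F. source F z = u \<longrightarrow> wact E w (h (\<alpha> @- z)) = Some (h (\<beta> @- z))))"
    proof (cases "\<exists>\<beta>. q (nw \<alpha> \<beta>) \<noteq> 0")
      case False
      have "wact E w (h (\<alpha> @- z)) = None" if z: "z \<in> ipaths F" "source F z = u" for z
      proof (rule ccontr)
        assume "\<not> ?thesis"
        then obtain x' where x': "wact E w (h (\<alpha> @- z)) = Some x'" by blast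
        have "corr (h (\<alpha> @- z)) (\<alpha> @- z)" using h path z by blast
        moreover from this have "x' \<in> ipaths E" using wact_ipaths[OF x'] w by (auto simp: corr_def)
        then obtain y' where "corr x' y'" using corr_exists_right by blast
        ultimately show False using corr_word_nonzero[OF _ x' _ w] op[OF z] False by auto
      qed
      then show ?thesis by blast
    next
      case True
      then obtain \<beta> where \<beta>: "q (nw \<alpha> \<beta>) \<noteq> 0" by blast
      have fp: "\<exists>v'. fpath F v' \<beta>' u" if "q (nw \<alpha> \<beta>') \<noteq> 0" for \<beta>'
        using F.NF_coeff[OF q(1) N_pos \<alpha>] that by blast
      have cw: "wact E w (h (\<alpha> @- z)) = Some (h (\<beta>' @- z))"
        if z: "z \<in> ipaths F" "source F z = u" and \<beta>': "q (nw \<alpha> \<beta>') \<noteq> 0"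
         and ne: "opr F (\<Phi> (mono w)) (delta (\<beta>' @- z)) (\<alpha> @- z) \<noteq> 0" for z \<beta>'
      proof -
        have "\<beta>' @- z \<in> ipaths F" using fp[OF \<beta>'] z fpath_shift_ipaths by metis
        then show ?thesis using corr_word_imp[OF h[OF path[OF z]] h w ne] by simp
      qed
      \<comment> \<open>At an eventually periodic point several coefficients could contribute to one
        entry. Uniqueness is therefore read off at one aperiodic tail; it then serves all
        \<open>z\<close>, as the coefficients do not depend on \<open>z\<close>.\<close>
      have uniq: "\<beta>' = \<beta>" if \<beta>': "q (nw \<alpha> \<beta>') \<noteq> 0" for \<beta>'
      proof -
        have "\<alpha> \<noteq> []" using \<alpha> N_pos by auto
        then obtain z where z: "z \<in> ipaths F" "source F z = u" "\<not> eper z"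
          using F.aperiodic_exists F.fpath_end_verts \<alpha> by blast
        have "opr F (\<Phi> (mono w)) (delta (b @- z)) (\<alpha> @- z) = q (nw \<alpha> b)" for b
          using F.opr_eqv[OF eq path[OF z(1,2)]] F.opr_NF_aperiodic[OF q(1) N_pos \<alpha> z] by simp
        then have "h (\<beta>' @- z) = h (\<beta> @- z)" using cw[OF z(1,2) \<beta>'] cw[OF z(1,2) \<beta>] \<beta> \<beta>' by simp
        moreover have "\<beta>' @- z \<in> ipaths F" "\<beta> @- z \<in> ipaths F"
          using fp \<beta> \<beta>' z fpath_shift_ipaths by metis+
        ultimately have "\<beta>' @- z = \<beta> @- z" using h corr_unique_right by metis
        then show ?thesis using shift_eq_aperiodic z by blast
      qed
      then have B: "{\<beta>. q (nw \<alpha> \<beta>) \<noteq> 0} = {\<beta>}" using \<beta> by blast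
      have "wact E w (h (\<alpha> @- z)) = Some (h (\<beta> @- z))" if z: "z \<in> ipaths F" "source F z = u" for z
        by (rule cw[OF z \<beta>]) (use op[OF z] B \<beta> in \<open>simp add: delta_def\<close>)
      then show ?thesis using fp[OF \<beta>] by blast
    qed
  qed
qed

theorem tail_maps_exist:
  "\<exists>h g. (\<forall>y\<in>ipaths F. h y \<in> ipaths E \<and> g (h y) = y) \<and> (\<forall>x\<in>ipaths E. g x \<in> ipaths F \<and> h (g x) = x) \<and>
     tail_map E F h \<and> tail_map F E g"
proof -
  obtain h where h: "\<And>y. y \<in> ipaths F \<Longrightarrow> corr (h y) y" using corr_exists_left by metis
  obtain g where g: "\<And>x. x \<in> ipaths E \<Longrightarrow> corr x (g x)" using corr_exists_right by metis
  have in_E: "h y \<in> ipaths E" if "y \<in> ipaths F" for y using h[OF that] by (simp add: corr_def)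
  have in_F: "g x \<in> ipaths F" if "x \<in> ipaths E" for x using g[OF that] by (simp add: corr_def)
  have "g (h y) = y" if "y \<in> ipaths F" for y using corr_unique_right[OF g[OF in_E] h] that by blast
  moreover have "h (g x) = x" if "x \<in> ipaths E" for x using corr_unique_left[OF h[OF in_F] g] that by blast
  moreover have "tail_map E F h" using corr_tail_map h by blast
  moreover have "tail_map F E g"
    using diag_iso.corr_tail_map[OF symmetric] g corr_sym by blast
  ultimately show ?thesis using in_E in_F by (intro exI[of _ h] exI[of _ g]) blast
qed

end

theorem star_iso_tail_maps:
  assumes E: "leavitt E R" and F: "leavitt F R" and iso: "star_iso R E F \<phi>"
    and diag: "\<phi> ` lpa_diag R E \<subseteq> lpa_diag R F"
  shows "\<exists>h g. (\<forall>y\<in>ipaths F. h y \<in> ipaths E \<and> g (h y) = y) \<and> (\<forall>x\<in>ipaths E. g x \<in> ipaths F \<and> h (g x) = x) \<and>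
     tail_map E F h \<and> tail_map F E g"
proof -
  interpret E: leavitt E R by fact
  interpret F: leavitt F R by fact
  define \<Phi> where "\<Phi> p = rep (\<phi> (lpa_cls R E p))" for p
  define \<Psi> where "\<Psi> r = rep (inv_into (lpa R E) \<phi> (lpa_cls R F r))" for r
  have bij: "bij_betw \<phi> (lpa R E) (lpa R F)" using iso by (simp add: star_iso_def)
  have \<phi>in: "\<phi> A \<in> lpa R F" if "A \<in> lpa R E" for A using bij that by (auto simp: bij_betw_def)
  have inv: "inv_into (lpa R E) \<phi> B \<in> lpa R E" "\<phi> (inv_into (lpa R E) \<phi> B) = B" if "B \<in> lpa R F" for B
    using bij that by (auto simp: bij_betw_def inv_into_into f_inv_into_f)
  have \<Phi>: "\<Phi> p \<in> ncpoly R F" "lpa_cls R F (\<Phi> p) = \<phi> (lpa_cls R E p)" if "p \<in> ncpoly R E" for p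
    unfolding \<Phi>_def using F.rep_lpa \<phi>in that by auto
  have \<Psi>: "\<Psi> r \<in> ncpoly R E" "\<phi> (lpa_cls R E (\<Psi> r)) = lpa_cls R F r" if "r \<in> ncpoly R F" for r
    unfolding \<Psi>_def using E.rep_lpa inv that by auto
  have inj: "A = B" if "\<phi> A = \<phi> B" "A \<in> lpa R E" "B \<in> lpa R E" for A B
    using bij that by (auto simp: bij_betw_def inj_on_def)
  have hom: "\<phi> (lpa_add R E A B) = lpa_add R F (\<phi> A) (\<phi> B)" "\<phi> (lpa_mul R E A B) = lpa_mul R F (\<phi> A) (\<phi> B)"
    "c \<in> R \<Longrightarrow> \<phi> (lpa_smult R E c A) = lpa_smult R F c (\<phi> A)" if "A \<in> lpa R E" "B \<in> lpa R E" for A B c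
    using iso that by (auto simp: star_iso_def)
  interpret diag_iso E F R \<Phi> \<Psi>
  proof unfold_locales
    fix p q assume p: "p \<in> ncpoly R E" and q: "q \<in> ncpoly R E"
    show "F.eqv (\<Phi> p) (\<Phi> q)" if "E.eqv p q"
      using that p q E.lpa_cls_eq_iff \<Phi> F.lpa_cls_eq_iff by metis
    show "F.eqv (\<Phi> (pmul p q)) (pmul (\<Phi> p) (\<Phi> q))"
      using \<Phi>[OF p] \<Phi>[OF q] \<Phi>[of "pmul p q"] p q hom(2)[of "lpa_cls R E p" "lpa_cls R E q"]
      by (simp add: E.lpa_ops_cls F.lpa_ops_cls flip: F.lpa_cls_eq_iff)
         (metis F.lpa_ops_cls(1))
    show "F.eqv (\<Phi> (padd p q)) (padd (\<Phi> p) (\<Phi> q))"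
      using \<Phi>[OF p] \<Phi>[OF q] \<Phi>[of "padd p q"] p q hom(1)[of "lpa_cls R E p" "lpa_cls R E q"]
      by (simp add: E.lpa_ops_cls F.lpa_ops_cls flip: F.lpa_cls_eq_iff)
         (metis F.lpa_ops_cls(2))
  next
    fix p c assume p: "p \<in> ncpoly R E" and c: "c \<in> R"
    show "F.eqv (\<Phi> (psmult c p)) (psmult c (\<Phi> p))"
      using \<Phi>[OF p] \<Phi>[of "psmult c p"] p c hom(3)[of "lpa_cls R E p" "lpa_cls R E p" c]
      by (simp add: E.lpa_ops_cls F.lpa_ops_cls flip: F.lpa_cls_eq_iff)
         (metis F.lpa_ops_cls(3))
  next
    fix r s assume r: "r \<in> ncpoly R F" "s \<in> ncpoly R F" "F.eqv r s"
    then have "\<phi> (lpa_cls R E (\<Psi> r)) = \<phi> (lpa_cls R E (\<Psi> s))" using \<Psi> F.lpa_cls_eq_iff by metis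
    then show "E.eqv (\<Psi> r) (\<Psi> s)" using inj \<Psi> r E.lpa_cls_eq_iff E.lpa_cls_in by metis
  next
    fix p assume p: "p \<in> ncpoly R E"
    have "\<phi> (lpa_cls R E (\<Psi> (\<Phi> p))) = \<phi> (lpa_cls R E p)" using \<Psi> \<Phi> p by metis
    then show "E.eqv (\<Psi> (\<Phi> p)) p" using inj \<Psi> \<Phi> p E.lpa_cls_eq_iff E.lpa_cls_in by metis
    show "F.isdiag (\<Phi> p)" if "E.isdiag p"
    proof -
      obtain q where q: "q \<in> diag_polys R E" "E.cg p q" using E.isdiag_imp_diag_poly p \<open>E.isdiag p\<close> by blast
      have "lpa_cls R E p = lpa_cls R E q"
        using E.lpa_cls_eq_iff E.cg_imp_eqv p q E.diag_poly_ncpoly by metis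
      then have "\<phi> (lpa_cls R E p) \<in> lpa_diag R F" using q diag by (auto simp: lpa_diag_def)
      then obtain r where r: "r \<in> diag_polys R F" "\<phi> (lpa_cls R E p) = lpa_cls R F r" by (auto simp: lpa_diag_def)
      then have "F.eqv r (\<Phi> p)" using \<Phi>[OF p] F.lpa_cls_eq_iff F.diag_poly_ncpoly by metis
      then show ?thesis using F.diag_poly_isdiag[OF r(1)] F.isdiag_eqv by blast
    qed
  next
    fix r assume r: "r \<in> ncpoly R F"
    show "F.eqv (\<Phi> (\<Psi> r)) r" using \<Phi> \<Psi> r F.lpa_cls_eq_iff by metis
  qed (use \<Phi> \<Psi> in auto)
  show ?thesis by (rule tail_maps_exist)
qed

section \<open>Periodic points and lags\<close>

definition teq :: "'e stream \<Rightarrow> 'e stream \<Rightarrow> bool" where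
  "teq x y \<longleftrightarrow> (\<exists>m n. sdrop m x = sdrop n y)"

lemma teq_refl [simp]: "teq x x" by (auto simp: teq_def)

lemma teq_sym: "teq x y \<Longrightarrow> teq y x" unfolding teq_def by metis

lemma sdrop_add_eq: "sdrop m x = sdrop n y \<Longrightarrow> sdrop (m + k) x = sdrop (n + k) y"
  by (metis sdrop_add)

lemma teq_trans: "teq x y \<Longrightarrow> teq y z \<Longrightarrow> teq x z"
proof -
  assume "teq x y" "teq y z"
  then obtain a b c d where *: "sdrop a x = sdrop b y" "sdrop c y = sdrop d z" by (auto simp: teq_def)
  have "sdrop (a + c) x = sdrop (b + c) y" "sdrop (c + b) y = sdrop (d + b) z"
    using sdrop_add_eq[OF *(1)] sdrop_add_eq[OF *(2)] by auto
  then have "sdrop (a + c) x = sdrop (d + b) z" by (simp add: add.commute)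
  then show ?thesis unfolding teq_def by blast
qed

lemma teq_shift [simp]: "teq (\<alpha> @- z) z"
  unfolding teq_def by (rule exI[of _ "length \<alpha>"], rule exI[of _ 0]) (simp add: sdrop_shift)

lemma teq_sdrop [simp]: "teq (sdrop n x) x"
  unfolding teq_def by (metis sdrop.simps(1))

lemma teq_eper: "teq x y \<Longrightarrow> eper x \<longleftrightarrow> eper y"
  unfolding teq_def by (metis eper_sdrop)

definition perpts :: "('v,'e) graph \<Rightarrow> 'e stream set" where
  "perpts G = {x \<in> ipaths G. \<exists>p>0. sdrop p x = x}"

definition per :: "'e stream \<Rightarrow> nat" where
  "per x = (LEAST p. p > 0 \<and> sdrop p x = x)"

lemma sdrop_mult: "sdrop p x = x \<Longrightarrow> sdrop (k * p) x = x"
proof (induction k)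
  case (Suc k)
  have "sdrop (Suc k * p) x = sdrop (k * p) (sdrop p x)" by (simp add: add.commute)
  then show ?case using Suc by simp
qed simp

lemma per_props:
  assumes "x \<in> perpts G"
  shows "per x > 0" "sdrop (per x) x = x"
proof -
  have "\<exists>p. p > 0 \<and> sdrop p x = x" using assms by (auto simp: perpts_def)
  from LeastI_ex[OF this] show "per x > 0" "sdrop (per x) x = x" by (auto simp: per_def)
qed

lemma per_dvd:
  assumes "x \<in> perpts G"
  shows "sdrop k x = x \<longleftrightarrow> per x dvd k"
proof
  assume k: "sdrop k x = x"
  let ?p = "per x"
  have "sdrop (k mod ?p) x = sdrop (k mod ?p) (sdrop (k div ?p * ?p) x)"
    using sdrop_mult[OF per_props(2)[OF assms]] by simp
  also have "\<dots> = sdrop (k div ?p * ?p + k mod ?p) x" by (simp only: sdrop_add)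
  also have "\<dots> = x" using k by simp
  finally have "sdrop (k mod ?p) x = x" .
  then have "\<not> 0 < k mod ?p"
    using not_less_Least[of "k mod ?p" "\<lambda>p. p > 0 \<and> sdrop p x = x"] per_props(1)[OF assms]
    by (auto simp: per_def)
  then show "?p dvd k" by auto
next
  assume "per x dvd k"
  then show "sdrop k x = x" using sdrop_mult[OF per_props(2)[OF assms]] by (metis dvd_def mult.commute)
qed

lemma teq_periodic:
  assumes "x \<in> perpts G" "y \<in> perpts G'" "teq x y"
  shows "\<exists>i<per x. y = sdrop i x"
proof -
  obtain m n where mn: "sdrop m x = sdrop n y" using assms by (auto simp: teq_def)
  let ?q = "per y" and ?p = "per x"
  have qp: "?q > 0" "?p > 0" using per_props assms by blast+
  obtain k where k: "n \<le> k * ?q" using qp by (intro that[of n]) simp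
  have "y = sdrop (k * ?q) y" using sdrop_mult[OF per_props(2)[OF assms(2)]] by simp
  also have "\<dots> = sdrop (n + (k * ?q - n)) y" using k by simp
  also have "\<dots> = sdrop (m + (k * ?q - n)) x" using sdrop_add_eq[OF mn] by simp
  finally obtain j where j: "y = sdrop j x" by blast
  have "sdrop j x = sdrop (j mod ?p) (sdrop (j div ?p * ?p) x)" by (simp only: sdrop_add) simp
  then have "y = sdrop (j mod ?p) x" using j sdrop_mult[OF per_props(2)[OF assms(1)]] by simp
  then show ?thesis using qp by (intro exI[of _ "j mod ?p"]) simp
qed

lemma perpts_sdrop: "x \<in> perpts G \<Longrightarrow> sdrop i x \<in> perpts G"
proof -
  assume x: "x \<in> perpts G"
  then have "sdrop (per x) (sdrop i x) = sdrop i x"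
    using per_props(2)[OF x] by (metis add.commute sdrop_add)
  then show ?thesis using x per_props(1)[OF x] ipaths_sdrop by (auto simp: perpts_def)
qed

lemma per_dvd_teq: "x \<in> perpts G \<Longrightarrow> y \<in> perpts G' \<Longrightarrow> teq x y \<Longrightarrow> per y dvd per x"
proof -
  assume *: "x \<in> perpts G" "y \<in> perpts G'" "teq x y"
  then obtain i where "y = sdrop i x" using teq_periodic by blast
  then have "sdrop (per x) y = y" using per_props(2)[OF *(1)] by (metis add.commute sdrop_add)
  then show ?thesis using per_dvd[OF *(2)] by simp
qed

lemma per_teq: "x \<in> perpts G \<Longrightarrow> y \<in> perpts G' \<Longrightarrow> teq x y \<Longrightarrow> per x = per y"
  using per_dvd_teq teq_sym dvd_antisym by metis

lemma sdrop_inj_per: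
  assumes "x \<in> perpts G" "i < per x" "j < per x" "sdrop i x = sdrop j x"
  shows "i = j"
proof -
  have aux: False if "i < j" "j < per x" "sdrop i x = sdrop j x" for i j
  proof -
    have "sdrop (i + (per x - j)) x = sdrop (j + (per x - j)) x" using sdrop_add_eq[OF that(3)] .
    also have "\<dots> = x" using that per_props(2)[OF assms(1)] by simp
    finally have "per x dvd i + (per x - j)" using per_dvd[OF assms(1)] by simp
    moreover have "0 < i + (per x - j)" "i + (per x - j) < per x" using that by auto
    ultimately show False by (simp add: nat_dvd_not_less)
  qed
  show ?thesis using aux[of i j] aux[of j i] assms by (metis nat_neq_iff)
qed

text \<open>Tail equivalent periodic points lie on one shift orbit, which has \<open>per x\<close>
  distinct members.\<close>

lemma card_teq_class:
  assumes "x \<in> perpts G"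
  shows "card {y \<in> perpts G. teq x y} = per x" "finite {y \<in> perpts G. teq x y}"
proof -
  have eq: "{y \<in> perpts G. teq x y} = (\<lambda>i. sdrop i x) ` {..<per x}"
    using teq_periodic[OF assms] perpts_sdrop[OF assms] teq_sym[OF teq_sdrop] by fastforce
  have "inj_on (\<lambda>i. sdrop i x) {..<per x}" using sdrop_inj_per[OF assms] by (auto simp: inj_on_def)
  then show "card {y \<in> perpts G. teq x y} = per x" "finite {y \<in> perpts G. teq x y}"
    unfolding eq by (simp_all add: card_image)
qed

lemma shift_eq_split:
  assumes "\<beta> @- z = \<alpha> @- w" "length \<beta> \<le> length \<alpha>"
  shows "\<exists>\<delta>. \<alpha> = \<beta> @ \<delta> \<and> z = \<delta> @- w"
  using assms
proof (induction \<beta> arbitrary: \<alpha>)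
  case (Cons b \<beta>)
  then obtain a \<alpha>' where "\<alpha> = a # \<alpha>'" by (cases \<alpha>) auto
  then show ?case using Cons by auto
qed auto

lemma blocks_eq:
  assumes "p > 0" "\<And>i. stake p (sdrop (i * p) x) = stake p (sdrop (i * p) y)"
  shows "x = y"
proof (rule stream_eqI)
  fix n
  have "x !! n = sdrop (n div p * p) x !! (n mod p)" by (simp add: sdrop_snth)
  also have "\<dots> = stake p (sdrop (n div p * p) x) ! (n mod p)" using assms(1) by simp
  also have "\<dots> = stake p (sdrop (n div p * p) y) ! (n mod p)" using assms(2) by simp
  also have "\<dots> = sdrop (n div p * p) y !! (n mod p)" using assms(1) by simp
  also have "\<dots> = y !! n" by (simp add: sdrop_snth)
  finally show "x !! n = y !! n" .
qed

section \<open>Birkhoff sums along the shift and continuous orbit equivalence\<close>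

definition fsum :: "('e stream \<Rightarrow> int) \<Rightarrow> nat \<Rightarrow> 'e stream \<Rightarrow> int" where
  "fsum f n x = (\<Sum>i<n. f (sdrop i x))"

lemma fsum_simps [simp]: "fsum f 0 x = 0" "fsum f (Suc n) x = fsum f n x + f (sdrop n x)"
  by (simp_all add: fsum_def)

lemma fsum_add: "fsum f (m + n) x = fsum f m x + fsum f n (sdrop m x)"
  by (induction n) (simp_all add: add.assoc)

lemma fsum_mult: "sdrop p x = x \<Longrightarrow> fsum f (k * p) x = int k * fsum f p x"
  by (induction k) (simp_all add: fsum_add algebra_simps)

lemma fsum_period_rotate:
  assumes "sdrop p x = x"
  shows "fsum f p (sdrop i x) = fsum f p x"
proof -
  have "fsum f i x + fsum f p (sdrop i x) = fsum f (i + p) x" by (simp add: fsum_add)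
  also have "\<dots> = fsum f p x + fsum f i (sdrop p x)" by (subst add.commute) (simp only: fsum_add)
  finally show ?thesis using assms by simp
qed

text \<open>The algebra is left behind here: what remains are inverse bijections of path spaces that
  are local prefix replacements in both directions. Continuity is not part of the data;
  \<open>h_continuous\<close> derives it.\<close>

locale coe = E: good_graph E + F: good_graph F
  for E :: "('v,'e) graph" and F :: "('w,'f) graph" +
  fixes h :: "'f stream \<Rightarrow> 'e stream" and g :: "'e stream \<Rightarrow> 'f stream"
  assumes h_in: "y \<in> ipaths F \<Longrightarrow> h y \<in> ipaths E" and gh: "y \<in> ipaths F \<Longrightarrow> g (h y) = y"
    and g_in: "x \<in> ipaths E \<Longrightarrow> g x \<in> ipaths F" and hg: "x \<in> ipaths E \<Longrightarrow> h (g x) = x"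
    and h_tail: "tail_map E F h" and g_tail: "tail_map F E g"
begin

lemma symmetric: "coe F E g h"
  using h_in gh g_in hg h_tail g_tail by unfold_locales auto

lemma h_tail_uniform:
  assumes "finite W" "\<And>w. w \<in> W \<Longrightarrow> w \<noteq> [] \<and> set w \<subseteq> gens E"
  shows "\<exists>N>0. \<forall>w\<in>W. \<forall>y\<in>ipaths F.
     (\<forall>y'\<in>ipaths F. stake N y' = stake N y \<longrightarrow> wact E w (h y') = None) \<or>
     (\<exists>\<beta>. \<forall>z\<in>ipaths F. source F z = rng F (last (stake N y)) \<longrightarrow>
        \<beta> @- z \<in> ipaths F \<and> wact E w (h (stake N y @- z)) = Some (h (\<beta> @- z)))"
proof -
  have "\<exists>N0. \<forall>N\<ge>N0. \<forall>\<alpha> v u. fpath F v \<alpha> u \<and> length \<alpha> = N \<longrightarrow>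
     (\<forall>z\<in>ipaths F. source F z = u \<longrightarrow> wact E w (h (\<alpha> @- z)) = None) \<or>
     (\<exists>\<beta> v'. fpath F v' \<beta> u \<and>
        (\<forall>z\<in>ipaths F. source F z = u \<longrightarrow> wact E w (h (\<alpha> @- z)) = Some (h (\<beta> @- z))))" if "w \<in> W" for w
    using h_tail assms(2)[OF that] unfolding tail_map_def by blast
  then obtain N0 where N0: "\<And>w N \<alpha> v u. w \<in> W \<Longrightarrow> N \<ge> N0 w \<Longrightarrow> fpath F v \<alpha> u \<Longrightarrow> length \<alpha> = N \<Longrightarrow>
     (\<forall>z\<in>ipaths F. source F z = u \<longrightarrow> wact E w (h (\<alpha> @- z)) = None) \<or>
     (\<exists>\<beta> v'. fpath F v' \<beta> u \<and>
        (\<forall>z\<in>ipaths F. source F z = u \<longrightarrow> wact E w (h (\<alpha> @- z)) = Some (h (\<beta> @- z))))"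
    by metis
  \<comment> \<open>The maximum is admissible because \<open>tail_map\<close> allows every larger
    length. The inserted 1 keeps prefixes nonempty, so that \<open>last\<close> names their final
    edge.\<close>
  define N where "N = Max (insert 1 (N0 ` W))"
  have N: "N > 0" "\<And>w. w \<in> W \<Longrightarrow> N \<ge> N0 w"
  proof -
    have fin: "finite (insert 1 (N0 ` W))" using assms(1) by simp
    show "N > 0" using Max_ge[OF fin, of 1] by (simp add: N_def)
    show "N \<ge> N0 w" if "w \<in> W" for w using Max_ge[OF fin, of "N0 w"] that by (simp add: N_def)
  qed
  show ?thesis
  proof (intro exI[of _ N] conjI N(1) ballI)
    fix w y assume w: "w \<in> W" and y: "y \<in> ipaths F"
    let ?\<alpha> = "stake N y"
    have \<alpha>: "fpath F (source F y) ?\<alpha> (source F (sdrop N y))" using fpath_stake[OF y] .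
    have ne: "?\<alpha> \<noteq> []" using N(1) by simp
    have u: "source F (sdrop N y) = rng F (last ?\<alpha>)" using fpath_ends[OF \<alpha> ne] by simp
    have "\<forall>y'\<in>ipaths F. stake N y' = stake N y \<longrightarrow> wact E w (h y') = None"
      if *: "\<forall>z\<in>ipaths F. source F z = source F (sdrop N y) \<longrightarrow> wact E w (h (?\<alpha> @- z)) = None"
    proof (intro ballI impI)
      fix y' assume y': "y' \<in> ipaths F" "stake N y' = stake N y"
      have "source F (sdrop N y') = source F (sdrop N y)"
        using fpath_ends[OF fpath_stake[OF y'(1), of N]] N(1) y' u by simp
      then show "wact E w (h y') = None"
        using * ipaths_sdrop[OF y'(1), of N] y'(2) stake_sdrop[of N y'] by metis
    qed
    moreover have "\<beta> @- z \<in> ipaths F" if "fpath F v' \<beta> (source F (sdrop N y))" "z \<in> ipaths F" "source F z = rng F (last ?\<alpha>)" for \<beta> v' z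
      using that u fpath_shift_ipaths by metis
    ultimately show "(\<forall>y'\<in>ipaths F. stake N y' = stake N y \<longrightarrow> wact E w (h y') = None) \<or>
     (\<exists>\<beta>. \<forall>z\<in>ipaths F. source F z = rng F (last (stake N y)) \<longrightarrow>
        \<beta> @- z \<in> ipaths F \<and> wact E w (h (stake N y @- z)) = Some (h (\<beta> @- z)))"
      using N0[OF w N(2)[OF w] \<alpha>] u by (metis length_stake)
  qed
qed

text \<open>The word \<alpha>\<alpha>* is defined exactly on the cylinder of \<alpha>, and by the
  uniform tail property its definedness at \<open>h y\<close> depends only on a prefix of
  \<open>y\<close>. For \<open>m = 0\<close>, where this word would be empty, there is nothing to
  show.\<close>

lemma h_continuous:
  "\<exists>K. \<forall>y\<in>ipaths F. \<forall>y'\<in>ipaths F. stake K y = stake K y' \<longrightarrow> stake m (h y) = stake m (h y')"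
proof (cases "m = 0")
  case False
  define W where "W = (\<lambda>\<alpha>. nw \<alpha> \<alpha> :: ('v,'e) gen list) ` {\<alpha>. length \<alpha> = m \<and> (\<exists>v w. fpath E v \<alpha> w)}"
  have "finite W" unfolding W_def using finite_fpaths[OF E.finite_edges] by simp
  moreover have "w \<noteq> [] \<and> set w \<subseteq> gens E" if w: "w \<in> W" for w
  proof -
    obtain \<alpha> v u where "w = nw \<alpha> \<alpha>" "length \<alpha> = m" "fpath E v \<alpha> u" using w by (auto simp: W_def)
    then show ?thesis using False fpath_set[of E v \<alpha> u] by (auto simp: nw_def gens_def)
  qed
  ultimately obtain N where N: "\<And>w y. w \<in> W \<Longrightarrow> y \<in> ipaths F \<Longrightarrow>
     (\<forall>y'\<in>ipaths F. stake N y' = stake N y \<longrightarrow> wact E w (h y') = None) \<or>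
     (\<exists>\<beta>. \<forall>z\<in>ipaths F. source F z = rng F (last (stake N y)) \<longrightarrow>
        \<beta> @- z \<in> ipaths F \<and> wact E w (h (stake N y @- z)) = Some (h (\<beta> @- z)))" "N > 0"
    using h_tail_uniform[of W] by blast
  show ?thesis
  proof (intro exI[of _ N] ballI impI)
    fix y y' assume y: "y \<in> ipaths F" "y' \<in> ipaths F" "stake N y = stake N y'"
    let ?\<alpha> = "stake m (h y)"
    have W: "nw ?\<alpha> ?\<alpha> \<in> W" unfolding W_def using fpath_stake[OF h_in[OF y(1)]] by force
    have "wact E (nw ?\<alpha> ?\<alpha>) (h y) \<noteq> None" using wact_nw_self[OF h_in[OF y(1)]] by simp
    then have "\<not> (\<forall>y'\<in>ipaths F. stake N y' = stake N y \<longrightarrow> wact E (nw ?\<alpha> ?\<alpha>) (h y') = None)"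
      using y(1) by metis
    then have "\<exists>\<beta>. \<forall>z\<in>ipaths F. source F z = rng F (last (stake N y)) \<longrightarrow>
        \<beta> @- z \<in> ipaths F \<and> wact E (nw ?\<alpha> ?\<alpha>) (h (stake N y @- z)) = Some (h (\<beta> @- z))"
      using N(1)[OF W y(1)] by (elim disjE) simp_all
    then obtain \<beta> where \<beta>: "\<And>z. z \<in> ipaths F \<Longrightarrow> source F z = rng F (last (stake N y)) \<Longrightarrow>
        wact E (nw ?\<alpha> ?\<alpha>) (h (stake N y @- z)) = Some (h (\<beta> @- z))"
      by blast
    have "source F (sdrop N y') = rng F (last (stake N y))"
      using fpath_ends[OF fpath_stake[OF y(2), of N]] N(2) y(3) by simp
    then have "wact E (nw ?\<alpha> ?\<alpha>) (h y') \<noteq> None"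
      using \<beta>[of "sdrop N y'"] ipaths_sdrop[OF y(2)] y(3) by (simp add: stake_sdrop)
    then show "stake m (h y) = stake m (h y')"
      using wact_nw_self[OF h_in[OF y(2)], of ?\<alpha>] by (simp split: if_splits)
  qed
qed auto

definition step_pair :: "'f list \<Rightarrow> 'f list \<Rightarrow> bool" where
  "step_pair \<alpha> \<beta> \<longleftrightarrow> (\<exists>e. \<forall>z\<in>ipaths F. source F z = rng F (last \<alpha>) \<longrightarrow>
     \<beta> @- z \<in> ipaths F \<and> shd (h (\<alpha> @- z)) = e \<and> stl (h (\<alpha> @- z)) = h (\<beta> @- z))"

lemma step_pair_exists: "\<exists>N>0. \<forall>y\<in>ipaths F. \<exists>\<beta>. step_pair (stake N y) \<beta>"
proof -
  define W where "W = (\<lambda>e. [GE e :: ('v,'e) gen]) ` edges E"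
  have "finite W" unfolding W_def using E.finite_edges by simp
  moreover have "w \<noteq> [] \<and> set w \<subseteq> gens E" if "w \<in> W" for w
    using that by (auto simp: W_def gens_def)
  ultimately obtain N where N: "\<And>w y. w \<in> W \<Longrightarrow> y \<in> ipaths F \<Longrightarrow>
     (\<forall>y'\<in>ipaths F. stake N y' = stake N y \<longrightarrow> wact E w (h y') = None) \<or>
     (\<exists>\<beta>. \<forall>z\<in>ipaths F. source F z = rng F (last (stake N y)) \<longrightarrow>
        \<beta> @- z \<in> ipaths F \<and> wact E w (h (stake N y @- z)) = Some (h (\<beta> @- z)))" "N > 0"
    using h_tail_uniform[of W] by blast
  have "\<exists>\<beta>. step_pair (stake N y) \<beta>" if y: "y \<in> ipaths F" for y
  proof -
    let ?e = "shd (h y)"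
    have "[GE ?e] \<in> W" using ipaths_shd[OF h_in[OF y]] by (simp add: W_def)
    from N(1)[OF this y] have "\<exists>\<beta>. \<forall>z\<in>ipaths F. source F z = rng F (last (stake N y)) \<longrightarrow>
        \<beta> @- z \<in> ipaths F \<and> wact E [GE ?e] (h (stake N y @- z)) = Some (h (\<beta> @- z))"
    proof
      assume "\<forall>y'\<in>ipaths F. stake N y' = stake N y \<longrightarrow> wact E [GE ?e] (h y') = None"
      then have "wact E [GE ?e] (h y) = None" using y by blast
      then show ?thesis by simp
    qed
    then obtain \<beta> where \<beta>: "\<And>z. z \<in> ipaths F \<Longrightarrow> source F z = rng F (last (stake N y)) \<Longrightarrow>
        \<beta> @- z \<in> ipaths F \<and> wact E [GE ?e] (h (stake N y @- z)) = Some (h (\<beta> @- z))"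
      by blast
    have "step_pair (stake N y) \<beta>"
      unfolding step_pair_def
    proof (intro exI[of _ ?e] ballI impI)
      fix z assume "z \<in> ipaths F" "source F z = rng F (last (stake N y))"
      from \<beta>[OF this] show "\<beta> @- z \<in> ipaths F \<and> shd (h (stake N y @- z)) = ?e \<and>
          stl (h (stake N y @- z)) = h (\<beta> @- z)"
        by (cases "shd (h (stake N y @- z)) = ?e") auto
    qed
    then show ?thesis by blast
  qed
  then show ?thesis using N(2) by blast
qed

definition step_len :: nat where
  "step_len = (SOME N. N > 0 \<and> (\<forall>y\<in>ipaths F. \<exists>\<beta>. step_pair (stake N y) \<beta>))"

definition step_image :: "'f list \<Rightarrow> 'f list" where
  "step_image \<alpha> = (SOME \<beta>. step_pair \<alpha> \<beta>)"

text \<open>The number of edges by which one shift in \<open>E\<close> shortens the path in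
  \<open>F\<close>; for the identity this is 1. Because \<open>step_len\<close> and
  \<open>step_image\<close> are fixed choices, it depends only on a prefix of \<open>g x\<close>,
  even at eventually periodic points, where the streams alone leave it ambiguous.\<close>

definition lag :: "'e stream \<Rightarrow> int" where
  "lag x = int step_len - int (length (step_image (stake step_len (g x))))"

lemma step_len: "step_len > 0" "y \<in> ipaths F \<Longrightarrow> step_pair (stake step_len y) (step_image (stake step_len y))"
proof -
  have *: "step_len > 0 \<and> (\<forall>y\<in>ipaths F. \<exists>\<beta>. step_pair (stake step_len y) \<beta>)"
    unfolding step_len_def by (rule someI_ex) (use step_pair_exists in blast)
  then show "step_len > 0" by simp
  show "step_pair (stake step_len y) (step_image (stake step_len y))" if "y \<in> ipaths F"
    unfolding step_image_def by (rule someI_ex) (use * that in blast)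
qed

lemma lag_locally_constant:
  "\<exists>M. \<forall>x\<in>ipaths E. \<forall>x'\<in>ipaths E. stake M x = stake M x' \<longrightarrow> lag x = lag x'"
  using coe.h_continuous[OF symmetric, of step_len] unfolding lag_def by metis

text \<open>\<open>trans_pair n x \<alpha> \<beta> z\<close>: near \<open>g x = \<alpha> z\<close> the \<open>n\<close>-fold shift of \<open>E\<close> is the prefix
  replacement \<open>\<alpha> z' \<mapsto> \<beta> z'\<close> on the side of \<open>F\<close>.\<close>

definition trans_pair :: "nat \<Rightarrow> 'e stream \<Rightarrow> 'f list \<Rightarrow> 'f list \<Rightarrow> 'f stream \<Rightarrow> bool" where
  "trans_pair n x \<alpha> \<beta> z \<longleftrightarrow> z \<in> ipaths F \<and> g x = \<alpha> @- z \<and> g (sdrop n x) = \<beta> @- z \<and>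
     (\<forall>z'\<in>ipaths F. source F z' = source F z \<longrightarrow> \<alpha> @- z' \<in> ipaths F \<and> \<beta> @- z' \<in> ipaths F \<and>
        stake n (h (\<alpha> @- z')) = stake n x \<and> sdrop n (h (\<alpha> @- z')) = h (\<beta> @- z'))"

lemma replace_tail:
  assumes "\<alpha> @- z \<in> ipaths F" "z' \<in> ipaths F" "source F z' = source F z"
  shows "\<alpha> @- z' \<in> ipaths F" "source F (\<alpha> @- z') = source F (\<alpha> @- z)"
proof -
  have *: "fpath F (source F (\<alpha> @- z)) \<alpha> (source F z')" using assms shift_ipaths_iff by metis
  show "\<alpha> @- z' \<in> ipaths F" using fpath_shift_ipaths[OF * assms(2)] .
  show "source F (\<alpha> @- z') = source F (\<alpha> @- z)" using fpath_source[OF *] .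
qed

lemma trans_pair_step:
  assumes x: "x \<in> ipaths E"
  shows "trans_pair 1 x (stake step_len (g x)) (step_image (stake step_len (g x))) (sdrop step_len (g x))"
proof -
  let ?y = "g x" let ?\<alpha> = "stake step_len ?y" and ?z = "sdrop step_len ?y"
  have y: "?y \<in> ipaths F" using g_in x .
  have sz: "source F ?z = rng F (last ?\<alpha>)" using fpath_ends[OF fpath_stake[OF y, of step_len]] step_len(1) by simp
  obtain e where e: "\<And>z. z \<in> ipaths F \<Longrightarrow> source F z = rng F (last ?\<alpha>) \<Longrightarrow>
     step_image ?\<alpha> @- z \<in> ipaths F \<and> shd (h (?\<alpha> @- z)) = e \<and> stl (h (?\<alpha> @- z)) = h (step_image ?\<alpha> @- z)"
    using step_len(2)[OF y] unfolding step_pair_def by blast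
  have zi: "?z \<in> ipaths F" using ipaths_sdrop[OF y] .
  have ez: "step_image ?\<alpha> @- ?z \<in> ipaths F" "shd x = e" "stl x = h (step_image ?\<alpha> @- ?z)"
    using e[OF zi sz] by (simp_all add: stake_sdrop hg[OF x])
  have "g (sdrop 1 x) = step_image ?\<alpha> @- ?z" using ez gh by simp
  moreover have "?\<alpha> @- z' \<in> ipaths F" if "z' \<in> ipaths F" "source F z' = source F ?z" for z'
    using replace_tail(1)[of ?\<alpha> ?z z'] that y by (simp add: stake_sdrop)
  ultimately show ?thesis
    unfolding trans_pair_def using zi e ez(2) sz by (auto simp: stake_sdrop)
qed

text \<open>Two successive prefix replacements compose after the shorter of \<beta> and the next
  source prefix is lengthened by a common piece \<delta> of the tail. The same \<delta> is added on
  both sides, so the length differences add up.\<close>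

lemma trans_pair_exists:
  assumes x: "x \<in> ipaths E"
  shows "\<exists>\<alpha> \<beta> z. trans_pair n x \<alpha> \<beta> z \<and> fsum lag n x = int (length \<alpha>) - int (length \<beta>)"
proof (induction n)
  case 0
  show ?case using g_in[OF x] by (intro exI[of _ "[]"] exI[of _ "g x"]) (auto simp: trans_pair_def)
next
  case (Suc n)
  then obtain \<alpha> \<beta> z where IH: "trans_pair n x \<alpha> \<beta> z" "fsum lag n x = int (length \<alpha>) - int (length \<beta>)" by blast
  let ?x = "sdrop n x"
  have xn: "?x \<in> ipaths E" using ipaths_sdrop[OF x] .
  obtain \<alpha>1 \<beta>1 z1 where st: "trans_pair 1 ?x \<alpha>1 \<beta>1 z1" "lag ?x = int (length \<alpha>1) - int (length \<beta>1)"
    using trans_pair_step[OF xn] by (auto simp: lag_def)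
  have sd: "sdrop 1 ?x = sdrop (Suc n) x" by (simp only: sdrop_add) simp
  have z: "z \<in> ipaths F" "z1 \<in> ipaths F" and gx: "g x = \<alpha> @- z" "g ?x = \<beta> @- z" "g ?x = \<alpha>1 @- z1"
    "g (sdrop (Suc n) x) = \<beta>1 @- z1"
    using IH(1) st(1)[unfolded trans_pair_def sd] unfolding trans_pair_def by blast+
  have A: "\<alpha> @- z' \<in> ipaths F" "\<beta> @- z' \<in> ipaths F" "stake n (h (\<alpha> @- z')) = stake n x"
     "sdrop n (h (\<alpha> @- z')) = h (\<beta> @- z')" if "z' \<in> ipaths F" "source F z' = source F z" for z'
    using IH(1) that by (auto simp: trans_pair_def)
  have B: "\<alpha>1 @- z' \<in> ipaths F" "\<beta>1 @- z' \<in> ipaths F" "shd (h (\<alpha>1 @- z')) = shd ?x"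
     "stl (h (\<alpha>1 @- z')) = h (\<beta>1 @- z')" if "z' \<in> ipaths F" "source F z' = source F z1" for z'
    using st(1) that by (auto simp: trans_pair_def)
  have comb: "stake (Suc n) X = stake (Suc n) x \<and> sdrop (Suc n) X = h (\<beta>1 @- z')"
    if "stake n X = stake n x" "sdrop n X = h (\<alpha>1 @- z')" "z' \<in> ipaths F" "source F z' = source F z1" for X z'
  proof
    have "X !! n = shd (sdrop n X)" by simp
    also have "\<dots> = x !! n" using B(3)[OF that(3,4)] that(2) by simp
    finally show "stake (Suc n) X = stake (Suc n) x" using that(1) by (simp add: stake_Suc del: stake.simps)
    show "sdrop (Suc n) X = h (\<beta>1 @- z')"
      using B(4)[OF that(3,4)] arg_cong[OF that(2), of stl] by simp
  qed
  show ?case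
  proof (cases "length \<beta> \<le> length \<alpha>1")
    case True
    then obtain \<delta> where \<delta>: "\<alpha>1 = \<beta> @ \<delta>" "z = \<delta> @- z1" using shift_eq_split gx by metis
    have "trans_pair (Suc n) x (\<alpha> @ \<delta>) \<beta>1 z1"
      unfolding trans_pair_def
    proof (intro conjI ballI impI)
      fix z' assume z': "z' \<in> ipaths F" "source F z' = source F z1"
      have \<delta>z: "\<delta> @- z' \<in> ipaths F" "source F (\<delta> @- z') = source F z"
        using replace_tail[of \<delta> z1 z'] z' z \<delta> by auto
      show "(\<alpha> @ \<delta>) @- z' \<in> ipaths F" "\<beta>1 @- z' \<in> ipaths F" using A(1)[OF \<delta>z] B(2)[OF z'] by auto
      show "stake (Suc n) (h ((\<alpha> @ \<delta>) @- z')) = stake (Suc n) x" "sdrop (Suc n) (h ((\<alpha> @ \<delta>) @- z')) = h (\<beta>1 @- z')"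
        using comb[of "h ((\<alpha> @ \<delta>) @- z')" z'] A(3,4)[OF \<delta>z] \<delta> z' by auto
    qed (use z gx \<delta> in auto)
    then show ?thesis using IH(2) st(2) \<delta>
      by (intro exI[of _ "\<alpha> @ \<delta>"] exI[of _ \<beta>1] exI[of _ z1]) auto
  next
    case False
    then obtain \<delta> where \<delta>: "\<beta> = \<alpha>1 @ \<delta>" "z1 = \<delta> @- z" using shift_eq_split gx by (metis nat_le_linear)
    have "trans_pair (Suc n) x \<alpha> (\<beta>1 @ \<delta>) z"
      unfolding trans_pair_def
    proof (intro conjI ballI impI)
      fix z' assume z': "z' \<in> ipaths F" "source F z' = source F z"
      have \<delta>z: "\<delta> @- z' \<in> ipaths F" "source F (\<delta> @- z') = source F z1"
        using replace_tail[of \<delta> z z'] z' z \<delta> by auto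
      show "\<alpha> @- z' \<in> ipaths F" "(\<beta>1 @ \<delta>) @- z' \<in> ipaths F" using A(1)[OF z'] B(2)[OF \<delta>z] by auto
      show "stake (Suc n) (h (\<alpha> @- z')) = stake (Suc n) x" "sdrop (Suc n) (h (\<alpha> @- z')) = h ((\<beta>1 @ \<delta>) @- z')"
        using comb[of "h (\<alpha> @- z')" "\<delta> @- z'"] A(3,4)[OF z'] \<delta> \<delta>z by auto
    qed (use z gx \<delta> in auto)
    then show ?thesis using IH(2) st(2) \<delta>
      by (intro exI[of _ \<alpha>] exI[of _ "\<beta>1 @ \<delta>"] exI[of _ z]) auto
  qed
qed

lemma lag_sdrop:
  assumes "x \<in> ipaths E"
  shows "\<exists>a b. sdrop a (g x) = sdrop b (g (sdrop n x)) \<and> fsum lag n x = int a - int b"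
proof -
  obtain \<alpha> \<beta> z where *: "trans_pair n x \<alpha> \<beta> z" "fsum lag n x = int (length \<alpha>) - int (length \<beta>)"
    using trans_pair_exists[OF assms] by blast
  have "sdrop (length \<alpha>) (\<alpha> @- z) = z" "sdrop (length \<beta>) (\<beta> @- z) = z" by (simp_all add: sdrop_shift)
  then show ?thesis using * unfolding trans_pair_def by metis
qed

text \<open>Around a periodic point the shift by a period is expanding; a prefix replacement that is not
  length-decreasing would collapse a whole cylinder to that point.\<close>

lemma periodic_lag_positive:
  assumes x: "x \<in> ipaths E" "sdrop p x = x" "p > 0"
    and tp: "trans_pair p x \<alpha> \<beta> z"
  shows "\<exists>\<delta>. \<alpha> = \<beta> @ \<delta> \<and> z = \<delta> @- z \<and> \<delta> \<noteq> []"
proof (cases "length \<alpha> \<le> length \<beta>")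
  case True
  have z: "z \<in> ipaths F" and gx: "g x = \<alpha> @- z" "g x = \<beta> @- z" using tp x by (auto simp: trans_pair_def)
  then obtain \<delta> where \<delta>: "\<beta> = \<alpha> @ \<delta>" "z = \<delta> @- z" using True shift_eq_split by metis
  have A: "\<alpha> @- z' \<in> ipaths F" "stake p (h (\<alpha> @- z')) = stake p x"
     "sdrop p (h (\<alpha> @- z')) = h (\<alpha> @- (\<delta> @- z'))" if "z' \<in> ipaths F" "source F z' = source F z" for z'
    using tp that \<delta> by (auto simp: trans_pair_def)
  have \<delta>z: "\<delta> @- z' \<in> ipaths F" "source F (\<delta> @- z') = source F z" if "z' \<in> ipaths F" "source F z' = source F z" for z'
    using replace_tail[of \<delta> z z'] that z \<delta> by auto
  \<comment> \<open>The return carries \<open>\<alpha> @- z'\<close> to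
    \<open>\<alpha> @- (\<delta> @- z')\<close>, which stays in the cylinder of \<alpha>. Hence
    every later block of length \<open>p\<close> is again the first block of
    \<open>x\<close>.\<close>
  have blk: "stake p (sdrop (i * p) (h (\<alpha> @- z'))) = stake p x"
    if "z' \<in> ipaths F" "source F z' = source F z" for z' i
    using that
  proof (induction i arbitrary: z')
    case 0
    then show ?case using A(2) by simp
  next
    case (Suc i)
    have "sdrop (Suc i * p) (h (\<alpha> @- z')) = sdrop (i * p) (h (\<alpha> @- (\<delta> @- z')))"
      using A(3)[OF Suc.prems] by (metis mult_Suc sdrop_add)
    then show ?case using Suc.IH[OF \<delta>z[OF Suc.prems]] by simp
  qed
  obtain z' where z': "z' \<in> ipaths F" "source F z' = source F z" "z' \<noteq> z" using F.another_path[OF z] by blast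
  have "h (\<alpha> @- z') = h (\<alpha> @- z)"
    by (rule blocks_eq[OF x(3)]) (use blk[OF z'(1,2)] blk[OF z refl] in simp)
  then have "\<alpha> @- z' = \<alpha> @- z" using gh A(1)[OF z'(1,2)] A(1)[OF z refl] by metis
  then show ?thesis using z' by simp
next
  case False
  have gx: "g x = \<alpha> @- z" "g x = \<beta> @- z" using tp x by (auto simp: trans_pair_def)
  then obtain \<delta> where "\<alpha> = \<beta> @ \<delta>" "z = \<delta> @- z" using False shift_eq_split by (metis nat_le_linear)
  then show ?thesis using False by auto
qed

lemma g_teq: "x \<in> ipaths E \<Longrightarrow> x' \<in> ipaths E \<Longrightarrow> teq x x' \<Longrightarrow> teq (g x) (g x')"
proof -
  assume x: "x \<in> ipaths E" "x' \<in> ipaths E" "teq x x'"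
  then obtain m n where mn: "sdrop m x = sdrop n x'" by (auto simp: teq_def)
  have "teq (g x) (g (sdrop m x))" "teq (g x') (g (sdrop n x'))"
    using lag_sdrop x by (auto simp: teq_def) metis+
  then show ?thesis using mn teq_sym teq_trans by metis
qed

text \<open>The removed piece \<delta> satisfies \<open>z = \<delta> @- z\<close>, so
  \<open>z\<close> is periodic and the lag, the length of \<delta>, is a positive multiple of its
  period. That the multiple is 1 has to wait for \<open>lag_of_period\<close>.\<close>

lemma periodic_image:
  assumes "x \<in> perpts E"
  shows "\<exists>z\<in>perpts F. teq (g x) z \<and> (\<exists>i>0. fsum lag (per x) x = int (i * per z))"
proof -
  have x: "x \<in> ipaths E" "sdrop (per x) x = x" "per x > 0" using assms per_props[OF assms] by (auto simp: perpts_def)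
  obtain \<alpha> \<beta> z where tp: "trans_pair (per x) x \<alpha> \<beta> z" "fsum lag (per x) x = int (length \<alpha>) - int (length \<beta>)"
    using trans_pair_exists[OF x(1)] by blast
  obtain \<delta> where \<delta>: "\<alpha> = \<beta> @ \<delta>" "z = \<delta> @- z" "\<delta> \<noteq> []" using periodic_lag_positive[OF x tp(1)] by blast
  have "sdrop (length \<delta>) z = z" using arg_cong[OF \<delta>(2), of "sdrop (length \<delta>)"] by (simp add: sdrop_shift)
  moreover from this have z: "z \<in> perpts F" using tp(1) \<delta>(3) by (auto simp: perpts_def trans_pair_def)
  ultimately obtain i where i: "length \<delta> = i * per z" using per_dvd[OF z] by (metis dvd_def mult.commute)
  have "fsum lag (per x) x = int (i * per z)" using tp(2) \<delta>(1) i by simp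
  moreover have "i > 0" using \<delta>(3) i by (cases i) auto
  moreover have "teq (g x) z" using tp(1) unfolding trans_pair_def by simp
  ultimately show ?thesis using z by blast
qed

lemma g_eper: "x \<in> ipaths E \<Longrightarrow> eper x \<Longrightarrow> eper (g x)"
proof -
  assume x: "x \<in> ipaths E" "eper x"
  then obtain m k where mk: "k > 0" "sdrop k (sdrop m x) = sdrop m x" by (auto simp only: eper_alt)
  then have "sdrop m x \<in> perpts E" using ipaths_sdrop x by (auto simp: perpts_def)
  then obtain z where z: "z \<in> perpts F" "teq (g (sdrop m x)) z" using periodic_image by blast
  have "sdrop (per z) z = sdrop 0 z" using per_props(2)[OF z(1)] by simp
  then have "eper z" unfolding eper_def using per_props(1)[OF z(1)] by (metis less_irrefl)
  moreover have "teq (g x) (g (sdrop m x))" using g_teq[OF x(1) ipaths_sdrop[OF x(1)]] teq_sym[OF teq_sdrop] by blast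
  ultimately show ?thesis using z teq_eper by metis
qed

lemma teq_g_h:
  assumes "x \<in> ipaths E" "z \<in> ipaths F" "teq (g x) z"
  shows "teq x (h z)"
  using coe.g_teq[OF symmetric g_in[OF assms(1)] assms(2,3)] hg[OF assms(1)] by simp

lemma fsum_locally_constant:
  assumes M: "\<And>x x'. x \<in> ipaths E \<Longrightarrow> x' \<in> ipaths E \<Longrightarrow> stake M x = stake M x' \<Longrightarrow> lag x = lag x'"
    and "x \<in> ipaths E" "x' \<in> ipaths E" "stake (n + M) x = stake (n + M) x'"
  shows "fsum lag n x = fsum lag n x'"
  unfolding fsum_def
proof (rule sum.cong[OF refl])
  fix i assume "i \<in> {..<n}"
  then have "stake (i + M) x = stake (i + M) x'" using stake_le[OF assms(4), of "i + M"] by simp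
  then have "drop i (stake (i + M) x) = drop i (stake (i + M) x')" by simp
  then have "stake M (sdrop i x) = stake M (sdrop i x')" by (simp add: drop_stake)
  then show "lag (sdrop i x) = lag (sdrop i x')" using M ipaths_sdrop assms by blast
qed

text \<open>Lags of aperiodic points are unique, so the lags of a short return to \<open>z\<close> in \<open>F\<close> and of the
  corresponding return in \<open>E\<close> can be compared along aperiodic points converging to the periodic one.\<close>

theorem lag_of_period:
  assumes x: "x \<in> perpts E" and z: "z \<in> perpts F" and xz: "teq (g x) z"
  shows "fsum lag (per x) x = int (per z)"
proof -
  interpret S: coe F E g h by (rule symmetric)
  have xi: "x \<in> ipaths E" and zi: "z \<in> ipaths F" using x z by (auto simp: perpts_def)
  define p q where "p = per x" and "q = per z"
  obtain z0 i where z0: "z0 \<in> perpts F" "teq (g x) z0" "i > 0" "fsum lag p x = int (i * per z0)"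
    using periodic_image[OF x] by (auto simp: p_def)
  have "per z0 = q" unfolding q_def using per_teq[OF z0(1) z] teq_trans[OF teq_sym[OF z0(2)] xz] by blast
  then have iq: "fsum lag p x = int (i * q)" using z0 by simp
  have q: "q > 0" "sdrop q z = z" using per_props[OF z] by (auto simp: q_def)
  \<comment> \<open>Through the inverse equivalence, one period of \<open>z\<close> becomes a return
    of length \<open>J\<close> at a point \<open>u\<close> on the orbit of \<open>x\<close>. With
    \<open>J = j * p\<close> its lag is \<open>j * (i * q)\<close>; the comparison below shows it to
    be \<open>q\<close>, which forces \<open>i = 1\<close>.\<close>
  obtain a b u where tp: "S.trans_pair q z a b u" using S.trans_pair_exists[OF zi] by blast
  obtain \<eta> where \<eta>: "a = b @ \<eta>" "u = \<eta> @- u" "\<eta> \<noteq> []"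
    using S.periodic_lag_positive[OF zi q(2,1) tp] by blast
  have ui: "u \<in> ipaths E" and hz: "h z = a @- u" using tp by (auto simp: S.trans_pair_def)
  define J where "J = length \<eta>"
  have uJ: "sdrop J u = u" using arg_cong[OF \<eta>(2), of "sdrop J"] by (simp add: sdrop_shift J_def)
  have up: "u \<in> perpts E" using ui uJ \<eta>(3) by (auto simp: perpts_def J_def)
  have "teq x u" using teq_trans[OF teq_g_h[OF xi zi xz]] hz by simp
  then obtain r where r: "u = sdrop r x" using teq_periodic[OF x up] by blast
  have pu: "per u = p" unfolding p_def using per_teq[OF x up] \<open>teq x u\<close> by simp
  then obtain j where j: "J = j * p" using per_dvd[OF up] uJ by (metis dvd_def mult.commute)
  have "fsum lag p u = int (i * q)"
    using fsum_period_rotate[OF per_props(2)[OF x], of lag r] r iq by (simp add: p_def)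
  then have fJ: "fsum lag J u = int (j * (i * q))"
    using fsum_mult[OF per_props(2)[OF up], of lag j] j pu by simp
  obtain M where M: "\<And>x x'. x \<in> ipaths E \<Longrightarrow> x' \<in> ipaths E \<Longrightarrow> stake M x = stake M x' \<Longrightarrow> lag x = lag x'"
    using lag_locally_constant by blast
  have si: "sdrop (Suc M) u \<in> ipaths E" using ipaths_sdrop[OF ui] .
  obtain v where v: "v \<in> ipaths E" "source E v = source E (sdrop (Suc M) u)" "\<not> eper v"
    using E.aperiodic_exists[OF source_in_verts[OF E.fin si]] by blast
  \<comment> \<open>A path that follows \<open>u\<close> far enough for the relevant lags to agree
    and then continues aperiodically.\<close>
  define u' where "u' = stake (Suc M) u @- v"
  have u': "u' \<in> ipaths E" "source E u' = source E u"
    using S.replace_tail[of "stake (Suc M) u" "sdrop (Suc M) u" v] v ui unfolding u'_def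
    by (simp_all only: stake_sdrop)
  have u'st: "stake M u' = stake M u"
    by (rule stake_le[of "Suc M"]) (simp_all add: u'_def stake_shift del: stake.simps)
  have u'a: "\<not> eper u'" using v by (simp add: u'_def del: stake.simps)
  define X where "X = a @- u'"
  define Y where "Y = b @- u'"
  have XY: "X \<in> ipaths E" "Y \<in> ipaths E" "sdrop q (g X) = g Y"
    using tp u' by (auto simp: S.trans_pair_def X_def Y_def)
  have bu: "b @- u = a @- u" using \<eta> by simp
  have ai: "a @- u \<in> ipaths E" using tp ui by (auto simp: S.trans_pair_def)
  obtain a1 b1 where 1: "sdrop a1 (g X) = sdrop b1 (g u')" "fsum lag (length b + J) X = int a1 - int b1"
    using lag_sdrop[OF XY(1), of "length b + J"] \<eta>(1) by (auto simp: X_def sdrop_shift J_def)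
  obtain a2 b2 where 2: "sdrop a2 (g Y) = sdrop b2 (g u')" "fsum lag (length b) Y = int a2 - int b2"
    using lag_sdrop[OF XY(2), of "length b"] by (auto simp: Y_def sdrop_shift)
  have "fsum lag (length b + J) X = fsum lag (length b + J) (a @- u)"
    by (rule fsum_locally_constant[OF M XY(1) ai]) (use u'st \<eta>(1) in \<open>simp_all add: X_def stake_shift J_def\<close>)
  also have "\<dots> = fsum lag (length b) (a @- u) + fsum lag J u"
    using \<eta> by (simp add: fsum_add sdrop_shift)
  finally have kX: "int a1 - int b1 = fsum lag (length b) (a @- u) + int (j * (i * q))" using 1(2) fJ by simp
  have bi: "b @- u \<in> ipaths E" using ai bu by simp
  have "fsum lag (length b) Y = fsum lag (length b) (b @- u)"
    by (rule fsum_locally_constant[OF M XY(2) bi]) (use u'st in \<open>simp_all add: Y_def stake_shift\<close>)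
  then have kY: "int a2 - int b2 = fsum lag (length b) (a @- u)" using 2(2) bu by simp
  have gX: "\<not> eper (g X)"
    using S.g_eper[OF g_in[OF XY(1)]] hg[OF XY(1)] u'a by (auto simp: X_def)
  \<comment> \<open>Both \<open>g X\<close> and \<open>g Y\<close> are related to
    \<open>g u'\<close>. Eliminating it relates them with lag \<open>j * (i * q)\<close>, whereas
    \<open>sdrop q (g X) = g Y\<close> relates them with lag \<open>q\<close>; aperiodicity of
    \<open>g X\<close> makes the two equal.\<close>
  have "sdrop (a1 + b2) (g X) = sdrop (b2 + b1) (g u')" using sdrop_add_eq[OF 1(1), of b2] by (simp add: add.commute)
  also have "\<dots> = sdrop (a2 + b1) (g Y)" using sdrop_add_eq[OF 2(1), of b1] by simp
  finally have "int (a1 + b2) - int (a2 + b1) = int q - int 0"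
    using XY(3) by (intro lag_unique[OF gX]) auto
  then have "int (j * (i * q)) = int q" using kX kY by linarith
  then have "(j * i) * q = 1 * q" by (simp only: of_nat_eq_iff mult.assoc mult_1)
  then have "j * i = 1" using q(1) by (simp only: mult_cancel2) simp
  then have "i = 1" by simp
  then show ?thesis using iq by (simp add: p_def q_def)
qed

end

section \<open>Zeta series as sums over periodic points\<close>

definition fixpts :: "('v,'e) graph \<Rightarrow> nat \<Rightarrow> 'e stream set" where
  "fixpts G n = {x \<in> ipaths G. sdrop n x = x}"

lemma finite_fixpts:
  assumes "finite (edges G)" "n > 0"
  shows "finite (fixpts G n)"
proof (rule inj_on_finite[of "stake n" _ "{\<alpha>. set \<alpha> \<subseteq> edges G \<and> length \<alpha> = n}"])
  show "inj_on (stake n) (fixpts G n)"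
    by (rule inj_onI) (metis (mono_tags, lifting) fixpts_def mem_Collect_eq periodic_eq_cycle assms(2))
  show "stake n ` fixpts G n \<subseteq> {\<alpha>. set \<alpha> \<subseteq> edges G \<and> length \<alpha> = n}"
    using fpath_set[OF fpath_stake[of _ G n]] by (auto simp: fixpts_def)
  show "finite {\<alpha>. set \<alpha> \<subseteq> edges G \<and> length \<alpha> = n}" using finite_lists_length_eq[OF assms(1)] .
qed

text \<open>A point fixed by the \<open>n\<close>-th shift has a period dividing \<open>n\<close>,
  so it amounts to a periodic point and a repetition number.\<close>

lemma fixpts_per_bij:
  "bij_betw (\<lambda>(n, x). (x, n div per x)) (SIGMA n:{1..}. fixpts G n) (perpts G \<times> {1..})"
proof (rule bij_betw_byWitness[where f' = "\<lambda>(x, k). (k * per x, x)"])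
  have *: "x \<in> perpts G \<and> per x dvd n" if "n \<ge> 1" "x \<in> fixpts G n" for n x
  proof -
    have "x \<in> perpts G" using that by (auto simp: fixpts_def perpts_def intro!: exI[of _ n])
    then show ?thesis using that per_dvd by (auto simp: fixpts_def)
  qed
  show "\<forall>a\<in>SIGMA n:{1..}. fixpts G n. (\<lambda>(x, k). (k * per x, x)) ((\<lambda>(n, x). (x, n div per x)) a) = a"
    using * by auto
  show "\<forall>a'\<in>perpts G \<times> {1..}. (\<lambda>(n, x). (x, n div per x)) ((\<lambda>(x, k). (k * per x, x)) a') = a'"
    using per_props(1) by fastforce
  show "(\<lambda>(n, x). (x, n div per x)) ` (SIGMA n:{1..}. fixpts G n) \<subseteq> perpts G \<times> {1..}"
  proof
    fix xk assume "xk \<in> (\<lambda>(n, x). (x, n div per x)) ` (SIGMA n:{1..}. fixpts G n)"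
    then obtain n x where nx: "n \<ge> 1" "x \<in> fixpts G n" "xk = (x, n div per x)" by auto
    have "n div per x \<noteq> 0" using *[OF nx(1,2)] nx(1) per_props(1)[of x G] by (metis dvd_div_eq_0_iff not_one_le_zero)
    then show "xk \<in> perpts G \<times> {1..}" using *[OF nx(1,2)] nx(3) by auto
  qed
  show "(\<lambda>(x, k). (k * per x, x)) ` (perpts G \<times> {1..}) \<subseteq> (SIGMA n:{1..}. fixpts G n)"
  proof
    fix nx assume "nx \<in> (\<lambda>(x, k). (k * per x, x)) ` (perpts G \<times> {1..})"
    then obtain x k where xk: "x \<in> perpts G" "k \<ge> 1" "nx = (k * per x, x)" by auto
    then have "sdrop (k * per x) x = x" using per_dvd[of x G "k * per x"] by simp
    moreover have "k * per x \<ge> 1" using xk per_props(1)[OF xk(1)] by simp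
    ultimately show "nx \<in> (SIGMA n:{1..}. fixpts G n)" using xk by (auto simp: fixpts_def perpts_def)
  qed
qed

text \<open>Tonelli: for nonnegative terms the iterated sum already yields joint summability. Both
  directions are needed, to enter and to leave the double sums.\<close>

lemma has_sum_Sigma_nonneg_iff:
  fixes f :: "'a \<times> 'b \<Rightarrow> real"
  assumes fib: "\<And>x. x \<in> A \<Longrightarrow> ((\<lambda>y. f (x, y)) has_sum g x) (B x)"
    and nonneg: "\<And>x y. x \<in> A \<Longrightarrow> y \<in> B x \<Longrightarrow> f (x, y) \<ge> 0"
  shows "(f has_sum S) (Sigma A B) \<longleftrightarrow> (g has_sum S) A"
proof
  assume L: "(g has_sum S) A"
  have summ: "f summable_on Sigma A B"
    by (rule summable_on_SigmaI[where g = g, OF _ has_sum_imp_summable[OF L]]) (rule fib nonneg; assumption)+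
  show "(f has_sum S) (Sigma A B)" by (rule has_sum_SigmaI[where g = g, OF _ L summ]) (rule fib)
next
  assume "(f has_sum S) (Sigma A B)"
  then show "(g has_sum S) A" by (rule has_sum_SigmaD) (rule fib)
qed

lemma has_sum_fixpts:
  fixes W :: "nat \<Rightarrow> 'e stream \<Rightarrow> real"
  assumes "finite (edges G)" "\<And>n x. n \<ge> 1 \<Longrightarrow> x \<in> fixpts G n \<Longrightarrow> W n x \<ge> 0"
  shows "((\<lambda>n. \<Sum>x\<in>fixpts G n. W n x) has_sum S) {1..} \<longleftrightarrow>
    ((\<lambda>(x, k). W (k * per x) x) has_sum S) (perpts G \<times> {1..})"
proof -
  have fib: "((\<lambda>x. (case (n, x) of (n, x) \<Rightarrow> W n x)) has_sum (\<Sum>x\<in>fixpts G n. W n x)) (fixpts G n)" if "n \<in> {1..}" for n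
    using finite_fixpts[OF assms(1), of n] that by (intro has_sum_finiteI) auto
  have "((\<lambda>n. \<Sum>x\<in>fixpts G n. W n x) has_sum S) {1..} \<longleftrightarrow>
     ((\<lambda>(n, x). W n x) has_sum S) (SIGMA n:{1..}. fixpts G n)"
    by (rule has_sum_Sigma_nonneg_iff[symmetric]) (use fib assms(2) in auto)
  also have "\<dots> \<longleftrightarrow> ((\<lambda>a. (\<lambda>(x, k). W (k * per x) x) ((\<lambda>(n, x). (x, n div per x)) a)) has_sum S) (SIGMA n:{1..}. fixpts G n)"
  proof (rule has_sum_cong)
    fix a assume "a \<in> (SIGMA n:{1..}. fixpts G n)"
    then obtain n x where a: "a = (n, x)" "n \<ge> 1" "x \<in> fixpts G n" by auto
    then have "x \<in> perpts G" by (auto simp: fixpts_def perpts_def intro!: exI[of _ n])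
    then have "n div per x * per x = n" using a per_dvd[of x G n] by (simp add: fixpts_def)
    then show "(case a of (n, x) \<Rightarrow> W n x) = (\<lambda>(x, k). W (k * per x) x) ((\<lambda>(n, x). (x, n div per x)) a)"
      using a by simp
  qed
  also have "\<dots> \<longleftrightarrow> ((\<lambda>(x, k). W (k * per x) x) has_sum S) (perpts G \<times> {1..})"
    by (rule has_sum_reindex_bij_betw[OF fixpts_per_bij])
  finally show ?thesis .
qed

context coe
begin

lemma periodic_image_right:
  assumes "z \<in> perpts F"
  shows "\<exists>x\<in>perpts E. teq (g x) z"
proof -
  interpret S: coe F E g h by (rule symmetric)
  have z: "z \<in> ipaths F" using assms by (simp add: perpts_def)
  obtain x where x: "x \<in> perpts E" "teq (h z) x" using S.periodic_image[OF assms] by blast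
  then have "teq (g (h z)) (g x)" using g_teq[OF h_in[OF z]] by (simp add: perpts_def)
  then show ?thesis using gh[OF z] x teq_sym by metis
qed

text \<open>Double counting over tail equivalent pairs of periodic points: both sums equal the sum of
  \<open>t ^ (k * per z) / (k * per x * per z)\<close> over triples \<open>(x, z, k)\<close> with \<open>g x\<close> tail equivalent to \<open>z\<close>.\<close>

theorem fixpts_sums:
  fixes t :: real
  assumes t: "t > 0" and S: "((\<lambda>n. (\<Sum>y\<in>fixpts F n. t ^ n / n)) has_sum S) {1..}"
  shows "((\<lambda>n. (\<Sum>x\<in>fixpts E n. t powi (fsum lag n x) / n)) has_sum S) {1..}"
proof -
  let ?w = "\<lambda>k x z. t ^ (k * per z) / (real k * per x * per z)"
  have cardz: "finite {z \<in> perpts F. teq (g x) z}" "card {z \<in> perpts F. teq (g x) z} = per z"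
    if z: "z \<in> perpts F" "teq (g x) z" for x z
  proof -
    have "{z \<in> perpts F. teq (g x) z} = {z' \<in> perpts F. teq z z'}"
      using teq_trans teq_sym z by blast
    then show "finite {z \<in> perpts F. teq (g x) z}" "card {z \<in> perpts F. teq (g x) z} = per z"
      using card_teq_class[OF z(1)] by simp_all
  qed
  have cardx: "finite {x \<in> perpts E. teq (g x) z}" "card {x \<in> perpts E. teq (g x) z} = per x"
    if z: "z \<in> perpts F" and x: "x \<in> perpts E" "teq (g x) z" for x z
  proof -
    have i: "x \<in> ipaths E" "z \<in> ipaths F" using x z by (auto simp: perpts_def)
    have "teq (g x') z \<longleftrightarrow> teq x x'" if "x' \<in> perpts E" for x'
    proof
      have x': "x' \<in> ipaths E" using that by (simp add: perpts_def)
      show "teq x x'" if "teq (g x') z"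
        using teq_trans teq_sym teq_g_h[OF i x(2)] teq_g_h[OF x' i(2) that] by blast
      show "teq (g x') z" if "teq x x'"
        using g_teq[OF i(1) x' that] x(2) teq_trans teq_sym by blast
    qed
    then have "{x \<in> perpts E. teq (g x) z} = {x' \<in> perpts E. teq x x'}" by blast
    then show "finite {x \<in> perpts E. teq (g x) z}" "card {x \<in> perpts E. teq (g x) z} = per x"
      using card_teq_class[OF x(1)] by simp_all
  qed
  let ?f = "\<lambda>((z, k), x). ?w k x z"
  let ?A = "SIGMA zk:perpts F \<times> {1..}. {x \<in> perpts E. teq (g x) (fst zk)}"
  have "((\<lambda>(z, k). t ^ (k * per z) / real (k * per z)) has_sum S) (perpts F \<times> {1..})"
    using S has_sum_fixpts[OF F.finite_edges, of "\<lambda>n y. t ^ n / n" S] t by simp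
  also have "?this \<longleftrightarrow> (?f has_sum S) ?A"
  proof (rule has_sum_Sigma_nonneg_iff[symmetric])
    fix zk assume "zk \<in> perpts F \<times> {1::nat..}"
    then obtain z k where zk: "zk = (z, k)" "z \<in> perpts F" "k \<ge> 1" by auto
    obtain x0 where x0: "x0 \<in> perpts E" "teq (g x0) z" using periodic_image_right[OF zk(2)] by blast
    have "(\<Sum>x | x \<in> perpts E \<and> teq (g x) z. ?w k x z) = (\<Sum>x | x \<in> perpts E \<and> teq (g x) z. ?w k x0 z)"
    proof (rule sum.cong[OF refl])
      fix x assume "x \<in> {x. x \<in> perpts E \<and> teq (g x) z}"
      then have "per x = per x0" using cardx(2)[OF zk(2), of x] cardx(2)[OF zk(2) x0] by simp
      then show "?w k x z = ?w k x0 z" by simp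
    qed
    also have "\<dots> = t ^ (k * per z) / real (k * per z)"
      using cardx(2)[OF zk(2) x0] per_props(1)[OF x0(1)] by simp
    finally show "((\<lambda>x. ?f (zk, x)) has_sum (case zk of (z, k) \<Rightarrow> t ^ (k * per z) / real (k * per z)))
      {x \<in> perpts E. teq (g x) (fst zk)}"
      using cardx(1)[OF zk(2) x0] zk(1) by (intro has_sum_finiteI) auto
  qed (use t in auto)
  also have "\<dots> \<longleftrightarrow>
     ((\<lambda>((x, k), z). ?w k x z) has_sum S) (SIGMA xk:perpts E \<times> {1..}. {z \<in> perpts F. teq (g (fst xk)) z})"
    by (rule has_sum_reindex_bij_witness[of _ "\<lambda>((x, k), z). ((z, k), x)" "\<lambda>((z, k), x). ((x, k), z)"]) auto
  finally have W: "((\<lambda>((x, k), z). ?w k x z) has_sum S)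
    (SIGMA xk:perpts E \<times> {1..}. {z \<in> perpts F. teq (g (fst xk)) z})" .
  let ?g = "\<lambda>(x, k). t powi (fsum lag (k * per x) x) / real (k * per x)"
  have fib: "((\<lambda>z. (\<lambda>((x, k), z). ?w k x z) (xk, z)) has_sum ?g xk) {z \<in> perpts F. teq (g (fst xk)) z}"
    if "xk \<in> perpts E \<times> {1..}" for xk
  proof -
    from that obtain x k where xk: "xk = (x, k)" "x \<in> perpts E" "k \<ge> 1" by auto
    obtain z0 where z0: "z0 \<in> perpts F" "teq (g x) z0" using periodic_image[OF xk(2)] by blast
    have "(\<Sum>z | z \<in> perpts F \<and> teq (g x) z. ?w k x z) = (\<Sum>z | z \<in> perpts F \<and> teq (g x) z. ?w k x z0)"
    proof (rule sum.cong[OF refl])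
      fix z assume "z \<in> {z. z \<in> perpts F \<and> teq (g x) z}"
      then have "per z = per z0" using cardz(2)[of z x] cardz(2)[OF z0] by simp
      then show "?w k x z = ?w k x z0" by simp
    qed
    also have "\<dots> = t ^ (k * per z0) / real (k * per x)"
      using cardz(2)[OF z0] per_props(1)[OF z0(1)] by simp
    \<comment> \<open>The one place where the two weights meet: by \<open>lag_of_period\<close>, the
      lags along \<open>k\<close> periods of \<open>x\<close> add up to \<open>k\<close> periods of
      \<open>z0\<close>.\<close>
    also have "t ^ (k * per z0) = t powi (fsum lag (k * per x) x)"
      using lag_of_period[OF xk(2) z0] fsum_mult[OF per_props(2)[OF xk(2)], of lag k]
      by (simp flip: power_int_of_nat)
    finally show ?thesis
      using cardz(1)[OF z0] xk(1) by (intro has_sum_finiteI) auto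
  qed
  have "(?g has_sum S) (perpts E \<times> {1..})" by (rule has_sum_SigmaD[OF W fib])
  then show ?thesis
    using has_sum_fixpts[OF E.finite_edges, of "\<lambda>n x. t powi (fsum lag n x) / n" S] t by simp
qed

end

section \<open>Determinants and periodic points\<close>

definition det_one_minus :: "'v set \<Rightarrow> ('v \<Rightarrow> 'v \<Rightarrow> complex) \<Rightarrow> complex" where
  "det_one_minus V M = (\<Sum>p | p permutes V. of_int (sign p) * (\<Prod>v\<in>V. (if p v = v then 1 else 0) - M v (p v)))"

primrec mpow :: "'v set \<Rightarrow> ('v \<Rightarrow> 'v \<Rightarrow> complex) \<Rightarrow> nat \<Rightarrow> 'v \<Rightarrow> 'v \<Rightarrow> complex" where
  "mpow V M 0 v w = (if v = w then 1 else 0)"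
| "mpow V M (Suc n) v w = (\<Sum>u\<in>V. mpow V M n v u * M u w)"

lemma permutes_bij_betw_map:
  assumes b: "bij_betw e A B"
  shows "bij_betw (map_permutation A e) {p. p permutes A} {p. p permutes B}"
proof (rule bij_betw_byWitness[where f' = "map_permutation B (inv_into A e)"])
  have b': "bij_betw (inv_into A e) B A" using bij_betw_inv_into[OF b] .
  show "\<forall>p\<in>{p. p permutes A}. map_permutation B (inv_into A e) (map_permutation A e p) = p"
    using map_permutation_compose_inv[OF b, of _ "inv_into A e"] b bij_betw_inv_into_left by fastforce
  show "\<forall>p\<in>{p. p permutes B}. map_permutation A e (map_permutation B (inv_into A e) p) = p"
    using map_permutation_compose_inv[OF b', of _ e] b bij_betw_inv_into_right by fastforce
  show "map_permutation A e ` {p. p permutes A} \<subseteq> {p. p permutes B}"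
    using map_permutation_permutes[OF b] by auto
  show "map_permutation B (inv_into A e) ` {p. p permutes B} \<subseteq> {p. p permutes A}"
    using map_permutation_permutes[OF b'] by auto
qed

text \<open>An enumeration of \<open>V\<close> carries permutations over with their signs, so the
  two Leibniz sums agree term by term.\<close>

lemma det_one_minus_eq_det:
  assumes e: "bij_betw e {0..<N} V"
  shows "det_one_minus V M = det (1\<^sub>m N - mat N N (\<lambda>(i, j). M (e i) (e j)))"
proof -
  let ?U = "{0..<N}"
  let ?A = "1\<^sub>m N - mat N N (\<lambda>(i, j). M (e i) (e j))"
  have inj: "inj_on e ?U" using e by (simp add: bij_betw_def)
  have "det_one_minus V M = (\<Sum>p | p permutes ?U. of_int (sign (map_permutation ?U e p)) *
     (\<Prod>v\<in>V. (if map_permutation ?U e p v = v then 1 else 0) - M v (map_permutation ?U e p v)))"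
    unfolding det_one_minus_def
    by (rule sum.reindex_bij_betw[OF permutes_bij_betw_map[OF e], symmetric])
  also have "\<dots> = (\<Sum>p | p permutes ?U. of_int (sign p) * (\<Prod>i = 0..<N. ?A $$ (i, p i)))"
  proof (rule sum.cong[OF refl])
    fix p assume "p \<in> {p. p permutes ?U}"
    then have p: "p permutes ?U" by simp
    have "(\<Prod>v\<in>V. (if map_permutation ?U e p v = v then 1 else 0) - M v (map_permutation ?U e p v))
      = (\<Prod>i\<in>?U. (if map_permutation ?U e p (e i) = e i then 1 else 0) - M (e i) (map_permutation ?U e p (e i)))"
      by (rule prod.reindex_bij_betw[OF e, symmetric])
    also have "\<dots> = (\<Prod>i = 0..<N. ?A $$ (i, p i))"
    proof (rule prod.cong[OF refl])
      fix i assume i: "i \<in> ?U"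
      then have "p i \<in> ?U" using permutes_in_image[OF p] by simp
      then show "(if map_permutation ?U e p (e i) = e i then 1 else 0) - M (e i) (map_permutation ?U e p (e i)) = ?A $$ (i, p i)"
        using i inj_on_eq_iff[OF inj, of "p i" i] by (simp add: map_permutation_apply[OF inj i])
    qed
    finally show "of_int (sign (map_permutation ?U e p)) *
      (\<Prod>v\<in>V. (if map_permutation ?U e p v = v then 1 else 0) - M v (map_permutation ?U e p v))
      = of_int (sign p) * (\<Prod>i = 0..<N. ?A $$ (i, p i))"
      using sign_map_permutation[OF inj p] by simp
  qed
  also have "\<dots> = det ?A" by (subst det_def'[of _ N]) auto
  finally show ?thesis .
qed

lemma mpow_eq_pow_mat:
  assumes e: "bij_betw e {0..<N} V" and "i < N" "j < N"
  shows "mpow V M n (e i) (e j) = (mat N N (\<lambda>(i, j). M (e i) (e j)) ^\<^sub>m n) $$ (i, j)"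
  using assms(2,3)
proof (induction n arbitrary: j)
  case 0
  have "e i = e j \<longleftrightarrow> i = j" using e 0 by (auto simp: bij_betw_def inj_on_def)
  then show ?case using 0 by simp
next
  case (Suc n)
  let ?A = "mat N N (\<lambda>(i, j). M (e i) (e j))"
  have "mpow V M (Suc n) (e i) (e j) = (\<Sum>k\<in>{0..<N}. mpow V M n (e i) (e k) * M (e k) (e j))"
    using sum.reindex_bij_betw[OF e, of "\<lambda>u. mpow V M n (e i) u * M u (e j)"] by simp
  also have "\<dots> = (\<Sum>k\<in>{0..<N}. (?A ^\<^sub>m n) $$ (i, k) * ?A $$ (k, j))"
    using Suc by (intro sum.cong) auto
  also have "\<dots> = (?A ^\<^sub>m Suc n) $$ (i, j)"
    using Suc.prems pow_mat_dim_square[of ?A N n] by (simp add: scalar_prod_def)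
  finally show ?case .
qed

lemma trace_comm:
  assumes "X \<in> carrier_mat n n" "Y \<in> carrier_mat n n"
  shows "(\<Sum>i<n. (X * Y) $$ (i, i)) = (\<Sum>i<n. (Y * X) $$ (i, i :: nat) :: complex)"
proof -
  have "(\<Sum>i<n. (X * Y) $$ (i, i)) = (\<Sum>i<n. \<Sum>j<n. X $$ (i, j) * Y $$ (j, i))"
    using assms by (auto simp: scalar_prod_def lessThan_atLeast0 intro!: sum.cong)
  also have "\<dots> = (\<Sum>j<n. \<Sum>i<n. Y $$ (j, i) * X $$ (i, j))"
    by (subst sum.swap) (simp add: mult.commute)
  also have "\<dots> = (\<Sum>i<n. (Y * X) $$ (i, i))"
    using assms by (auto simp: scalar_prod_def lessThan_atLeast0 intro!: sum.cong)
  finally show ?thesis .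
qed

lemma upper_triangular_pow:
  fixes B :: "complex mat"
  assumes B: "B \<in> carrier_mat n n" "upper_triangular B"
  shows "upper_triangular (B ^\<^sub>m k) \<and> (\<forall>i<n. (B ^\<^sub>m k) $$ (i, i) = (B $$ (i, i)) ^ k)"
proof (induction k)
  case 0
  then show ?case using B by simp
next
  case (Suc k)
  let ?C = "B ^\<^sub>m k"
  have C: "?C \<in> carrier_mat n n" using B by simp
  have zero: "B $$ (i, j) = 0" "?C $$ (i, j) = 0" if "j < i" "i < n" for i j
    using upper_triangularD[OF B(2) that(1)] upper_triangularD[of ?C j i] Suc that B C by auto
  have entry: "(?C * B) $$ (i, j) = (\<Sum>l = 0..<n. ?C $$ (i, l) * B $$ (l, j))" if "i < n" "j < n" for i j
    using B C that by (simp add: scalar_prod_def)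
  have "(?C * B) $$ (i, j) = 0" if "j < i" "i < n" for i j
    unfolding entry[OF that(2) less_trans[OF that]]
  proof (rule sum.neutral, rule ballI)
    fix l assume "l \<in> {0..<n}"
    then show "?C $$ (i, l) * B $$ (l, j) = 0" using zero that by (cases "l < i") auto
  qed
  then have "upper_triangular (?C * B)" using C by (intro upper_triangularI) auto
  moreover have "(?C * B) $$ (i, i) = (B $$ (i, i)) ^ Suc k" if i: "i < n" for i
  proof -
    have "(?C * B) $$ (i, i) = (\<Sum>l = 0..<n. if l = i then ?C $$ (i, i) * B $$ (i, i) else 0)"
      unfolding entry[OF i i]
    proof (rule sum.cong[OF refl])
      fix l assume "l \<in> {0..<n}"
      then show "?C $$ (i, l) * B $$ (l, i) = (if l = i then ?C $$ (i, i) * B $$ (i, i) else 0)"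
        using zero i by (cases l i rule: linorder_cases) auto
    qed
    then show ?thesis using Suc i by (simp add: mult.commute)
  qed
  ultimately show ?case by simp
qed

text \<open>Over the complex numbers \<open>A\<close> is similar to a triangular matrix. Its
  diagonal gives the determinants for all \<open>s\<close> and, because powers stay triangular, all
  power traces.\<close>

lemma eigenvalue_sums:
  fixes A :: "complex mat"
  assumes A: "A \<in> carrier_mat n n"
  shows "\<exists>l. (\<forall>s. det (1\<^sub>m n - s \<cdot>\<^sub>m A) = (\<Prod>i<n. 1 - s * l i)) \<and>
     (\<forall>k. (\<Sum>i<n. (A ^\<^sub>m k) $$ (i, i)) = (\<Sum>i<n. l i ^ k))"
proof -
  obtain as where "char_poly A = (\<Prod>a\<leftarrow>as. [:- a, 1:])" using char_poly_factorized[OF A] by blast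
  then obtain B where B: "B \<in> carrier_mat n n" "upper_triangular B" "similar_mat A B"
    using schur_decomposition_exists[OF A] by blast
  then obtain P Q where wit: "similar_mat_wit A B P Q" by (auto simp: similar_mat_def)
  have PQ: "P \<in> carrier_mat n n" "Q \<in> carrier_mat n n" "P * Q = 1\<^sub>m n" "Q * P = 1\<^sub>m n" "A = P * B * Q"
    using similar_mat_witD2[OF A wit] by auto
  define l where "l i = B $$ (i, i)" for i
  have "det (1\<^sub>m n - s \<cdot>\<^sub>m A) = (\<Prod>i<n. 1 - s * l i)" for s
  proof -
    let ?T = "1\<^sub>m n - s \<cdot>\<^sub>m B"
    have T: "?T \<in> carrier_mat n n" using B(1) by (intro minus_carrier_mat smult_carrier_mat)
    have sB: "s \<cdot>\<^sub>m B \<in> carrier_mat n n" "P * B \<in> carrier_mat n n" "P * (s \<cdot>\<^sub>m B) \<in> carrier_mat n n"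
      using B(1) PQ(1) by (auto intro!: mult_carrier_mat)
    have "P * ?T * Q = (P * 1\<^sub>m n - P * (s \<cdot>\<^sub>m B)) * Q"
      using mult_minus_distrib_mat[OF PQ(1) one_carrier_mat sB(1)] by simp
    also have "\<dots> = P * 1\<^sub>m n * Q - P * (s \<cdot>\<^sub>m B) * Q"
      using PQ(1) sB(3) by (intro minus_mult_distrib_mat[OF _ _ PQ(2)]) auto
    also have "P * 1\<^sub>m n * Q = 1\<^sub>m n" using PQ(1,3) by simp
    also have "P * (s \<cdot>\<^sub>m B) * Q = s \<cdot>\<^sub>m A"
      using mult_smult_distrib[OF PQ(1) B(1)] mult_smult_assoc_mat[OF sB(2) PQ(2)] PQ(5) by simp
    finally have "det (1\<^sub>m n - s \<cdot>\<^sub>m A) = det (P * ?T * Q)" by simp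
    also have "\<dots> = det P * det ?T * det Q" using PQ T by (simp add: det_mult[of _ n])
    also have "\<dots> = det ?T * (det P * det Q)" by simp
    also have "det P * det Q = 1" using det_mult[OF PQ(1,2)] PQ(3) by simp
    also have "det ?T * 1 = prod_list (diag_mat ?T)"
      using B det_upper_triangular[of ?T n] by (simp add: T upper_triangular_def)
    also have "\<dots> = (\<Prod>i<n. 1 - s * l i)"
      using B by (simp add: prod_list_diag_prod l_def lessThan_atLeast0)
    finally show ?thesis .
  qed
  moreover have "(\<Sum>i<n. (A ^\<^sub>m k) $$ (i, i)) = (\<Sum>i<n. l i ^ k)" for k
  proof -
    have Bk: "B ^\<^sub>m k \<in> carrier_mat n n" using B by simp
    have "A ^\<^sub>m k = P * (B ^\<^sub>m k * Q)"
      using similar_mat_wit_pow_id[OF wit, of k] PQ Bk by (simp add: assoc_mult_mat[of _ n n _ n _ n])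
    then have "(\<Sum>i<n. (A ^\<^sub>m k) $$ (i, i)) = (\<Sum>i<n. (B ^\<^sub>m k * Q * P) $$ (i, i))"
      using trace_comm[of P n "B ^\<^sub>m k * Q"] PQ Bk by simp
    also have "B ^\<^sub>m k * Q * P = B ^\<^sub>m k"
      using PQ(1,2,4) right_mult_one_mat[OF Bk] Bk by (simp add: assoc_mult_mat[of _ n n _ n _ n])
    finally show ?thesis using upper_triangular_pow[OF B(1,2)] by (simp add: l_def)
  qed
  ultimately show ?thesis by blast
qed

text \<open>Sum of the logarithm series of the factors. The term for \<open>k = 0\<close> is
  harmless, since division by zero yields zero.\<close>

lemma prod_exp_log:
  fixes l :: "nat \<Rightarrow> complex"
  assumes "\<And>i. i < n \<Longrightarrow> norm (s * l i) < 1"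
  shows "(\<Prod>i<n. 1 - s * l i) = exp (- (\<Sum>k. s ^ k * (\<Sum>i<n. l i ^ k) / of_nat k))"
proof -
  have ln: "(\<lambda>k. - ((s * l i) ^ k) / of_nat k) sums ln (1 - s * l i)" if "i < n" for i
    using Ln_series'[of "- (s * l i)"] assms[OF that] by simp
  have "(\<lambda>k. \<Sum>i<n. - ((s * l i) ^ k) / of_nat k) sums (\<Sum>i<n. ln (1 - s * l i))"
    by (rule sums_sum) (use ln in simp)
  moreover have "(\<lambda>k. \<Sum>i<n. - ((s * l i) ^ k) / of_nat k) = (\<lambda>k. - (s ^ k * (\<Sum>i<n. l i ^ k) / of_nat k))"
    by (rule ext) (simp add: sum_distrib_left power_mult_distrib sum_negf sum_divide_distrib)
  ultimately have "(\<lambda>k. s ^ k * (\<Sum>i<n. l i ^ k) / of_nat k) sums - (\<Sum>i<n. ln (1 - s * l i))"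
    using sums_minus by fastforce
  then have "exp (- (\<Sum>k. s ^ k * (\<Sum>i<n. l i ^ k) / of_nat k)) = exp (\<Sum>i<n. ln (1 - s * l i))"
    by (simp add: sums_iff)
  also have "\<dots> = (\<Prod>i<n. exp (ln (1 - s * l i)))" by (simp add: exp_sum)
  also have "\<dots> = (\<Prod>i<n. 1 - s * l i)"
  proof (rule prod.cong[OF refl])
    fix i assume "i \<in> {..<n}"
    then have "s * l i \<noteq> 1" using assms[of i] by auto
    then show "exp (ln (1 - s * l i)) = 1 - s * l i" by (intro exp_Ln) simp
  qed
  finally show ?thesis by simp
qed

text \<open>The exponential formula holds near \<open>0\<close> by the eigenvalue expansion; absolute summability of the
  traces alone carries it to the unit disc and, by continuity, to the boundary point \<open>1\<close>.\<close>

theorem det_one_minus_exp: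
  assumes "finite V" and summ: "summable (\<lambda>k. norm (\<Sum>v\<in>V. mpow V M k v v) / real k)"
  shows "det_one_minus V M = exp (- (\<Sum>k. (\<Sum>v\<in>V. mpow V M k v v) / of_nat k))"
proof -
  define N where "N = card V"
  obtain e where e: "bij_betw e {0..<N} V" using ex_bij_betw_nat_finite[OF assms(1)] by (auto simp: N_def)
  define A where "A = mat N N (\<lambda>(i, j). M (e i) (e j))"
  have A: "A \<in> carrier_mat N N" by (simp add: A_def)
  obtain l where l: "\<And>s. det (1\<^sub>m N - s \<cdot>\<^sub>m A) = (\<Prod>i<N. 1 - s * l i)"
     "\<And>k. (\<Sum>i<N. (A ^\<^sub>m k) $$ (i, i)) = (\<Sum>i<N. l i ^ k)"
    using eigenvalue_sums[OF A] by blast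
  define \<tau> where "\<tau> k = (\<Sum>v\<in>V. mpow V M k v v)" for k
  have \<tau>: "\<tau> k = (\<Sum>i<N. l i ^ k)" for k
  proof -
    have "\<tau> k = (\<Sum>i\<in>{0..<N}. mpow V M k (e i) (e i))"
      unfolding \<tau>_def by (rule sum.reindex_bij_betw[OF e, symmetric])
    also have "\<dots> = (\<Sum>i<N. (A ^\<^sub>m k) $$ (i, i))"
      unfolding A_def lessThan_atLeast0 using mpow_eq_pow_mat[OF e] by (intro sum.cong) auto
    finally show ?thesis using l(2) by simp
  qed
  define L where "L s = (\<Sum>k. s ^ k * \<tau> k / of_nat k)" for s :: complex
  define d where "d s = (\<Prod>i<N. 1 - s * l i)" for s
  have bound: "norm (s ^ k * \<tau> k / of_nat k) \<le> norm (\<tau> k) / real k" if "norm s \<le> 1" for s k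
    using that by (simp add: norm_mult norm_divide norm_power divide_right_mono mult_left_le_one_le power_le_one)
  have summ': "summable (\<lambda>k. norm (\<tau> k) / real k)" using summ by (simp add: \<tau>_def)
  have ul: "uniform_limit (cball 0 1) (\<lambda>n s. \<Sum>k<n. s ^ k * \<tau> k / of_nat k) (\<lambda>s. \<Sum>k. s ^ k * \<tau> k / of_nat k) sequentially"
    by (rule Weierstrass_m_test[OF _ summ']) (use bound in auto)
  have "continuous_on (cball 0 1) (\<lambda>s. \<Sum>k<n. s ^ k * \<tau> k / of_nat k)" for n
    unfolding times_divide_eq_right[symmetric] by (intro continuous_intros)
  then have contL: "continuous_on (cball 0 1) L"
    unfolding L_def by (intro uniform_limit_theorem[OF _ ul] always_eventually) auto
  have holL: "L holomorphic_on ball 0 1"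
  proof (rule power_series_holomorphic[where a = "\<lambda>k. \<tau> k / of_nat k"])
    fix w :: complex assume "w \<in> ball 0 1"
    then have "summable (\<lambda>k. w ^ k * \<tau> k / of_nat k)"
      using bound[of w] by (intro summable_comparison_test'[OF summ', of 0]) auto
    then show "(\<lambda>k. \<tau> k / of_nat k * (w - 0) ^ k) sums L w"
      by (simp add: L_def summable_sums_iff mult.commute)
  qed
  \<comment> \<open>Chosen so that \<open>r\<close> times the sum of all \<open>norm (l i)\<close>
    is below 1; then every factor lies in the domain of the logarithm series.\<close>
  define r where "r = 1 / (1 + (\<Sum>i<N. norm (l i)))"
  have S0: "(\<Sum>i<N. norm (l i)) \<ge> 0" by (simp add: sum_nonneg)
  have r: "0 < r" "r \<le> 1" using S0 by (auto simp: r_def)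
  have near: "d s = exp (- L s)" if s: "s \<in> ball 0 r" for s
  proof -
    have "norm (s * l i) < 1" if i: "i < N" for i
    proof -
      have "norm (l i) \<le> (\<Sum>i<N. norm (l i))" using i by (intro member_le_sum) auto
      then have "norm s * norm (l i) \<le> norm s * (\<Sum>i<N. norm (l i))" by (intro mult_left_mono) auto
      also have "\<dots> \<le> r * (\<Sum>i<N. norm (l i))" using s S0 by (intro mult_right_mono) auto
      also have "\<dots> < 1" using S0 by (simp add: r_def field_simps)
      finally show ?thesis by (simp add: norm_mult)
    qed
    then show ?thesis unfolding d_def L_def \<tau> by (rule prod_exp_log)
  qed
  have disc: "d s - exp (- L s) = 0" if "s \<in> ball 0 1" for s
  proof (rule analytic_continuation[where f = "\<lambda>s. d s - exp (- L s)" and U = "ball 0 r" and S = "ball 0 1" and \<xi> = 0])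
    show "(\<lambda>s. d s - exp (- L s)) holomorphic_on ball 0 1"
      unfolding d_def by (intro holomorphic_intros holL)
    show "ball 0 r \<subseteq> ball (0::complex) 1" using r by (intro subset_ball)
    show "(0::complex) islimpt ball 0 r" using r by (intro interior_limit_point) (simp add: interior_open)
  qed (use near that r in auto)
  have "d 1 - exp (- L 1) = 0"
  proof (rule continuous_constant_on_closure[where S = "ball (0::complex) 1" and f = "\<lambda>s. d s - exp (- L s)"])
    show "continuous_on (closure (ball 0 1)) (\<lambda>s. d s - exp (- L s))"
      unfolding d_def using contL by (simp add: closure_ball) (intro continuous_intros; simp)
  qed (use disc in auto)
  moreover have "det_one_minus V M = d 1"
  proof -
    have "1 \<cdot>\<^sub>m A = A" by (rule eq_matI) auto
    then show ?thesis using det_one_minus_eq_det[OF e, of M] l(1)[of 1] by (simp add: A_def d_def)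
  qed
  moreover have "L 1 = (\<Sum>k. (\<Sum>v\<in>V. mpow V M k v v) / of_nat k)" by (simp add: L_def \<tau>_def)
  ultimately show ?thesis by simp
qed

section \<open>Weighted graphs: traces as sums over fixed points\<close>

definition wmat :: "('v,'e) graph \<Rightarrow> ('e \<Rightarrow> complex) \<Rightarrow> 'v \<Rightarrow> 'v \<Rightarrow> complex" where
  "wmat G c v w = (\<Sum>e | e \<in> edges G \<and> src G e = v \<and> rng G e = w. c e)"

lemma mpow_wmat:
  assumes G: "finite_graph G" and w: "w \<in> verts G"
  shows "mpow (verts G) (wmat G c) n v w = (\<Sum>\<alpha> | length \<alpha> = n \<and> fpath G v \<alpha> w. prod_list (map c \<alpha>))"
  using w
proof (induction n arbitrary: w)
  case 0
  have "{\<alpha>. length \<alpha> = 0 \<and> fpath G v \<alpha> w} = (if v = w then {[]} else {})" by auto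
  then show ?case by simp
next
  case (Suc n)
  have fin: "finite (verts G)" "finite (edges G)" using G by (auto simp: finite_graph_def)
  have finP: "finite {\<alpha>. length \<alpha> = n \<and> fpath G v \<alpha> u}" for u
    by (rule finite_subset[OF _ finite_fpaths[OF fin(2), of n]]) auto
  let ?T = "SIGMA u:verts G. {\<alpha>. length \<alpha> = n \<and> fpath G v \<alpha> u} \<times> {e \<in> edges G. src G e = u \<and> rng G e = w}"
  have "mpow (verts G) (wmat G c) (Suc n) v w =
    (\<Sum>u\<in>verts G. \<Sum>(\<alpha>, e)\<in>{\<alpha>. length \<alpha> = n \<and> fpath G v \<alpha> u} \<times> {e \<in> edges G. src G e = u \<and> rng G e = w}.
       prod_list (map c \<alpha>) * c e)"
    unfolding mpow.simps
  proof (rule sum.cong[OF refl])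
    fix u assume "u \<in> verts G"
    then show "mpow (verts G) (wmat G c) n v u * wmat G c u w =
      (\<Sum>(\<alpha>, e)\<in>{\<alpha>. length \<alpha> = n \<and> fpath G v \<alpha> u} \<times> {e \<in> edges G. src G e = u \<and> rng G e = w}.
         prod_list (map c \<alpha>) * c e)"
      unfolding Suc.IH[OF \<open>u \<in> verts G\<close>] wmat_def by (simp add: sum_product sum.cartesian_product)
  qed
  also have "\<dots> = (\<Sum>(u, \<alpha>, e)\<in>?T. prod_list (map c \<alpha>) * c e)"
    using fin finP by (subst sum.Sigma) auto
  also have "\<dots> = (\<Sum>\<alpha> | length \<alpha> = Suc n \<and> fpath G v \<alpha> w. prod_list (map c \<alpha>))"
  proof (rule sum.reindex_bij_witness[of _ "\<lambda>\<alpha>. (src G (last \<alpha>), butlast \<alpha>, last \<alpha>)" "\<lambda>(u, \<alpha>, e). \<alpha> @ [e]"])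
    fix \<alpha> assume "\<alpha> \<in> {\<alpha>. length \<alpha> = Suc n \<and> fpath G v \<alpha> w}"
    then have \<alpha>: "length \<alpha> = Suc n" "fpath G v \<alpha> w" "\<alpha> \<noteq> []" by auto
    show "(\<lambda>(u, \<alpha>, e). \<alpha> @ [e]) (src G (last \<alpha>), butlast \<alpha>, last \<alpha>) = \<alpha>" using \<alpha>(3) by simp
    have "fpath G v (butlast \<alpha> @ [last \<alpha>]) w" using \<alpha> by simp
    then obtain u where "fpath G v (butlast \<alpha>) u" "fpath G u [last \<alpha>] w" unfolding fpath_append by blast
    then show "(src G (last \<alpha>), butlast \<alpha>, last \<alpha>) \<in> ?T" using \<alpha> G by (auto simp: finite_graph_def)
  qed (auto simp: fpath_append)
  finally show ?case .
qed

text \<open>A cycle is a constant sequence of blocks, so the block construction of aperiodic paths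
  applies here as well.\<close>

lemma cycle_ipaths:
  assumes "fpath G v \<alpha> v" "\<alpha> \<noteq> []"
  shows "cycle \<alpha> \<in> ipaths G \<and> source G (cycle \<alpha>) = v"
proof -
  let ?f = "flat (smap (\<lambda>b::bool. \<alpha>) (sconst True))"
  have "?f = \<alpha> @- ?f" using flat_unfold[of "smap (\<lambda>b::bool. \<alpha>) (sconst True)"] assms(2) by simp
  then have "?f = cycle \<alpha>" using shift_fix_unique[of ?f \<alpha> "cycle \<alpha>"] cycle_decomp assms(2) by blast
  then show ?thesis using flat_blocks_ipaths[of "\<lambda>b. \<alpha>" G v "sconst True"] assms by simp
qed

text \<open>The trace sums over closed paths of length \<open>n\<close>; repeating such a path and
  cutting off a prefix of length \<open>n\<close> are inverse to each other.\<close>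

lemma trace_wmat:
  assumes G: "finite_graph G" and n: "n > 0"
  shows "(\<Sum>v\<in>verts G. mpow (verts G) (wmat G c) n v v) = (\<Sum>x\<in>fixpts G n. prod_list (map c (stake n x)))"
proof -
  have fin: "finite (verts G)" "finite (edges G)" using G by (auto simp: finite_graph_def)
  have finP: "finite {\<alpha>. length \<alpha> = n \<and> fpath G v \<alpha> v}" for v
    by (rule finite_subset[OF _ finite_fpaths[OF fin(2), of n]]) auto
  have "(\<Sum>v\<in>verts G. mpow (verts G) (wmat G c) n v v) =
    (\<Sum>(v, \<alpha>)\<in>(SIGMA v:verts G. {\<alpha>. length \<alpha> = n \<and> fpath G v \<alpha> v}). prod_list (map c \<alpha>))"
    using fin finP by (simp add: mpow_wmat[OF G] sum.Sigma)
  also have "\<dots> = (\<Sum>x\<in>fixpts G n. prod_list (map c (stake n x)))"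
  proof (rule sum.reindex_bij_witness[of _ "\<lambda>x. (source G x, stake n x)" "\<lambda>(v, \<alpha>). cycle \<alpha>"])
    fix a assume "a \<in> (SIGMA v:verts G. {\<alpha>. length \<alpha> = n \<and> fpath G v \<alpha> v})"
    then obtain v \<alpha> where a: "a = (v, \<alpha>)" "length \<alpha> = n" "fpath G v \<alpha> v" "\<alpha> \<noteq> []" using n by auto
    have s: "stake n (cycle \<alpha>) = \<alpha>" "sdrop n (cycle \<alpha>) = cycle \<alpha>"
      using a(2,4) stake_cycle_eq sdrop_cycle_eq by metis+
    show "(\<lambda>x. (source G x, stake n x)) ((\<lambda>(v, \<alpha>). cycle \<alpha>) a) = a"
      using cycle_ipaths[OF a(3,4)] s a(1) by simp
    show "(\<lambda>(v, \<alpha>). cycle \<alpha>) a \<in> fixpts G n"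
      using cycle_ipaths[OF a(3,4)] s a(1) by (simp add: fixpts_def)
    show "prod_list (map c (stake n ((\<lambda>(v, \<alpha>). cycle \<alpha>) a))) = (\<lambda>(v, \<alpha>). prod_list (map c \<alpha>)) a"
      using s a(1) by simp
  next
    fix x assume x: "x \<in> fixpts G n"
    then have xi: "x \<in> ipaths G" "sdrop n x = x" by (auto simp: fixpts_def)
    show "(\<lambda>(v, \<alpha>). cycle \<alpha>) (source G x, stake n x) = x" using periodic_eq_cycle[OF xi(2) n] by simp
    show "(source G x, stake n x) \<in> (SIGMA v:verts G. {\<alpha>. length \<alpha> = n \<and> fpath G v \<alpha> v})"
      using fpath_stake[OF xi(1), of n] xi source_in_verts[OF G xi(1)] by simp
  qed
  finally show ?thesis .
qed

definition wdet :: "('v,'e) graph \<Rightarrow> ('e \<Rightarrow> int) \<Rightarrow> complex \<Rightarrow> complex" where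
  "wdet G k s = det_one_minus (verts G) (wmat G (\<lambda>e. s powi k e))"

lemma prod_list_powi:
  fixes s :: "'a::field"
  assumes "s \<noteq> 0"
  shows "prod_list (map (\<lambda>e. s powi k e) (stake n x)) = s powi (\<Sum>i<n. k (x !! i))"
  by (induction n) (simp_all add: stake_Suc power_int_add assms del: stake.simps(2))

text \<open>For positive \<open>s\<close> all weights are positive, so the traces are nonnegative
  and the given sum already provides the absolute summability required by
  \<open>det_one_minus_exp\<close>. Smallness of \<open>s\<close> is not asked for; it would not
  help with negative exponents.\<close>

lemma wdet_exp:
  fixes s :: real
  assumes G: "finite_graph G" and s: "s > 0"
    and S: "((\<lambda>n. \<Sum>x\<in>fixpts G n. s powi (\<Sum>i<n. k (x !! i)) / n) has_sum S) {1..}"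
  shows "wdet G k (of_real s) = exp (- of_real S)"
proof -
  define \<tau> where "\<tau> n = (\<Sum>x\<in>fixpts G n. s powi (\<Sum>i<n. k (x !! i)))" for n
  let ?t = "\<lambda>n. \<Sum>v\<in>verts G. mpow (verts G) (wmat G (\<lambda>e. of_real s powi k e)) n v v"
  have t: "?t n / of_nat n = complex_of_real (\<tau> n / n)" for n
  proof (cases "n > 0")
    case True
    have "?t n = (\<Sum>x\<in>fixpts G n. complex_of_real (s powi (\<Sum>i<n. k (x !! i))))"
      using s by (simp add: trace_wmat[OF G True] prod_list_powi)
    then show ?thesis by (simp add: \<tau>_def)
  qed simp
  have "((\<lambda>n. \<tau> n / n) has_sum S) {1..}"
    using S by (simp add: \<tau>_def sum_divide_distrib)
  \<comment> \<open>The added term \<open>n = 0\<close> vanishes because of the division by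
    zero.\<close>
  also have "?this \<longleftrightarrow> ((\<lambda>n. \<tau> n / n) has_sum S) UNIV"
    by (rule has_sum_cong_neutral) auto
  finally have sums: "(\<lambda>n. \<tau> n / n) sums S" by (rule has_sum_imp_sums)
  have nonneg: "\<tau> n \<ge> 0" for n using s by (auto simp: \<tau>_def intro!: sum_nonneg)
  have "norm (?t n) / real n = \<tau> n / n" for n
  proof -
    have "norm (?t n) / real n = norm (?t n / of_nat n)" by (simp add: norm_divide)
    also have "\<dots> = \<tau> n / n" unfolding t norm_of_real using nonneg[of n] by simp
    finally show ?thesis .
  qed
  then have "summable (\<lambda>n. norm (?t n) / real n)" using sums_summable[OF sums] by presburger
  then have "wdet G k (of_real s) = exp (- (\<Sum>n. ?t n / of_nat n))"
    unfolding wdet_def using G by (intro det_one_minus_exp) (auto simp: finite_graph_def)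
  also have "(\<lambda>n. ?t n / of_nat n) = (\<lambda>n. complex_of_real (\<tau> n / n))" using t by blast
  also have "(\<Sum>n. complex_of_real (\<tau> n / n)) = of_real S"
    using sums_of_real[OF sums, where 'a = complex] by (simp add: sums_iff)
  finally show ?thesis .
qed

section \<open>Analytic continuation in the weight parameter\<close>

lemma wdet_holomorphic:
  shows "wdet G k holomorphic_on {s. Re s > 0}"
proof -
  have "(\<lambda>s. of_int (sign p) * (\<Prod>v\<in>verts G. (if p v = v then 1 else 0) - wmat G (\<lambda>e. s powi k e) v (p v)))
     holomorphic_on {s. Re s > 0}" for p
    unfolding wmat_def by (intro holomorphic_intros) auto
  then show ?thesis unfolding wdet_def[abs_def] det_one_minus_def by (rule holomorphic_on_sum)
qed

text \<open>Negative exponents exclude the origin. The right half-plane avoids it, is connected and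
  contains 1 as well as the small positive reals, which accumulate at its interior point
  \<open>\<delta> / 2\<close>.\<close>

lemma half_plane_identity:
  assumes "f holomorphic_on {s. Re s > 0}" "g holomorphic_on {s. Re s > 0}" "\<delta> > 0"
    and eq: "\<And>s. 0 < s \<Longrightarrow> s < \<delta> \<Longrightarrow> f (of_real s) = g (of_real s)"
  shows "f 1 = g 1"
proof -
  define U where "U = complex_of_real ` {0<..<\<delta>}"
  have "f 1 - g 1 = 0"
  proof (rule analytic_continuation[where f = "\<lambda>s. f s - g s" and U = U and S = "{s. Re s > 0}" and \<xi> = "of_real (\<delta> / 2)"])
    show "(\<lambda>s. f s - g s) holomorphic_on {s. Re s > 0}" using assms by (intro holomorphic_intros)
    show "open {s. Re s > 0}" by (rule open_halfspace_Re_gt)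
    show "connected {s. Re s > 0}" by (intro convex_connected convex_halfspace_Re_gt)
    show "complex_of_real (\<delta> / 2) islimpt U"
      unfolding islimpt_approachable
    proof (intro allI impI)
      fix e :: real assume e: "e > 0"
      define h where "h = min (e / 2) (\<delta> / 4)"
      have h: "h > 0" "h < e" "h < \<delta> / 2" using e assms(3) by (auto simp: h_def min_def)
      have "dist (complex_of_real (\<delta> / 2 + h)) (complex_of_real (\<delta> / 2)) = \<bar>h\<bar>"
        unfolding dist_norm of_real_diff[symmetric] norm_of_real by simp
      moreover have "complex_of_real (\<delta> / 2 + h) \<in> U" unfolding U_def using h assms(3) by (intro imageI) auto
      moreover have "complex_of_real (\<delta> / 2 + h) \<noteq> complex_of_real (\<delta> / 2)" using h by (simp only: of_real_eq_iff)
      ultimately show "\<exists>x'\<in>U. x' \<noteq> complex_of_real (\<delta> / 2) \<and> dist x' (complex_of_real (\<delta> / 2)) < e"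
        using h by (intro bexI[of _ "complex_of_real (\<delta> / 2 + h)"]) auto
    qed
  qed (use assms(3) eq in \<open>auto simp: U_def\<close>)
  then show ?thesis by simp
qed

lemma wdet_one: "wdet G k 1 = of_int (det_I_minus_adj G)"
proof -
  have "wmat G (\<lambda>e. 1 powi k e) v w = of_int (adj G v w)" for v w
    by (simp add: wmat_def adj_def)
  then show ?thesis
    unfolding wdet_def det_one_minus_def det_I_minus_adj_def
    by (simp del: power_int_1_left) (intro sum.cong arg_cong2[of _ _ _ _ "(*)"] prod.cong refl; simp)
qed

text \<open>There are at most \<open>card (edges G) ^ n\<close> fixed points of the
  \<open>n\<close>-th shift, so a geometric series dominates.\<close>

lemma fixpts_has_sum_small:
  assumes G: "finite_graph G"
  shows "\<exists>\<delta>>0. \<forall>s. 0 < s \<and> s < \<delta> \<longrightarrow>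
    (\<exists>S::real. ((\<lambda>n. \<Sum>x\<in>fixpts G n. s ^ n / n) has_sum S) {1..})"
proof -
  have fin: "finite (edges G)" using G by (auto simp: finite_graph_def)
  \<comment> \<open>The summand 1 keeps \<open>C\<close> positive for a graph without edges.\<close>
  define C where "C = 1 + real (card (edges G))"
  have C: "C > 0" by (simp add: C_def)
  have card: "real (card (fixpts G n)) \<le> C ^ n" if "n > 0" for n
  proof -
    have "card (fixpts G n) \<le> card {\<alpha>. set \<alpha> \<subseteq> edges G \<and> length \<alpha> = n}"
    proof (rule card_inj_on_le[of "stake n"])
      show "inj_on (stake n) (fixpts G n)"
        by (rule inj_onI) (metis (mono_tags, lifting) fixpts_def mem_Collect_eq periodic_eq_cycle that)
      show "stake n ` fixpts G n \<subseteq> {\<alpha>. set \<alpha> \<subseteq> edges G \<and> length \<alpha> = n}"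
        using fpath_set[OF fpath_stake[of _ G n]] by (auto simp: fixpts_def)
      show "finite {\<alpha>. set \<alpha> \<subseteq> edges G \<and> length \<alpha> = n}" using finite_lists_length_eq[OF fin] .
    qed
    also have "\<dots> = card (edges G) ^ n" by (rule card_lists_length_eq[OF fin])
    finally have "real (card (fixpts G n)) \<le> real (card (edges G)) ^ n" by (simp flip: of_nat_power)
    also have "\<dots> \<le> C ^ n" by (rule power_mono) (auto simp: C_def)
    finally show ?thesis .
  qed
  show ?thesis
  proof (rule exI[of _ "1 / C"], intro conjI allI impI)
    fix s :: real assume "0 < s \<and> s < 1 / C"
    then have s: "0 < s" "s * C < 1" using C by (auto simp: field_simps)
    have "summable (\<lambda>n. (s * C) ^ n)" using s C by (intro summable_geometric) (auto simp: abs_mult)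
    then have "summable (\<lambda>n. \<Sum>x\<in>fixpts G n. s ^ n / n)"
    proof (rule summable_comparison_test'[where N = 1])
      fix n :: nat assume n: "n \<ge> 1"
      have "(\<Sum>x\<in>fixpts G n. s ^ n / n) = real (card (fixpts G n)) * s ^ n / n" by simp
      also have "\<dots> \<le> real (card (fixpts G n)) * s ^ n" 
        using n s mult_left_mono[of 1 "real n" "real (card (fixpts G n)) * s ^ n"] by (simp add: divide_le_eq)
      also have "\<dots> \<le> C ^ n * s ^ n" using card[of n] n s by (intro mult_right_mono) auto
      finally have "(\<Sum>x\<in>fixpts G n. s ^ n / n) \<le> (s * C) ^ n" by (simp add: power_mult_distrib mult.commute)
      moreover have "(\<Sum>x\<in>fixpts G n. s ^ n / n) \<ge> 0" using s by (intro sum_nonneg) auto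
      ultimately show "norm (\<Sum>x\<in>fixpts G n. s ^ n / n) \<le> (s * C) ^ n" by simp
    qed
    then have "(\<lambda>n. \<Sum>x\<in>fixpts G n. s ^ n / n) summable_on UNIV"
      using s by (intro summable_nonneg_imp_summable_on sum_nonneg) auto
    then have "(\<lambda>n. \<Sum>x\<in>fixpts G n. s ^ n / n) summable_on {1..}" by (rule summable_on_subset) simp
    then show "\<exists>S. ((\<lambda>n. \<Sum>x\<in>fixpts G n. s ^ n / n) has_sum S) {1..}" by (simp add: summable_on_def)
  qed (use C in simp)
qed

section \<open>Higher block graphs, where a function of \<open>K + 1\<close> consecutive edges
  becomes a weight of a single edge\<close>

definition block_graph :: "nat \<Rightarrow> ('v,'e) graph \<Rightarrow> ('e list, 'e list) graph" where
  "block_graph K G = \<lparr>verts = {\<alpha>. length \<alpha> = K \<and> (\<exists>v w. fpath G v \<alpha> w)},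
     edges = {\<alpha>. length \<alpha> = Suc K \<and> (\<exists>v w. fpath G v \<alpha> w)}, src = butlast, rng = tl\<rparr>"

lemma block_graph_simps [simp]:
  "verts (block_graph K G) = {\<alpha>. length \<alpha> = K \<and> (\<exists>v w. fpath G v \<alpha> w)}"
  "edges (block_graph K G) = {\<alpha>. length \<alpha> = Suc K \<and> (\<exists>v w. fpath G v \<alpha> w)}"
  "src (block_graph K G) = butlast" "rng (block_graph K G) = tl"
  by (simp_all add: block_graph_def)

lemma finite_block_graph:
  assumes "finite_graph G"
  shows "finite_graph (block_graph K G)"
proof -
  have "finite (edges G)" using assms by (simp add: finite_graph_def)
  moreover have "\<exists>v w. fpath G v (butlast \<alpha>) w" "\<exists>v w. fpath G v (tl \<alpha>) w"
    if "length \<alpha> = Suc K" "fpath G v \<alpha> w" for \<alpha> v w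
  proof -
    have "\<alpha> = butlast \<alpha> @ [last \<alpha>]" "\<alpha> = [hd \<alpha>] @ tl \<alpha>" using that by (cases \<alpha>; simp)+
    then show "\<exists>v w. fpath G v (butlast \<alpha>) w" "\<exists>v w. fpath G v (tl \<alpha>) w"
      using that(2) fpath_append by metis+
  qed
  ultimately show ?thesis
    unfolding finite_graph_def by (auto simp: finite_fpaths)
qed

definition block_path :: "nat \<Rightarrow> 'e stream \<Rightarrow> 'e list stream" where
  "block_path K x = smap (\<lambda>i. stake (Suc K) (sdrop i x)) nats"

lemma block_path_snth [simp]: "block_path K x !! i = stake (Suc K) (sdrop i x)"
  by (simp add: block_path_def del: stake.simps)

lemma block_path_ipaths:
  assumes "x \<in> ipaths G"
  shows "block_path K x \<in> ipaths (block_graph K G)"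
  unfolding ipaths_def
proof (intro CollectI allI conjI)
  fix n
  show "block_path K x !! n \<in> edges (block_graph K G)"
    using fpath_stake[OF ipaths_sdrop[OF assms, of n], of "Suc K"] by (auto simp del: stake.simps)
  have "tl (stake (Suc K) (sdrop n x)) = stake K (sdrop (Suc n) x)" by simp
  moreover have "butlast (stake (Suc K) (sdrop (Suc n) x)) = stake K (sdrop (Suc n) x)"
    by (simp add: stake_Suc del: stake.simps)
  ultimately show "rng (block_graph K G) (block_path K x !! n) = src (block_graph K G) (block_path K x !! Suc n)"
    by (simp del: stake.simps sdrop.simps snth.simps)
qed

lemma sdrop_block_path: "sdrop n (block_path K x) = block_path K (sdrop n x)"
  by (rule stream_eqI) (simp add: sdrop_snth del: stake.simps)

lemma hd_block_path [simp]: "smap hd (block_path K x) = x"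
  by (rule stream_eqI) simp

text \<open>Consecutive blocks overlap in \<open>K\<close> letters, so the first letters determine
  everything. With \<open>K = 0\<close> there would be no overlap to enforce that consecutive edges
  are composable.\<close>

lemma block_path_hd:
  assumes y: "y \<in> ipaths (block_graph K G)" and K: "K > 0"
  shows "smap hd y \<in> ipaths G" "block_path K (smap hd y) = y"
proof -
  have e: "length (y !! i) = Suc K" "\<exists>v w. fpath G v (y !! i) w" "tl (y !! i) = butlast (y !! Suc i)" for i
    using y by (auto simp: ipaths_def)
  \<comment> \<open>Letter \<open>j\<close> of a block is the first letter of the block
    \<open>j\<close> positions later, because each step drops one letter in front.\<close>
  have shift: "y !! (i + j) ! 0 = y !! i ! j" if "j \<le> K" for i j
    using that
  proof (induction j arbitrary: i)
    case (Suc j)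
    have "y !! (i + Suc j) ! 0 = y !! Suc i ! j" using Suc.IH[of "Suc i"] Suc.prems by simp
    also have "\<dots> = butlast (y !! Suc i) ! j" using Suc.prems e(1)[of "Suc i"] by (simp add: nth_butlast)
    also have "\<dots> = tl (y !! i) ! j" using e(3)[of i] by simp
    also have "\<dots> = y !! i ! Suc j" using Suc.prems e(1)[of i] by (simp add: nth_tl)
    finally show ?case .
  qed simp
  have hd: "hd (y !! i) = y !! i ! 0" for i using e(1)[of i] by (cases "y !! i") auto
  show "block_path K (smap hd y) = y"
  proof (rule stream_eqI, rule nth_equalityI)
    fix n j assume "j < length (block_path K (smap hd y) !! n)"
    then have "j \<le> K" by (simp del: stake.simps)
    then show "block_path K (smap hd y) !! n ! j = y !! n ! j"
      using shift[of j n] by (simp add: sdrop_snth hd del: stake.simps)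
  qed (simp add: e(1) del: stake.simps)
  show "smap hd y \<in> ipaths G"
    unfolding ipaths_def
  proof (intro CollectI allI conjI)
    fix n
    obtain v w where p: "fpath G v (y !! n) w" using e(2) by blast
    obtain a b \<gamma> where ab: "y !! n = a # b # \<gamma>"
      using e(1)[of n] K by (cases "y !! n"; cases "tl (y !! n)") auto
    have "y !! Suc n ! 0 = b" using shift[of 1 n] K ab by simp
    then show "smap hd y !! n \<in> edges G" "rng G (smap hd y !! n) = src G (smap hd y !! Suc n)"
      using p ab hd[of "Suc n"] by auto
  qed
qed

lemma sum_fixpts_block_graph:
  assumes "K > 0"
  shows "(\<Sum>y\<in>fixpts (block_graph K G) n. \<phi> y) = (\<Sum>x\<in>fixpts G n. \<phi> (block_path K x))"
proof (rule sum.reindex_bij_witness[of _ "block_path K" "smap hd"])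
  fix y assume y: "y \<in> fixpts (block_graph K G) n"
  then show eq: "block_path K (smap hd y) = y"
    using block_path_hd(2)[OF _ assms, of y G] by (simp add: fixpts_def)
  show "\<phi> (block_path K (smap hd y)) = \<phi> y" unfolding eq ..
  show "smap hd y \<in> fixpts G n" using y block_path_hd(1)[OF _ assms] by (auto simp: fixpts_def)
next
  fix x assume "x \<in> fixpts G n"
  then show "block_path K x \<in> fixpts (block_graph K G) n"
    using block_path_ipaths by (auto simp: fixpts_def sdrop_block_path)
qed simp

text \<open>At 1 all weights are 1, so both exponents may be replaced by the constant 1. Block graph
  and graph have matching fixed points for every \<open>n\<close>, hence equal determinants for
  small \<open>s\<close>, and continuation reaches 1.\<close>

lemma det_block_graph:
  assumes G: "finite_graph G" and K: "K > 0"
  shows "wdet (block_graph K G) k 1 = wdet G k' 1"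
proof -
  obtain \<delta> where \<delta>: "\<delta> > 0" "\<And>s. 0 < s \<Longrightarrow> s < \<delta> \<Longrightarrow> \<exists>S::real. ((\<lambda>n. \<Sum>x\<in>fixpts G n. s ^ n / n) has_sum S) {1..}"
    using fixpts_has_sum_small[OF G] by blast
  have "wdet (block_graph K G) (\<lambda>_. 1) 1 = wdet G (\<lambda>_. 1) 1"
  proof (rule half_plane_identity[OF wdet_holomorphic wdet_holomorphic \<delta>(1)])
    fix s :: real assume s: "0 < s" "s < \<delta>"
    obtain S where S: "((\<lambda>n. \<Sum>x\<in>fixpts G n. s ^ n / n) has_sum S) {1..}" using \<delta>(2)[OF s] by blast
    have "wdet G (\<lambda>_. 1) (of_real s) = exp (- of_real S)"
      by (rule wdet_exp[OF G s(1)]) (use S in \<open>simp add: power_int_of_nat\<close>)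
    moreover have "wdet (block_graph K G) (\<lambda>_. 1) (of_real s) = exp (- of_real S)"
      by (rule wdet_exp[OF finite_block_graph[OF G] s(1)])
         (use S in \<open>simp only: sum_fixpts_block_graph[OF K], simp add: power_int_of_nat\<close>)
    ultimately show "wdet (block_graph K G) (\<lambda>_. 1) (of_real s) = wdet G (\<lambda>_. 1) (of_real s)" by simp
  qed
  then show ?thesis by (simp add: wdet_one)
qed

theorem (in coe) det_eq: "det_I_minus_adj E = det_I_minus_adj F"
proof -
  obtain M where M: "\<And>x x'. x \<in> ipaths E \<Longrightarrow> x' \<in> ipaths E \<Longrightarrow> stake M x = stake M x' \<Longrightarrow> lag x = lag x'"
    using lag_locally_constant by blast
  \<comment> \<open>The block length \<open>Suc M\<close> is positive, as the block lemmas require,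
    and an edge, having \<open>M + 2\<close> letters, contains the \<open>M\<close> letters that
    determine the lag.\<close>
  let ?B = "block_graph (Suc M) E"
  \<comment> \<open>The lag of an arbitrary path through the block; by the choice of
    \<open>M\<close> all paths of \<open>E\<close> starting with the same block have the same
    lag.\<close>
  define k where "k \<alpha> = lag (SOME x. x \<in> ipaths E \<and> stake (Suc (Suc M)) x = \<alpha>)" for \<alpha>
  have k: "k (stake (Suc (Suc M)) x) = lag x" if "x \<in> ipaths E" for x
  proof -
    let ?x = "SOME x'. x' \<in> ipaths E \<and> stake (Suc (Suc M)) x' = stake (Suc (Suc M)) x"
    have x': "?x \<in> ipaths E \<and> stake (Suc (Suc M)) ?x = stake (Suc (Suc M)) x"
      by (rule someI[of _ x]) (use that in simp)
    have "stake M ?x = stake M x" by (rule stake_le[OF conjunct2[OF x']]) simp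
    then show ?thesis unfolding k_def by (rule M[OF conjunct1[OF x'] that])
  qed
  obtain \<delta> where \<delta>: "\<delta> > 0" "\<And>s. 0 < s \<Longrightarrow> s < \<delta> \<Longrightarrow> \<exists>S::real. ((\<lambda>n. \<Sum>x\<in>fixpts F n. s ^ n / n) has_sum S) {1..}"
    using fixpts_has_sum_small[OF F.fin] by blast
  have "wdet ?B k 1 = wdet F (\<lambda>_. 1) 1"
  proof (rule half_plane_identity[OF wdet_holomorphic wdet_holomorphic \<delta>(1)])
    fix s :: real assume s: "0 < s" "s < \<delta>"
    obtain S where S: "((\<lambda>n. \<Sum>x\<in>fixpts F n. s ^ n / n) has_sum S) {1..}" using \<delta>(2)[OF s] by blast
    have "wdet F (\<lambda>_. 1) (of_real s) = exp (- of_real S)"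
      by (rule wdet_exp[OF F.fin s(1)]) (use S in \<open>simp add: power_int_of_nat\<close>)
    moreover have "wdet ?B k (of_real s) = exp (- of_real S)"
    proof (rule wdet_exp[OF finite_block_graph[OF E.fin] s(1)])
      have "(\<Sum>x\<in>fixpts E n. s powi (\<Sum>i<n. k (block_path (Suc M) x !! i)) / n) =
         (\<Sum>x\<in>fixpts E n. s powi fsum lag n x / n)" for n
      proof (rule sum.cong[OF refl])
        fix x assume "x \<in> fixpts E n"
        then have "x \<in> ipaths E" by (simp add: fixpts_def)
        then have "k (block_path (Suc M) x !! i) = lag (sdrop i x)" for i
          unfolding block_path_snth by (intro k ipaths_sdrop)
        then show "s powi (\<Sum>i<n. k (block_path (Suc M) x !! i)) / n = s powi fsum lag n x / n"
          by (simp add: fsum_def)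
      qed
      then show "((\<lambda>n. \<Sum>y\<in>fixpts ?B n. s powi (\<Sum>i<n. k (y !! i)) / real n) has_sum S) {1..}"
        using fixpts_sums[OF s(1) S] by (simp only: sum_fixpts_block_graph[OF zero_less_Suc])
    qed
    ultimately show "wdet ?B k (of_real s) = wdet F (\<lambda>_. 1) (of_real s)" by simp
  qed
  \<comment> \<open>At 1 the exponent \<open>k\<close> no longer matters, which discards both the
    lag weights and the blocks.\<close>
  also have "wdet ?B k 1 = wdet E (\<lambda>_. 1) 1" by (rule det_block_graph[OF E.fin]) simp
  finally show ?thesis by (simp add: wdet_one)
qed

theorem theorem3p6:
  fixes E :: "('v,'e) graph" and F :: "('w,'f) graph" and R :: "complex set"
    and \<phi> :: "('v,'e) ncp set \<Rightarrow> ('w,'f) ncp set"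
  assumes "finite_graph E" "essential E" "strongly_connected E" "condition_L E"
    and "finite_graph F" "essential F" "strongly_connected F" "condition_L F"
    and "conj_closed_unital_subring R"
    and "star_iso R E F \<phi>"
    and "\<phi> ` lpa_diag R E \<subseteq> lpa_diag R F"
  shows "sgn (det_I_minus_adj E) = sgn (det_I_minus_adj F)"
proof -
  have E: "leavitt E R" and F: "leavitt F R" using assms by unfold_locales
  obtain h g where hg: "\<forall>y\<in>ipaths F. h y \<in> ipaths E \<and> g (h y) = y"
    "\<forall>x\<in>ipaths E. g x \<in> ipaths F \<and> h (g x) = x" "tail_map E F h" "tail_map F E g"
    using star_iso_tail_maps[OF E F assms(10,11)] by blast
  interpret coe E F h g using assms hg by unfold_locales auto
  show ?thesis using det_eq by simp
qed

end
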